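(* Let $\mu,\nu\in\mathcal S_{00}$ and let $A=(A_t)_{t\ge0}$ and $B=(B_t)_{t\ge0}$ be the PCAFs of $X$ associated with $\mu$ and $\nu$, respectively, by the Revuz correspondence. Then, for any $\alpha,T>0$, $$\sup_{x\in S}E_x\Big[\sup_{0\le t\le T}|A_t-B_t|^2\Big]\le 18\big(\|R_\alpha\mu\|_\infty+\|R_\alpha\nu\|_\infty\big)\|R_\alpha\mu-R_\alpha\nu\|_\infty+4e^{2T}(1-e^{-\alpha T})\big(\|R_1\mu\|_\infty^2+\|R_1\nu\|_\infty^2\big).$$
   Context: Setting. $S$ is a locally compact separable metrizable space; $S_\Delta=S\cup\{\Delta\}$ is its one-point compactification ($\Delta$ isolated if $S$ is compact). Functions $f$ on $S$ are extended by $f(\Delta)=0$; $\inf\emptyset=\infty$. $X=(\Omega,\mathscr M,(X_t)_{t\in[0,\infty]},(P_x)_{x\in S_\Delta},(\theta_t)_{t\in[0,\infty]})$ is a standard process on $S$ (a normal, right-continuous strong Markov process with cemetery $\Delta$, having left limits and quasi-left-continuous on $[0,\zeta)$, where $\zeta=\inf\{t: X_t=\Delta\}$ is the lifetime; $X_\infty=\Delta$; $\theta_t$ are shift operators, $X_s\circ\theta_t=X_{s+t}$). $(\mathscr F_t)_{t\in[0,\infty]}$ is the minimum augmented admissible filtration. Standing assumption (duality and absolute continuity): there exist another standard process $\hat X$ on $S$ with laws $\hat P_x$, a $\sigma$-finite Borel measure $m$ on $S$ and a Borel measurable function $p:(0,\infty)\times S\times S\to[0,\infty]$ such that for all $s,t>0$,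 $x,y\in S$: $P_x(X_t\in dy)=p_t(x,y)\,m(dy)$; $\hat P_y(\hat X_t\in dx)=p_t(x,y)\,m(dx)$; $p_{t+s}(x,y)=\int_S p_t(x,z)p_s(z,y)\,m(dz)$. Notation. For $\alpha\ge0$: $r_\alpha(x,y)=\int_0^\infty e^{-\alpha t}p_t(x,y)\,dt$ and, for a Borel measure $\mu$, $R_\alpha\mu(x)=\int_S r_\alpha(x,y)\,\mu(dy)$ (the $\alpha$-potential). $\mu^E(dx)=1_E(x)\mu(dx)$. $\|f\|_\infty=\sup_{x\in S}|f(x)|$. For Borel $E\subseteq S$: $\sigma_E=\inf\{t\in(0,\infty):X_t\in E\}$, $\tau_E=\inf\{t\in[0,\infty):X_t\notin E\}$. A set is thin if it is contained in a nearly Borel set $B$ with $P_x(\sigma_B=0)=0$ for all $x$; a set is semipolar if it is contained in a countable union of thin sets. $\mathcal S_{00}$: finite Borel measures $\mu$ on $S$ charging no semipolar set with $\|R_1\mu\|_\infty<\infty$. A Borel measure $\mu$ is smooth ($\mu\in\mathcal S_1$) if it charges no semipolar set and there is an increasing sequence of Borel sets $E_n$ with $\bigcup_nE_n=S$, $\mu(E_n)<\infty$, $\|R_1\mu^{E_n}\|_\infty<\infty$ for all $n$, and $P_x(\lim_n\tau_{E_n}\ge\zeta)=1$ for all $x\in S$. One has $\mathcal S_{00}\subseteq\mathcal S_1$. PCAF: an $(\mathscr F_t)$-adapted non-negative process $A=(A_t)_{t\ge0}$ for which there is $\Lambda\in\mathscr F_\infty$ (a defining set) with $P_x(\Lambda)=1$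 for all $x\in S$, $\theta_t(\Lambda)\subseteq\Lambda$ for all $t\ge0$, and for every $\omega\in\Lambda$: $A_0(\omega)=0$, $t\mapsto A_t(\omega)\in[0,\infty]$ is continuous on $[0,\infty)$, $A_t(\omega)<\infty$ for $t<\zeta(\omega)$, $A_t(\omega)=A_{\zeta(\omega)}(\omega)$ for $t\ge\zeta(\omega)$, and $A_{t+s}(\omega)=A_t(\omega)+A_s(\theta_t\omega)$ for all $s,t\ge0$. Two PCAFs are equivalent if they coincide for all $t$ on a common defining set. Revuz correspondence (known): equivalence classes of PCAFs $A$ and smooth measures $\mu$ are in one-to-one correspondence, characterized by $E_x[\int_0^\infty e^{-\alpha t}f(X_t)\,dA_t]=\int_S r_\alpha(x,y)f(y)\,\mu(dy)$ for all $\alpha>0$, $x\in S$ and non-negative Borel $f$. *)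

theory Defs
  imports "HOL-Probability.Probability"
begin

section \<open>The state space with cemetery\<close>

text \<open>The point \<open>\<Delta>\<close> is \<^const>\<open>None\<close>, so \<open>S\<^sub>\<Delta>\<close> is the type \<open>'s option\<close> with the Alexandroff topology;
  \<^const>\<open>None\<close> is isolated iff \<open>S\<close> is compact.\<close>

abbreviation top_\<Delta> :: "'s::topological_space option topology" where
  "top_\<Delta> \<equiv> Alexandroff_compactification euclidean"

definition borel_\<Delta> :: "'s::topological_space option measure" where
  "borel_\<Delta> = sigma UNIV {U. openin top_\<Delta> U}"

definition ext_\<Delta> :: "('s \<Rightarrow> ennreal) \<Rightarrow> 's option \<Rightarrow> ennreal" where
  "ext_\<Delta> f = case_option 0 f"

section \<open>Processes and the minimum augmented admissible filtration\<close>

text \<open>Times in \<open>[0,\<infinity>]\<close> are \<^typ>\<open>ennreal\<close>. The field \<open>msp\<close> carries the measurable space \<open>(\<Omega>, \<M>)\<close>; only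
  its space and its sets matter.\<close>

record ('w, 's) process =
  msp :: "'w measure"
  path :: "ennreal \<Rightarrow> 'w \<Rightarrow> 's option"
  law :: "'s option \<Rightarrow> 'w measure"
  shift :: "ennreal \<Rightarrow> 'w \<Rightarrow> 'w"

definition raw_filtration :: "('w, 's::topological_space) process \<Rightarrow> ennreal \<Rightarrow> 'w measure" where
  "raw_filtration Z t = sigma (space (msp Z))
     {path Z s -` B \<inter> space (msp Z) | s B. s \<le> t \<and> B \<in> sets borel_\<Delta>}"

text \<open>The law \<open>P\<^sub>\<pi> = \<integral> P\<^sub>x \<pi>(dx)\<close> with initial distribution \<open>\<pi>\<close>, on the raw \<open>\<sigma>\<close>-algebra at time \<open>\<infinity>\<close>.\<close>

definition init_law :: "('w, 's::topological_space) process \<Rightarrow> 's option measure \<Rightarrow> 'w measure" where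
  "init_law Z \<pi> = measure_of (space (msp Z)) (sets (raw_filtration Z \<infinity>))
     (\<lambda>A. \<integral>\<^sup>+x. emeasure (law Z x) A \<partial>\<pi>)"

definition initial_distribution :: "'s::topological_space option measure \<Rightarrow> bool" where
  "initial_distribution \<pi> \<longleftrightarrow> prob_space \<pi> \<and> sets \<pi> = sets borel_\<Delta>"

text \<open>\<open>\<F>\<^sub>t\<close> is the intersection over all initial distributions \<open>\<pi>\<close> of the raw \<open>\<sigma>\<close>-algebra at time \<open>t\<close>
  augmented by the subsets of the \<open>P\<^sub>\<pi>\<close>-null sets of the raw \<open>\<sigma>\<close>-algebra at time \<open>\<infinity>\<close>. An event of \<open>\<F>\<^sub>\<infinity>\<close> need
  not lie in \<open>\<M>\<close>, but it lies in the completion of \<open>\<M>\<close> under every \<open>P\<^sub>x\<close>; this is why \<^const>\<open>completion\<close> and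
  almost-everywhere quantifiers appear below.\<close>

definition aug_filtration :: "('w, 's::topological_space) process \<Rightarrow> ennreal \<Rightarrow> 'w measure" where
  "aug_filtration Z t = sigma (space (msp Z))
     {A. A \<subseteq> space (msp Z) \<and>
         (\<forall>\<pi>. initial_distribution \<pi> \<longrightarrow>
            (\<exists>B\<in>sets (raw_filtration Z t). \<exists>N\<in>null_sets (init_law Z \<pi>). (A - B) \<union> (B - A) \<subseteq> N))}"

definition lifetime :: "('w, 's) process \<Rightarrow> 'w \<Rightarrow> ennreal" where
  "lifetime Z \<omega> = Inf {t. path Z t \<omega> = None}"

section \<open>Standard processes\<close>

definition normal_process :: "('w, 's::topological_space) process \<Rightarrow> bool" where
  "normal_process Z \<longleftrightarrow>
     (\<forall>x. prob_space (law Z x) \<and> sets (law Z x) = sets (msp Z)) \<and>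
     (\<forall>t. path Z t \<in> measurable (msp Z) borel_\<Delta>) \<and>
     (\<forall>t. \<forall>B\<in>sets borel_\<Delta>.
        (\<lambda>x. emeasure (law Z x) {\<omega>\<in>space (msp Z). path Z t \<omega> \<in> B}) \<in> borel_measurable borel_\<Delta>) \<and>
     (\<forall>x. AE \<omega> in law Z x. path Z 0 \<omega> = x)"

definition cemetery_trap :: "('w, 's) process \<Rightarrow> bool" where
  "cemetery_trap Z \<longleftrightarrow>
     (\<forall>\<omega>\<in>space (msp Z). path Z \<infinity> \<omega> = None \<and>
        (\<forall>s t. s \<le> t \<longrightarrow> path Z s \<omega> = None \<longrightarrow> path Z t \<omega> = None))"

definition shift_operators :: "('w, 's) process \<Rightarrow> bool" where
  "shift_operators Z \<longleftrightarrow>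
     (\<forall>t. \<forall>\<omega>\<in>space (msp Z). shift Z t \<omega> \<in> space (msp Z) \<and>
        (\<forall>s. path Z s (shift Z t \<omega>) = path Z (s + t) \<omega>))"

definition right_continuous_paths :: "('w, 's::topological_space) process \<Rightarrow> bool" where
  "right_continuous_paths Z \<longleftrightarrow>
     (\<forall>\<omega>\<in>space (msp Z). \<forall>t<\<infinity>. limitin top_\<Delta> (\<lambda>s. path Z s \<omega>) (path Z t \<omega>) (at_right t))"

definition left_limits_before_lifetime :: "('w, 's::topological_space) process \<Rightarrow> bool" where
  "left_limits_before_lifetime Z \<longleftrightarrow>
     (\<forall>x. AE \<omega> in law Z x. \<forall>t. 0 < t \<and> t < lifetime Z \<omega> \<longrightarrow>
        (\<exists>y. limitin top_\<Delta> (\<lambda>s. path Z s \<omega>) y (at_left t)))"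

text \<open>The strong Markov property \<open>P\<^sub>x(X\<^bsub>T+s\<^esub> \<in> B | \<F>\<^sub>T) = P\<^bsub>X\<^sub>T\<^esub>(X\<^sub>s \<in> B)\<close>, written out over the events of \<open>\<F>\<^sub>T\<close>.
  As usual, right-continuity of the filtration is part of it. On \<open>T = \<infinity>\<close> it is trivial, as \<open>X\<^sub>\<infinity> = \<Delta>\<close>.\<close>

definition strong_Markov :: "('w, 's::topological_space) process \<Rightarrow> bool" where
  "strong_Markov Z \<longleftrightarrow>
     (\<forall>t<\<infinity>. sets (aug_filtration Z t) = (\<Inter>u\<in>{t<..}. sets (aug_filtration Z u))) \<and>
     (\<forall>T x s. \<forall>B\<in>sets borel_\<Delta>. stopping_time (aug_filtration Z) T \<longrightarrow>
        (\<forall>\<Lambda>\<in>sets (filtration.pre_sigma (space (msp Z)) (aug_filtration Z) T).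
           emeasure (completion (law Z x)) {\<omega>\<in>\<Lambda>. path Z (T \<omega> + s) \<omega> \<in> B} =
           (\<integral>\<^sup>+\<omega>\<in>\<Lambda>. emeasure (law Z (path Z (T \<omega>) \<omega>)) {\<omega>'\<in>space (msp Z). path Z s \<omega>' \<in> B}
              \<partial>completion (law Z x))))"

definition quasi_left_continuous :: "('w, 's::topological_space) process \<Rightarrow> bool" where
  "quasi_left_continuous Z \<longleftrightarrow>
     (\<forall>T :: nat \<Rightarrow> 'w \<Rightarrow> ennreal.
        (\<forall>n. stopping_time (aug_filtration Z) (T n)) \<and>
        (\<forall>\<omega>\<in>space (msp Z). incseq (\<lambda>n. T n \<omega>)) \<longrightarrow>
        (\<forall>x. AE \<omega> in law Z x. (SUP n. T n \<omega>) < lifetime Z \<omega> \<longrightarrow>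
           limitin top_\<Delta> (\<lambda>n. path Z (T n \<omega>) \<omega>) (path Z (SUP n. T n \<omega>) \<omega>) sequentially))"

definition standard_process :: "('w, 's::topological_space) process \<Rightarrow> bool" where
  "standard_process Z \<longleftrightarrow>
     normal_process Z \<and> cemetery_trap Z \<and> shift_operators Z \<and>
     right_continuous_paths Z \<and> left_limits_before_lifetime Z \<and>
     strong_Markov Z \<and> quasi_left_continuous Z"

section \<open>Duality, absolute continuity and potentials\<close>

definition duality_density ::
  "('w, 's::topological_space) process \<Rightarrow> ('v, 's) process \<Rightarrow> 's measure \<Rightarrow>
   (real \<Rightarrow> 's \<Rightarrow> 's \<Rightarrow> ennreal) \<Rightarrow> bool" where
  "duality_density Z Zh m p \<longleftrightarrow>
     sets m = sets borel \<and> sigma_finite_measure m \<and>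
     (\<lambda>(t, x, y). p t x y) \<in>
        borel_measurable (restrict_space borel {0<..} \<Otimes>\<^sub>M (borel \<Otimes>\<^sub>M borel)) \<and>
     (\<forall>t>0. \<forall>x. \<forall>C\<in>sets borel.
        emeasure (law Z (Some x)) {\<omega>\<in>space (msp Z). path Z (ennreal t) \<omega> \<in> Some ` C} =
        (\<integral>\<^sup>+y\<in>C. p t x y \<partial>m)) \<and>
     (\<forall>t>0. \<forall>y. \<forall>C\<in>sets borel.
        emeasure (law Zh (Some y)) {\<omega>\<in>space (msp Zh). path Zh (ennreal t) \<omega> \<in> Some ` C} =
        (\<integral>\<^sup>+x\<in>C. p t x y \<partial>m)) \<and>
     (\<forall>s>0. \<forall>t>0. \<forall>x y. p (t + s) x y = (\<integral>\<^sup>+z. p t x z * p s z y \<partial>m))"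

definition resolvent_density :: "(real \<Rightarrow> 's \<Rightarrow> 's \<Rightarrow> ennreal) \<Rightarrow> real \<Rightarrow> 's \<Rightarrow> 's \<Rightarrow> ennreal" where
  "resolvent_density p \<alpha> x y = (\<integral>\<^sup>+t\<in>{0<..}. ennreal (exp (- \<alpha> * t)) * p t x y \<partial>lborel)"

definition potential ::
  "(real \<Rightarrow> 's \<Rightarrow> 's \<Rightarrow> ennreal) \<Rightarrow> real \<Rightarrow> 's measure \<Rightarrow> 's \<Rightarrow> ennreal" where
  "potential p \<alpha> \<mu> x = (\<integral>\<^sup>+y. resolvent_density p \<alpha> x y \<partial>\<mu>)"

definition sup_norm :: "('s \<Rightarrow> ennreal) \<Rightarrow> ennreal" where
  "sup_norm f = (SUP x. f x)"

text \<open>\<open>|a - b|\<close> in \<open>[0,\<infinity>]\<close>; subtraction on \<^typ>\<open>ennreal\<close> is truncated at \<open>0\<close>.\<close>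

definition abs_diff :: "ennreal \<Rightarrow> ennreal \<Rightarrow> ennreal" where
  "abs_diff a b = max (a - b) (b - a)"

section \<open>Semipolar sets and the class \<open>S\<^sub>0\<^sub>0\<close>\<close>

definition hitting_time :: "('w, 's) process \<Rightarrow> 's set \<Rightarrow> 'w \<Rightarrow> ennreal" where
  "hitting_time Z E \<omega> = Inf {t. 0 < t \<and> t < \<infinity> \<and> path Z t \<omega> \<in> Some ` E}"

definition nearly_Borel :: "('w, 's::topological_space) process \<Rightarrow> 's set \<Rightarrow> bool" where
  "nearly_Borel Z B \<longleftrightarrow>
     (\<forall>\<pi>. initial_distribution \<pi> \<longrightarrow>
        (\<exists>B1\<in>sets borel. \<exists>B2\<in>sets borel. B1 \<subseteq> B \<and> B \<subseteq> B2 \<and>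
           (AE \<omega> in init_law Z \<pi>. \<forall>t. path Z t \<omega> \<notin> Some ` (B2 - B1))))"

definition thin :: "('w, 's::topological_space) process \<Rightarrow> 's set \<Rightarrow> bool" where
  "thin Z E \<longleftrightarrow>
     (\<exists>B. E \<subseteq> B \<and> nearly_Borel Z B \<and> (\<forall>x. AE \<omega> in law Z (Some x). hitting_time Z B \<omega> \<noteq> 0))"

definition semipolar :: "('w, 's::topological_space) process \<Rightarrow> 's set \<Rightarrow> bool" where
  "semipolar Z E \<longleftrightarrow> (\<exists>C :: nat \<Rightarrow> 's set. (\<forall>n. thin Z (C n)) \<and> E \<subseteq> (\<Union>n. C n))"

text \<open>Semipolar sets need not be Borel, hence the completion of \<open>\<mu>\<close>.\<close>

definition S00 ::
  "('w, 's::topological_space) process \<Rightarrow> (real \<Rightarrow> 's \<Rightarrow> 's \<Rightarrow> ennreal) \<Rightarrow> 's measure set" where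
  "S00 Z p = {\<mu>. sets \<mu> = sets borel \<and> finite_measure \<mu> \<and>
     (\<forall>E. semipolar Z E \<longrightarrow> E \<in> null_sets (completion \<mu>)) \<and>
     sup_norm (potential p 1 \<mu>) < \<infinity>}"

section \<open>Positive continuous additive functionals and the Revuz correspondence\<close>

definition defining_set ::
  "('w, 's::topological_space) process \<Rightarrow> (real \<Rightarrow> 'w \<Rightarrow> ennreal) \<Rightarrow> 'w set \<Rightarrow> bool" where
  "defining_set Z A \<Lambda> \<longleftrightarrow>
     \<Lambda> \<in> sets (aug_filtration Z \<infinity>) \<and>
     (\<forall>x. AE \<omega> in law Z (Some x). \<omega> \<in> \<Lambda>) \<and>
     (\<forall>t\<ge>0::real. shift Z (ennreal t) ` \<Lambda> \<subseteq> \<Lambda>) \<and>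
     (\<forall>\<omega>\<in>\<Lambda>.
        A 0 \<omega> = 0 \<and>
        continuous_on {0..} (\<lambda>t. A t \<omega>) \<and>
        (\<forall>t\<ge>0. ennreal t < lifetime Z \<omega> \<longrightarrow> A t \<omega> < \<infinity>) \<and>
        (\<forall>t\<ge>0. lifetime Z \<omega> \<le> ennreal t \<longrightarrow> A t \<omega> = A (enn2real (lifetime Z \<omega>)) \<omega>) \<and>
        (\<forall>s\<ge>0. \<forall>t\<ge>0. A (t + s) \<omega> = A t \<omega> + A s (shift Z (ennreal t) \<omega>)))"

text \<open>The index of \<open>A\<close> is a real number, of which only the values \<open>t \<ge> 0\<close> are used.\<close>

definition PCAF ::
  "('w, 's::topological_space) process \<Rightarrow> (real \<Rightarrow> 'w \<Rightarrow> ennreal) \<Rightarrow> bool" where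
  "PCAF Z A \<longleftrightarrow>
     (\<forall>t\<ge>0. A t \<in> borel_measurable (aug_filtration Z (ennreal t))) \<and>
     (\<exists>\<Lambda>. defining_set Z A \<Lambda>)"

text \<open>The integral \<open>\<integral>\<^sub>0\<^sup>\<infinity> g(t) da(t)\<close> for a continuous nondecreasing \<open>a : [0,\<infinity>) \<rightarrow> [0,\<infinity>]\<close> with \<open>a(0) = 0\<close>. A PCAF may
  reach \<open>\<infinity>\<close> at the lifetime; \<open>da\<close> lives on the times before \<open>a\<close> becomes infinite, so it is the increasing
  limit of the Stieltjes measures of the stopped, finite functions \<open>t \<mapsto> a(min t u)\<close> with \<open>a(u) < \<infinity>\<close>.\<close>

definition stieltjes_integral :: "(real \<Rightarrow> ennreal) \<Rightarrow> (real \<Rightarrow> ennreal) \<Rightarrow> ennreal" where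
  "stieltjes_integral g a =
     (SUP u\<in>{u. 0 \<le> u \<and> a u < \<infinity>}.
        \<integral>\<^sup>+t. g t \<partial>interval_measure (\<lambda>t. enn2real (a (min (max 0 t) u))))"

definition Revuz ::
  "('w, 's::topological_space) process \<Rightarrow> (real \<Rightarrow> 's \<Rightarrow> 's \<Rightarrow> ennreal) \<Rightarrow>
   (real \<Rightarrow> 'w \<Rightarrow> ennreal) \<Rightarrow> 's measure \<Rightarrow> bool" where
  "Revuz Z p A \<mu> \<longleftrightarrow>
     (\<forall>\<alpha>>0. \<forall>x. \<forall>f\<in>borel_measurable borel.
        (\<integral>\<^sup>+\<omega>. stieltjes_integral
            (\<lambda>t. ennreal (exp (- \<alpha> * t)) * ext_\<Delta> f (path Z (ennreal t) \<omega>)) (\<lambda>t. A t \<omega>)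
           \<partial>law Z (Some x)) =
        (\<integral>\<^sup>+y. resolvent_density p \<alpha> x y * f y \<partial>\<mu>))"

end

theory Submission
  imports Defs
begin

text \<open>
  Put \<open>D = A - B\<close>, \<open>q = 1 - e\<^sup>-\<^sup>\<alpha>\<^sup>T\<close> and let \<open>D'\<close> be the discounted functional \<open>D'\<^sub>t = \<integral>\<^sub>0\<^sup>t e\<^sup>-\<^sup>\<alpha>\<^sup>s dD\<^sub>s\<close>. For
  \<open>t \<le> T\<close> and \<open>y = max A\<^sub>T B\<^sub>T\<close> one has \<open>|D\<^sub>t| \<le> y\<close> and \<open>|D\<^sub>t| \<le> |D'\<^sub>t| + q y\<close>, hence \<open>D\<^sub>t\<^sup>2 \<le> D'\<^sub>t\<^sup>2 + 2 q y\<^sup>2\<close>.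
  The Markov property bounds the second moment of \<open>A\<^sub>T\<close> by \<open>2 e\<^sup>2\<^sup>T \<parallel>R\<^sub>1\<mu>\<parallel>\<^sup>2\<close>. With \<open>h = R\<^sub>\<alpha>\<mu> - R\<^sub>\<alpha>\<nu>\<close> the process
  \<open>N\<^sub>t = D'\<^sub>t + e\<^sup>-\<^sup>\<alpha>\<^sup>t h(X\<^sub>t)\<close> is a martingale whose second moment is at most
  \<open>2 \<parallel>h\<parallel> (\<parallel>R\<^sub>\<alpha>\<mu>\<parallel> + \<parallel>R\<^sub>\<alpha>\<nu>\<parallel>)\<close>, up to the quadratic variation of \<open>D'\<close>, which vanishes by continuity; Doob's
  \<open>L\<^sup>2\<close> inequality then gives \<open>E sup D'\<^sup>2 \<le> 2 \<cdot> 4 \<cdot> 2 \<parallel>h\<parallel> (\<dots>) + 2 \<parallel>h\<parallel>\<^sup>2 \<le> 18 \<parallel>h\<parallel> (\<dots>)\<close>. All of this is carried out along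
  dyadic grids, with Riemann sums in place of the integral, so that only discrete martingales occur.
\<close>

section \<open>Discrete square-integrable martingales\<close>

text \<open>Two obstacles lie behind the grids. The Stieltjes integral along a path is not known to
  be measurable, whereas a Riemann sum is, and its potential differs from
  \<open>potential p \<alpha> \<mu>\<close> only by a factor between exp(-\<alpha> \<eta>) and 1,
  which tends to 1 with the mesh. Moreover an event of the augmented filtration is Borel only up to
  a null set that depends on the initial law, so that E_y[C] is not known to be Borel in y for a
  functional C; the Markov property is therefore stated with a version chosen anew for each starting
  point and time. The bound for the second moment of N = D + y, with y uniformly small, comes from
  an expansion in which the past value of D multiplies only martingale increments. What survives
  carries a factor y, except for the squared increments of D, and the remaining factors add up to
  the nonnegative martingales U + Y and V + W, whose means are known at time 0. The second moment of
  A_T rests on the discrete form of A_T^2 = 2 int (A_T - A_s) dA_s, whose inner factor is the future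
  that the Markov property controls.\<close>

text \<open>The sum on the right is a discrete stochastic integral of a predictable process, so that its expectation
  vanishes when \<open>N\<close> is a martingale, which leaves Doob's \<open>L\<^sup>2\<close> inequality.\<close>

lemma pathwise_Doob:
  fixes N :: "nat \<Rightarrow> real" and S :: "nat \<Rightarrow> real"
  defines "S \<equiv> \<lambda>k. Max ((\<lambda>i. \<bar>N i\<bar>) ` {..k})"
  shows "(S n)\<^sup>2 \<le> 4 * (N n)\<^sup>2 - 4 * (\<Sum>k<n. S k * sgn (N k) * (N (Suc k) - N k))"
proof -
  have S_Suc: "S (Suc k) = max (S k) \<bar>N (Suc k)\<bar>" for k
    by (simp add: S_def atMost_Suc max.commute)
  have S_nn: "0 \<le> S k" for k
    unfolding S_def by (rule order_trans[OF abs_ge_zero[of "N 0"]]) (auto intro!: Max_ge)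
  have S_ge: "\<bar>N k\<bar> \<le> S k" for k
    unfolding S_def by (auto intro!: Max_ge)
  \<comment> \<open>Strengthened for the induction: increments of |N| replace the signed ones. If
    the running maximum does not move, both sides grow by the same amount; if it jumps to |N (Suc
    n)|, the slack is twice a perfect square. One more square then leads to 4 (N n)^2.\<close>
  have *: "(S n)\<^sup>2 + 4 * (\<Sum>k<n. S k * (\<bar>N (Suc k)\<bar> - \<bar>N k\<bar>)) \<le> 4 * S n * \<bar>N n\<bar> - 2 * (S n)\<^sup>2 + (S n)\<^sup>2"
  proof (induction n)
    case 0
    have "S 0 = \<bar>N 0\<bar>" by (simp add: S_def)
    then show ?case by (simp add: power2_eq_square)
  next
    case (Suc n)
    show ?case
    proof (cases "\<bar>N (Suc n)\<bar> \<le> S n")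
      case True
      then have "S (Suc n) = S n" by (simp add: S_Suc)
      then show ?thesis using Suc by (simp add: algebra_simps)
    next
      case False
      then have e: "S (Suc n) = \<bar>N (Suc n)\<bar>" by (simp add: S_Suc)
      have "0 \<le> (\<bar>N (Suc n)\<bar> - S n)\<^sup>2" by simp
      then show ?thesis using Suc unfolding e
        by (simp add: algebra_simps power2_eq_square)
    qed
  qed
  have "4 * S n * \<bar>N n\<bar> - 2 * (S n)\<^sup>2 + (S n)\<^sup>2 \<le> 4 * (N n)\<^sup>2"
  proof -
    have "0 \<le> (S n - 2 * \<bar>N n\<bar>)\<^sup>2" by simp
    then show ?thesis by (simp add: power2_eq_square algebra_simps)
  qed
  \<comment> \<open>Tangent inequality for the convex function |.|. It makes the sum linear in the
    increments of N, which is what an expectation can annihilate.\<close>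
  moreover have "(\<Sum>k<n. S k * sgn (N k) * (N (Suc k) - N k)) \<le> (\<Sum>k<n. S k * (\<bar>N (Suc k)\<bar> - \<bar>N k\<bar>))"
  proof (rule sum_mono)
    fix k
    have "sgn (N k) * (N (Suc k) - N k) \<le> \<bar>N (Suc k)\<bar> - \<bar>N k\<bar>"
      by (auto simp: sgn_real_def abs_if)
    then show "S k * sgn (N k) * (N (Suc k) - N k) \<le> S k * (\<bar>N (Suc k)\<bar> - \<bar>N k\<bar>)"
      unfolding mult.assoc by (rule mult_left_mono) (rule S_nn)
  qed
  ultimately show ?thesis using * by linarith
qed

section \<open>Square-integrable functions and orthogonality of martingale increments\<close>

definition "square_integrable M (f :: 'a \<Rightarrow> real) \<longleftrightarrow> f \<in> borel_measurable M \<and> integrable M (\<lambda>x. (f x)\<^sup>2)"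

lemma square_integrable_mult:
  assumes "square_integrable M f" "square_integrable M g"
  shows "integrable M (\<lambda>x. f x * g x)"
proof (rule Bochner_Integration.integrable_bound)
  show "integrable M (\<lambda>x. (f x)\<^sup>2 + (g x)\<^sup>2)" using assms by (simp add: square_integrable_def)
  show "(\<lambda>x. f x * g x) \<in> borel_measurable M"
    using assms by (intro borel_measurable_times) (auto simp: square_integrable_def)
  have "\<bar>f x * g x\<bar> \<le> (f x)\<^sup>2 + (g x)\<^sup>2" for x
  proof -
    have "0 \<le> (\<bar>f x\<bar> - \<bar>g x\<bar>)\<^sup>2" by simp
    moreover have "0 \<le> \<bar>f x\<bar> * \<bar>g x\<bar>" by simp
    ultimately show ?thesis unfolding abs_mult power2_diff power2_abs by linarith
  qed
  then show "AE x in M. norm (f x * g x) \<le> norm ((f x)\<^sup>2 + (g x)\<^sup>2)" by simp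
qed

lemma square_integrable_add:
  assumes "square_integrable M f" "square_integrable M g"
  shows "square_integrable M (\<lambda>x. f x + g x)"
  using assms square_integrable_mult[OF assms]
  by (auto simp: square_integrable_def power2_sum mult.assoc)

lemma square_integrable_diff:
  assumes "square_integrable M f" "square_integrable M g"
  shows "square_integrable M (\<lambda>x. f x - g x)"
  using assms square_integrable_mult[OF assms]
  by (auto simp: square_integrable_def power2_diff mult.assoc)

lemma (in prob_space) square_integrable_bounded:
  assumes "f \<in> borel_measurable M" "AE x in M. \<bar>f x\<bar> \<le> c"
  shows "square_integrable M f"
  unfolding square_integrable_def
proof (intro conjI assms(1))
  show "integrable M (\<lambda>x. (f x)\<^sup>2)"
  proof (rule integrable_const_bound[where B="c\<^sup>2"])
    show "AE x in M. norm ((f x)\<^sup>2) \<le> c\<^sup>2"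
      using assms(2) by eventually_elim (simp add: abs_le_square_iff[symmetric])
  qed (use assms(1) in measurable)
qed

lemma (in prob_space) square_integrable_integrable:
  "square_integrable M f \<Longrightarrow> integrable M f"
  using square_integrable_mult[of M f "\<lambda>_. 1"] by (simp add: square_integrable_def)

lemma square_integrable_le:
  assumes "square_integrable M g" "f \<in> borel_measurable M" "AE x in M. \<bar>f x\<bar> \<le> \<bar>g x\<bar>"
  shows "square_integrable M f"
  unfolding square_integrable_def
proof (intro conjI assms(2))
  show "integrable M (\<lambda>x. (f x)\<^sup>2)"
  proof (rule Bochner_Integration.integrable_bound)
    show "integrable M (\<lambda>x. (g x)\<^sup>2)" using assms(1) by (simp add: square_integrable_def)
    show "AE x in M. norm ((f x)\<^sup>2) \<le> norm ((g x)\<^sup>2)"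
      using assms(3) by eventually_elim (simp add: abs_le_square_iff[symmetric])
  qed (use assms(2) in measurable)
qed

text \<open>Vanishing integrals over all of F mean that the conditional expectation of d given F is
  zero, and the F-measurable factor Z can be pulled out of it. Square integrability of both factors
  makes the product integrable without bounding Z.\<close>

lemma (in prob_space) orthogonal_of_set_integral_zero:
  assumes F: "subalgebra M F" and d: "square_integrable M d" and Z: "square_integrable M Z"
    and ZF: "Z \<in> borel_measurable F" and 0: "\<And>A. A \<in> sets F \<Longrightarrow> (\<integral>x\<in>A. d x \<partial>M) = 0"
  shows "(\<integral>x. Z x * d x \<partial>M) = 0"
proof -
  interpret finite_measure_subalgebra M F
    by standard (rule F)
  have "AE x in M. real_cond_exp M F d x = 0"
    by (rule real_cond_exp_charact) (use 0 square_integrable_integrable[OF d] in auto)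
  then have "(\<integral>x. Z x * real_cond_exp M F d x \<partial>M) = (\<integral>x. 0 \<partial>M)"
    by (intro integral_cong_AE) (use measurable_from_subalg[OF F ZF] in auto)
  then show ?thesis
    using real_cond_exp_intg(2)[OF square_integrable_mult[OF Z d] ZF] d
    by (simp add: square_integrable_def)
qed

section \<open>Energy and maximal inequalities for the difference of two potentials\<close>

text \<open>\<open>U\<close> and \<open>V\<close> are increasing, \<open>Y\<close> and \<open>W\<close> their potentials, so \<open>U + Y\<close> and \<open>V + W\<close> are martingales.\<close>

locale potential_pair = prob_space +
  fixes F :: "nat \<Rightarrow> 'a measure" and U V Y W :: "nat \<Rightarrow> 'a \<Rightarrow> real" and c \<epsilon> :: real
  assumes F: "\<And>i. subalgebra M (F i)"
    and F_mono: "\<And>i j. i \<le> j \<Longrightarrow> sets (F i) \<subseteq> sets (F j)"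
    and meas_F: "\<And>i. U i \<in> borel_measurable (F i)" "\<And>i. V i \<in> borel_measurable (F i)"
      "\<And>i. Y i \<in> borel_measurable (F i)" "\<And>i. W i \<in> borel_measurable (F i)"
    and zero: "\<And>x. U 0 x = 0" "\<And>x. V 0 x = 0"
    and mono: "\<And>i. AE x in M. U i x \<le> U (Suc i) x" "\<And>i. AE x in M. V i x \<le> V (Suc i) x"
    and sq_UV: "\<And>i. square_integrable M (U i)" "\<And>i. square_integrable M (V i)"
    and bound: "\<And>i. AE x in M. 0 \<le> Y i x \<and> Y i x \<le> c" "\<And>i. AE x in M. 0 \<le> W i x \<and> W i x \<le> c"
    and close: "\<And>i. AE x in M. \<bar>Y i x - W i x\<bar> \<le> \<epsilon>"
    and mart: "\<And>i A. A \<in> sets (F i) \<Longrightarrow> (\<integral>x\<in>A. U (Suc i) x + Y (Suc i) x \<partial>M) = (\<integral>x\<in>A. U i x + Y i x \<partial>M)"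
      "\<And>i A. A \<in> sets (F i) \<Longrightarrow> (\<integral>x\<in>A. V (Suc i) x + W (Suc i) x \<partial>M) = (\<integral>x\<in>A. V i x + W i x \<partial>M)"
begin

definition "D i x = U i x - V i x"
definition "y i x = Y i x - W i x"
definition "N i x = D i x + y i x"

lemma meas_M: "U i \<in> borel_measurable M" "V i \<in> borel_measurable M" "Y i \<in> borel_measurable M" "W i \<in> borel_measurable M"
  by (rule measurable_from_subalg[OF F meas_F(1)] measurable_from_subalg[OF F meas_F(2)]
      measurable_from_subalg[OF F meas_F(3)] measurable_from_subalg[OF F meas_F(4)])+

lemma measF: "D i \<in> borel_measurable (F i)" "y i \<in> borel_measurable (F i)" "N i \<in> borel_measurable (F i)"
  using meas_F unfolding N_def D_def y_def by measurable

lemma sq_YW: "square_integrable M (Y i)" "square_integrable M (W i)"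
proof -
  have "AE x in M. \<bar>Y i x\<bar> \<le> c" using bound(1)[of i] by eventually_elim simp
  then show "square_integrable M (Y i)" by (rule square_integrable_bounded[OF meas_M(3)])
  have "AE x in M. \<bar>W i x\<bar> \<le> c" using bound(2)[of i] by eventually_elim simp
  then show "square_integrable M (W i)" by (rule square_integrable_bounded[OF meas_M(4)])
qed

lemma sq: "square_integrable M (D i)" "square_integrable M (y i)" "square_integrable M (N i)"
  unfolding N_def D_def y_def by (intro square_integrable_add square_integrable_diff sq_YW sq_UV)+

lemma increment_orthogonal:
  assumes "square_integrable M Z" "Z \<in> borel_measurable (F i)"
  shows "(\<integral>x. Z x * (N (Suc i) x - N i x) \<partial>M) = 0"
proof (rule orthogonal_of_set_integral_zero[OF F _ assms])
  show "square_integrable M (\<lambda>x. N (Suc i) x - N i x)" by (intro square_integrable_diff sq)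
  fix A assume A: "A \<in> sets (F i)"
  then have AM: "A \<in> sets M" using F[of i] by (auto simp: subalgebra_def)
  have int: "set_integrable M A (\<lambda>x. f x)" if "square_integrable M f" for f
    unfolding set_integrable_def using integrable_mult_indicator[OF AM square_integrable_integrable[OF that]] .
  have "(\<integral>x\<in>A. N (Suc i) x - N i x \<partial>M) =
      (\<integral>x\<in>A. (U (Suc i) x + Y (Suc i) x) - (U i x + Y i x) - ((V (Suc i) x + W (Suc i) x) - (V i x + W i x)) \<partial>M)"
    by (simp add: N_def D_def y_def algebra_simps)
  also have "\<dots> = ((\<integral>x\<in>A. U (Suc i) x + Y (Suc i) x \<partial>M) - (\<integral>x\<in>A. U i x + Y i x \<partial>M))
      - ((\<integral>x\<in>A. V (Suc i) x + W (Suc i) x \<partial>M) - (\<integral>x\<in>A. V i x + W i x \<partial>M))"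
    by (simp add: set_integral_diff set_integral_add int square_integrable_add square_integrable_diff sq_UV sq_YW)
  finally show "(\<integral>x\<in>A. N (Suc i) x - N i x \<partial>M) = 0" using mart[OF A] by simp
qed

text \<open>Write d for the increment of D. Then N_(k+1)^2 - N_k^2 equals y_(k+1)^2 - y_k^2 + d^2 +
  2 d y_(k+1) plus 2 D_k (N_(k+1) - N_k). The last term has mean zero because D_k is known at stage
  k, so D itself never enters the energy, only its increments do.\<close>

lemma energy_identity:
  "(\<integral>x. (N k x)\<^sup>2 \<partial>M) = (\<integral>x. (y k x)\<^sup>2 \<partial>M)
    + (\<Sum>i<k. (\<integral>x. (D (Suc i) x - D i x)\<^sup>2 \<partial>M) + 2 * (\<integral>x. (D (Suc i) x - D i x) * y (Suc i) x \<partial>M))"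
proof (induction k)
  case 0
  have "D 0 x = 0" for x by (simp add: D_def zero)
  then show ?case by (simp add: N_def)
next
  case (Suc k)
  let ?d = "\<lambda>x. D (Suc k) x - D k x"
  have sqd: "square_integrable M ?d" by (intro square_integrable_diff sq)
  note i = square_integrable_mult[OF sq(1) sq(2), of k k] square_integrable_mult[OF sqd sq(2)[of "Suc k"]]
    square_integrable_mult[OF sq(1)[of k] square_integrable_diff[OF sq(3)[of "Suc k"] sq(3)[of k]]]
    sqd[unfolded square_integrable_def, THEN conjunct2]
    sq(2)[unfolded square_integrable_def, THEN conjunct2] sq(3)[unfolded square_integrable_def, THEN conjunct2]
  have "(\<integral>x. (N (Suc k) x)\<^sup>2 \<partial>M) = (\<integral>x. (N k x)\<^sup>2 - (y k x)\<^sup>2 + 2 * (D k x * (N (Suc k) x - N k x))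
      + (?d x)\<^sup>2 + 2 * (?d x * y (Suc k) x) + (y (Suc k) x)\<^sup>2 \<partial>M)"
    by (intro Bochner_Integration.integral_cong) (simp_all add: N_def power2_eq_square algebra_simps)
  also have "\<dots> = (\<integral>x. (N k x)\<^sup>2 \<partial>M) - (\<integral>x. (y k x)\<^sup>2 \<partial>M) + 2 * (\<integral>x. D k x * (N (Suc k) x - N k x) \<partial>M)
      + (\<integral>x. (?d x)\<^sup>2 \<partial>M) + 2 * (\<integral>x. ?d x * y (Suc k) x \<partial>M) + (\<integral>x. (y (Suc k) x)\<^sup>2 \<partial>M)"
    using i by simp
  finally show ?case
    using Suc increment_orthogonal[OF sq(1) measF(1)] by simp
qed

lemma expectation_potential: "(\<integral>x. U k x + Y k x \<partial>M) = (\<integral>x. Y 0 x \<partial>M)" "(\<integral>x. V k x + W k x \<partial>M) = (\<integral>x. W 0 x \<partial>M)"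
proof -
  have sp: "space M \<in> sets (F i)" "integrable M (U i)" "integrable M (Y i)" "integrable M (V i)" "integrable M (W i)" for i
    using F[of i] sets.top[of "F i"] square_integrable_integrable sq_UV sq_YW by (auto simp: subalgebra_def)
  have *: "(\<integral>x\<in>space M. f x \<partial>M) = (\<integral>x. f x \<partial>M)" if "integrable M f" for f :: "'a \<Rightarrow> real"
    using that by (rule set_integral_space)
  show "(\<integral>x. U k x + Y k x \<partial>M) = (\<integral>x. Y 0 x \<partial>M)"
  proof (induction k)
    case (Suc k)
    then show ?case using mart(1)[OF sp(1), of k] sp by (simp add: *)
  qed (simp add: zero)
  show "(\<integral>x. V k x + W k x \<partial>M) = (\<integral>x. W 0 x \<partial>M)"
  proof (induction k)
    case (Suc k)
    then show ?case using mart(2)[OF sp(1), of k] sp by (simp add: *)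
  qed (simp add: zero)
qed

text \<open>One factor y is bounded by \<epsilon> and the other factor by a sum instead of a
  difference: y^2 by \<epsilon> (Y + W), and the increment of D by the sum of the increments of U
  and V, which then telescopes.\<close>

lemma energy_bound:
  "(\<integral>x. (N k x)\<^sup>2 \<partial>M) \<le> 2 * \<epsilon> * ((\<integral>x. Y 0 x \<partial>M) + (\<integral>x. W 0 x \<partial>M)) + (\<Sum>i<k. (\<integral>x. (D (Suc i) x - D i x)\<^sup>2 \<partial>M))"
proof -
  note int[simp] = square_integrable_integrable[OF sq_UV(1)] square_integrable_integrable[OF sq_UV(2)]
    square_integrable_integrable[OF sq_YW(1)] square_integrable_integrable[OF sq_YW(2)]
  have y: "(\<integral>x. (y k x)\<^sup>2 \<partial>M) \<le> (\<integral>x. \<epsilon> * (Y k x + W k x) \<partial>M)"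
  proof (rule integral_mono_AE)
    show "AE x in M. (y k x)\<^sup>2 \<le> \<epsilon> * (Y k x + W k x)"
      using close[of k] bound(1)[of k] bound(2)[of k]
    proof eventually_elim
      case (elim x)
      have "(y k x)\<^sup>2 = \<bar>y k x\<bar> * \<bar>y k x\<bar>" by (simp add: power2_eq_square)
      also have "\<dots> \<le> \<epsilon> * (Y k x + W k x)"
        using elim unfolding y_def by (intro mult_mono) auto
      finally show ?case .
    qed
  qed (use sq(2) in \<open>auto simp: square_integrable_def\<close>)
  have d: "(\<integral>x. (D (Suc i) x - D i x) * y (Suc i) x \<partial>M) \<le> (\<integral>x. \<epsilon> * ((U (Suc i) x - U i x) + (V (Suc i) x - V i x)) \<partial>M)" for i
  proof (rule integral_mono_AE)
    show "integrable M (\<lambda>x. (D (Suc i) x - D i x) * y (Suc i) x)"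
      by (intro square_integrable_mult square_integrable_diff sq)
    show "AE x in M. (D (Suc i) x - D i x) * y (Suc i) x \<le> \<epsilon> * ((U (Suc i) x - U i x) + (V (Suc i) x - V i x))"
      using close[of "Suc i"] mono(1)[of i] mono(2)[of i]
    proof eventually_elim
      case (elim x)
      have "(D (Suc i) x - D i x) * y (Suc i) x \<le> \<bar>y (Suc i) x\<bar> * \<bar>D (Suc i) x - D i x\<bar>"
        by (metis abs_ge_self abs_mult mult.commute)
      also have "\<dots> \<le> \<epsilon> * ((U (Suc i) x - U i x) + (V (Suc i) x - V i x))"
        using elim unfolding y_def D_def by (intro mult_mono) auto
      finally show ?case .
    qed
  qed simp
  have "(\<integral>x. (N k x)\<^sup>2 \<partial>M) \<le> (\<integral>x. \<epsilon> * (Y k x + W k x) \<partial>M)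
    + (\<Sum>i<k. (\<integral>x. (D (Suc i) x - D i x)\<^sup>2 \<partial>M) + 2 * (\<integral>x. \<epsilon> * ((U (Suc i) x - U i x) + (V (Suc i) x - V i x)) \<partial>M))"
    unfolding energy_identity[of k] by (intro add_mono y sum_mono mult_left_mono d order_refl) simp
  also have "\<dots> = \<epsilon> * ((\<integral>x. Y k x \<partial>M) + (\<integral>x. W k x \<partial>M)) + (\<Sum>i<k. (\<integral>x. (D (Suc i) x - D i x)\<^sup>2 \<partial>M))
     + 2 * \<epsilon> * (\<Sum>i<k. ((\<integral>x. U (Suc i) x \<partial>M) + (\<integral>x. V (Suc i) x \<partial>M)) - ((\<integral>x. U i x \<partial>M) + (\<integral>x. V i x \<partial>M)))"
    by (simp add: sum.distrib sum_distrib_left algebra_simps sum_subtractf)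
  also have "\<dots> = \<epsilon> * ((\<integral>x. Y k x \<partial>M) + (\<integral>x. W k x \<partial>M)) + (\<Sum>i<k. (\<integral>x. (D (Suc i) x - D i x)\<^sup>2 \<partial>M))
     + 2 * \<epsilon> * ((\<integral>x. U k x \<partial>M) + (\<integral>x. V k x \<partial>M))"
    using sum_lessThan_telescope[of "\<lambda>i. (\<integral>x. U i x \<partial>M) + (\<integral>x. V i x \<partial>M)" k] by (simp add: zero)
  \<comment> \<open>Doubling the nonnegative mean of Y k + W k completes U + Y and V + W, whose
    expectations do not depend on k.\<close>
  also have "\<dots> \<le> 2 * \<epsilon> * ((\<integral>x. U k x + Y k x \<partial>M) + (\<integral>x. V k x + W k x \<partial>M)) + (\<Sum>i<k. (\<integral>x. (D (Suc i) x - D i x)\<^sup>2 \<partial>M))"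
  proof -
    have "AE x in M. 0 \<le> \<epsilon>" using close[of k] by eventually_elim simp
    then have "0 \<le> \<epsilon>" by simp
    moreover have "0 \<le> (\<integral>x. Y k x \<partial>M)" "0 \<le> (\<integral>x. W k x \<partial>M)"
      using bound by (auto intro!: integral_nonneg_AE)
    ultimately have "0 \<le> \<epsilon> * ((\<integral>x. Y k x \<partial>M) + (\<integral>x. W k x \<partial>M))" by simp
    then show ?thesis by (simp add: algebra_simps)
  qed
  finally show ?thesis unfolding expectation_potential .
qed

text \<open>D and N differ by at most \<epsilon>, so the maximum of |D| is at most Q + \<epsilon>
  with Q the maximum of |N|. The factor 8 is 2 from squaring this sum times 4 from Doob; the
  squaring also leaves 2 \<epsilon>^2.\<close>

lemma maximal_bound:
  defines "S \<equiv> \<lambda>k x. Max ((\<lambda>i. \<bar>D i x\<bar>) ` {..k})"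
  shows "integrable M (\<lambda>x. (S k x)\<^sup>2)"
    "(\<integral>x. (S k x)\<^sup>2 \<partial>M) \<le> 8 * (2 * \<epsilon> * ((\<integral>x. Y 0 x \<partial>M) + (\<integral>x. W 0 x \<partial>M))
      + (\<Sum>i<k. (\<integral>x. (D (Suc i) x - D i x)\<^sup>2 \<partial>M))) + 2 * \<epsilon>\<^sup>2"
proof -
  have "AE x in M. 0 \<le> \<epsilon>" using close[of 0] by eventually_elim simp
  then have \<epsilon>: "0 \<le> \<epsilon>" by simp
  define Q where "Q k x = Max ((\<lambda>i. \<bar>N i x\<bar>) ` {..k})" for k x
  have MF: "f \<in> borel_measurable (F j)" if "f \<in> borel_measurable (F i)" "i \<le> j" for f :: "'a \<Rightarrow> real" and i j
    by (rule measurable_from_subalg[OF _ that(1)])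
      (use F[of i] F[of j] F_mono[OF that(2)] in \<open>auto simp: subalgebra_def\<close>)
  have QF: "Q j \<in> borel_measurable (F j)" for j
    unfolding Q_def
  proof (rule borel_measurable_Max)
    fix i assume "i \<in> {..j}"
    then show "(\<lambda>x. \<bar>N i x\<bar>) \<in> borel_measurable (F j)" using MF[OF measF(3), of i j] by simp
  qed auto
  have Qsq: "square_integrable M (Q j)" for j
  proof (induction j)
    case 0
    show ?case
      by (rule square_integrable_le[OF sq(3)[of 0]]) (use measurable_from_subalg[OF F QF, of 0] in simp, simp add: Q_def)
  next
    case (Suc j)
    have Qs: "Q (Suc j) x = max (Q j x) \<bar>N (Suc j) x\<bar>" for x
      by (simp add: Q_def atMost_Suc max.commute)
    have ab: "square_integrable M (\<lambda>x. \<bar>f x\<bar>)" if "square_integrable M f" for f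
      using that by (auto simp: square_integrable_def)
    show ?case
      by (rule square_integrable_le[OF square_integrable_add[OF ab[OF Suc] ab[OF sq(3)[of "Suc j"]]]])
        (rule measurable_from_subalg[OF F QF], simp add: Qs)
  qed
  have Q2: "(\<integral>x. (Q k x)\<^sup>2 \<partial>M) \<le> 4 * (\<integral>x. (N k x)\<^sup>2 \<partial>M)"
  proof -
    \<comment> \<open>The integrand of \<open>pathwise_Doob\<close>. It is known at stage i, hence
      orthogonal to the next increment of N.\<close>
    let ?s = "\<lambda>i x. Q i x * sgn (N i x)"
    have sF: "?s i \<in> borel_measurable (F i)" for i
      using QF measF(3) by measurable
    have ssq: "square_integrable M (?s i)" for i
      by (rule square_integrable_le[OF Qsq[of i]])
        (use measurable_from_subalg[OF F sF] in \<open>auto simp: abs_mult sgn_real_def\<close>)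
    have si: "integrable M (\<lambda>x. ?s i x * (N (Suc i) x - N i x))" for i
      by (intro square_integrable_mult ssq square_integrable_diff sq)
    have "(\<integral>x. (Q k x)\<^sup>2 \<partial>M) \<le> (\<integral>x. 4 * (N k x)\<^sup>2 - 4 * (\<Sum>i<k. ?s i x * (N (Suc i) x - N i x)) \<partial>M)"
    proof (rule integral_mono)
      show "integrable M (\<lambda>x. (Q k x)\<^sup>2)" using Qsq by (simp add: square_integrable_def)
      show "integrable M (\<lambda>x. 4 * (N k x)\<^sup>2 - 4 * (\<Sum>i<k. ?s i x * (N (Suc i) x - N i x)))"
        using sq(3) si by (auto simp: square_integrable_def)
      show "(Q k x)\<^sup>2 \<le> 4 * (N k x)\<^sup>2 - 4 * (\<Sum>i<k. ?s i x * (N (Suc i) x - N i x))" for x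
        unfolding Q_def by (rule pathwise_Doob)
    qed
    also have "\<dots> = 4 * (\<integral>x. (N k x)\<^sup>2 \<partial>M) - 4 * (\<Sum>i<k. \<integral>x. ?s i x * (N (Suc i) x - N i x) \<partial>M)"
      using sq(3)[of k] si by (simp add: square_integrable_def)
    also have "\<dots> = 4 * (\<integral>x. (N k x)\<^sup>2 \<partial>M)"
      using increment_orthogonal[OF ssq sF] by simp
    finally show ?thesis .
  qed
  have SQ: "AE x in M. (S k x)\<^sup>2 \<le> 2 * (Q k x)\<^sup>2 + 2 * \<epsilon>\<^sup>2"
  proof -
    have "AE x in M. \<forall>i. \<bar>y i x\<bar> \<le> \<epsilon>" using close by (simp add: AE_all_countable y_def)
    then show ?thesis
    proof eventually_elim
      case (elim x)
      have "S k x \<le> Q k x + \<epsilon>"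
        unfolding S_def
      proof (rule Max.boundedI)
        fix a assume "a \<in> (\<lambda>i. \<bar>D i x\<bar>) ` {..k}"
        then obtain i where i: "i \<le> k" "a = \<bar>D i x\<bar>" by auto
        have "\<bar>N i x\<bar> \<le> Q k x" unfolding Q_def using i by (auto intro!: Max_ge)
        then show "a \<le> Q k x + \<epsilon>" using elim[rule_format, of i] i by (simp add: N_def)
      qed auto
      moreover have "0 \<le> S k x"
        unfolding S_def by (rule order_trans[OF abs_ge_zero[of "D 0 x"]]) (auto intro!: Max_ge)
      ultimately have "(S k x)\<^sup>2 \<le> (Q k x + \<epsilon>)\<^sup>2" by (intro power_mono)
      also have "\<dots> \<le> 2 * (Q k x)\<^sup>2 + 2 * \<epsilon>\<^sup>2"
      proof -
        have "0 \<le> (Q k x - \<epsilon>)\<^sup>2" by simp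
        then show ?thesis by (simp add: power2_eq_square algebra_simps)
      qed
      finally show ?case .
    qed
  qed
  have Smeas: "S k \<in> borel_measurable M"
    unfolding S_def
    by (rule borel_measurable_Max) (use measurable_from_subalg[OF F measF(1)] in auto)
  have int: "integrable M (\<lambda>x. 2 * (Q k x)\<^sup>2 + 2 * \<epsilon>\<^sup>2)"
    using Qsq by (simp add: square_integrable_def)
  show S_int: "integrable M (\<lambda>x. (S k x)\<^sup>2)"
    by (rule Bochner_Integration.integrable_bound[OF int]) (use Smeas SQ in auto)
  have "(\<integral>x. (S k x)\<^sup>2 \<partial>M) \<le> (\<integral>x. 2 * (Q k x)\<^sup>2 + 2 * \<epsilon>\<^sup>2 \<partial>M)"
    by (rule integral_mono_AE[OF S_int int SQ])
  also have "\<dots> = 2 * (\<integral>x. (Q k x)\<^sup>2 \<partial>M) + 2 * \<epsilon>\<^sup>2"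
    using Qsq by (simp add: square_integrable_def prob_space)
  also have "\<dots> \<le> 8 * (\<integral>x. (N k x)\<^sup>2 \<partial>M) + 2 * \<epsilon>\<^sup>2" using Q2 by simp
  also have "\<dots> \<le> 8 * (2 * \<epsilon> * ((\<integral>x. Y 0 x \<partial>M) + (\<integral>x. W 0 x \<partial>M))
      + (\<Sum>i<k. (\<integral>x. (D (Suc i) x - D i x)\<^sup>2 \<partial>M))) + 2 * \<epsilon>\<^sup>2"
    by (intro add_mono mult_left_mono energy_bound) auto
  finally show "(\<integral>x. (S k x)\<^sup>2 \<partial>M) \<le> 8 * (2 * \<epsilon> * ((\<integral>x. Y 0 x \<partial>M) + (\<integral>x. W 0 x \<partial>M))
      + (\<Sum>i<k. (\<integral>x. (D (Suc i) x - D i x)\<^sup>2 \<partial>M))) + 2 * \<epsilon>\<^sup>2" .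
qed

end

section \<open>Elementary inequalities for increasing sequences\<close>

text \<open>Discrete counterpart of b_T^2 = 2 int (b_T - b_s) db_s, with the diagonal as a separate
  sum of squares. The factor \<open>b N - b (Suc i)\<close> involves only what happens after step
  i.\<close>

lemma square_telescope:
  fixes b :: "nat \<Rightarrow> real"
  shows "(b N - b 0)\<^sup>2 = (\<Sum>i<N. (b (Suc i) - b i)\<^sup>2) + 2 * (\<Sum>i<N. (b (Suc i) - b i) * (b N - b (Suc i)))"
proof -
  have "(\<Sum>i<N. (b (Suc i) - b i)\<^sup>2) + 2 * (\<Sum>i<N. (b (Suc i) - b i) * (b N - b (Suc i)))
      = (\<Sum>i<N. - ((b N - b (Suc i))\<^sup>2 - (b N - b i)\<^sup>2))"
    by (simp add: sum_distrib_left sum.distrib[symmetric] power2_eq_square algebra_simps)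
  also have "\<dots> = (b N - b 0)\<^sup>2"
    unfolding sum_negf sum_lessThan_telescope[of "\<lambda>i. (b N - b i)\<^sup>2"] by simp
  finally show ?thesis by simp
qed

text \<open>Here w is the discount factor, at least 1 - q up to the horizon. It converts the
  estimate for the discounted difference into one for the plain difference at the price of q times
  second moments.\<close>

lemma discounted_square_le:
  fixes b c w :: "nat \<Rightarrow> real"
  assumes b: "b 0 = 0" "\<And>i. b i \<le> b (Suc i)" and c: "c 0 = 0" "\<And>i. c i \<le> c (Suc i)"
    and w: "\<And>i. i < k \<Longrightarrow> 1 - q \<le> w i" "\<And>i. i < k \<Longrightarrow> w i \<le> 1" and q: "0 \<le> q"
    and R: "b k \<le> R" "c k \<le> R'"
  shows "(b k - c k)\<^sup>2 \<le>
    ((\<Sum>i<k. w i * (b (Suc i) - b i)) - (\<Sum>i<k. w i * (c (Suc i) - c i)))\<^sup>2 + 2 * q * (R\<^sup>2 + R'\<^sup>2)"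
proof -
  define y where "y = max (b k) (c k)"
  define x where "x = \<bar>(\<Sum>i<k. w i * (b (Suc i) - b i)) - (\<Sum>i<k. w i * (c (Suc i) - c i))\<bar>"
  have tele: "(\<Sum>i<k. g (Suc i) - g i) = g k" if "g 0 = 0" for g :: "nat \<Rightarrow> real"
    using sum_lessThan_telescope[of g k] that by simp
  \<comment> \<open>Both corrections lie between 0 and q y, hence so does the absolute value of
    their difference; adding the two bounds would lose a factor 2.\<close>
  have rest: "0 \<le> (\<Sum>i<k. (1 - w i) * (g (Suc i) - g i))" "(\<Sum>i<k. (1 - w i) * (g (Suc i) - g i)) \<le> q * g k"
    if "g 0 = 0" "\<And>i. g i \<le> g (Suc i)" for g
  proof -
    show "0 \<le> (\<Sum>i<k. (1 - w i) * (g (Suc i) - g i))"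
      using w(2) that(2) by (intro sum_nonneg mult_nonneg_nonneg) auto
    have "(\<Sum>i<k. (1 - w i) * (g (Suc i) - g i)) \<le> (\<Sum>i<k. q * (g (Suc i) - g i))"
      using w(1) that(2) by (intro sum_mono mult_right_mono) (auto simp: algebra_simps)
    then show "(\<Sum>i<k. (1 - w i) * (g (Suc i) - g i)) \<le> q * g k"
      by (simp add: sum_distrib_left[symmetric] tele[of g, OF that(1)])
  qed
  have split: "g k = (\<Sum>i<k. w i * (g (Suc i) - g i)) + (\<Sum>i<k. (1 - w i) * (g (Suc i) - g i))" if "g 0 = 0" for g
    unfolding sum.distrib[symmetric] tele[of g, OF that, symmetric] by (intro sum.cong) (auto simp: algebra_simps)
  have bk: "0 \<le> b k" "0 \<le> c k"
    using lift_Suc_mono_le[of b 0 k] lift_Suc_mono_le[of c 0 k] b c by auto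
  have y: "0 \<le> y" "b k \<le> y" "c k \<le> y" using bk by (auto simp: y_def)
  have Dy: "\<bar>b k - c k\<bar> \<le> y" using bk y by linarith
  have "q * b k \<le> q * y" "q * c k \<le> q * y" using y q by (auto intro: mult_left_mono)
  then have Dx: "\<bar>b k - c k\<bar> \<le> x + q * y"
    using rest[OF b] rest[OF c] split[of b, OF b(1)] split[of c, OF c(1)] unfolding x_def by linarith
  have "\<bar>b k - c k\<bar>\<^sup>2 \<le> x\<^sup>2 + 2 * q * y\<^sup>2"
  proof (cases "\<bar>b k - c k\<bar> \<le> x")
    case True
    then have "\<bar>b k - c k\<bar>\<^sup>2 \<le> x\<^sup>2" by (intro power_mono) auto
    moreover have "0 \<le> 2 * q * y\<^sup>2" using q by simp
    ultimately show ?thesis by linarith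
  next
    case False
    \<comment> \<open>Here x < |b k - c k|, so the second factor is at most 2 |b k - c k|, hence at
      most 2 y. Factoring keeps the coefficient of x^2 at 1 and gives exactly 2 q y^2; expanding (x
      + q y)^2 would leave an additional q^2 y^2.\<close>
    have "\<bar>b k - c k\<bar>\<^sup>2 - x\<^sup>2 = (\<bar>b k - c k\<bar> - x) * (\<bar>b k - c k\<bar> + x)"
      by (simp add: power2_eq_square algebra_simps)
    also have "\<dots> \<le> (q * y) * (2 * y)"
      using False Dx Dy y(1) q by (intro mult_mono) (auto simp: x_def)
    finally show ?thesis by (simp add: power2_eq_square)
  qed
  moreover have "y\<^sup>2 \<le> R\<^sup>2 + R'\<^sup>2"
  proof -
    have "(b k)\<^sup>2 \<le> R\<^sup>2" "(c k)\<^sup>2 \<le> R'\<^sup>2" using bk R by (auto intro: power_mono)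
    then show ?thesis unfolding y_def max_def by (auto intro: order_trans add_increasing add_increasing2)
  qed
  ultimately show ?thesis
    using mult_left_mono[of "y\<^sup>2" "R\<^sup>2 + R'\<^sup>2" "2 * q"] q by (simp add: x_def)
qed

section \<open>Stieltjes integrals of continuous increasing paths\<close>

abbreviation stopped :: "(real \<Rightarrow> ennreal) \<Rightarrow> real \<Rightarrow> real \<Rightarrow> real" where
  "stopped a u \<equiv> \<lambda>t. enn2real (a (min (max 0 t) u))"

text \<open>The value infinity is allowed. Constancy is demanded from every s at or beyond \<zeta>,
  which makes sense for an infinite \<zeta> too and avoids evaluating the path at \<zeta>.\<close>

definition "increasing_path \<zeta> (a :: real \<Rightarrow> ennreal) \<longleftrightarrow>
  a 0 = 0 \<and> continuous_on {0..} a \<and> mono_on {0..} a \<and> (\<forall>s t. 0 \<le> s \<longrightarrow> s \<le> t \<longrightarrow> \<zeta> \<le> ennreal s \<longrightarrow> a t = a s)"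

context
  fixes \<zeta> :: ennreal and a :: "real \<Rightarrow> ennreal"
  assumes a: "increasing_path \<zeta> a"
begin

lemma path_const: "0 \<le> s \<Longrightarrow> s \<le> t \<Longrightarrow> \<zeta> \<le> ennreal s \<Longrightarrow> a t = a s"
  using a[unfolded increasing_path_def, THEN conjunct2, THEN conjunct2, THEN conjunct2] by iprover

lemma path_mono: "0 \<le> s \<Longrightarrow> s \<le> t \<Longrightarrow> a s \<le> a t"
  using a by (auto simp: increasing_path_def mono_on_def)

context
  fixes u :: real
  assumes u: "0 \<le> u" "a u < \<infinity>"
begin

lemma stopped_path_finite: "a (min (max 0 t) u) < \<infinity>"
  by (rule le_less_trans[OF path_mono u(2)]) (use u(1) in auto)

lemma stopped_mono: "s \<le> t \<Longrightarrow> stopped a u s \<le> stopped a u t"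
  using u stopped_path_finite by (intro enn2real_mono path_mono) auto

lemma stopped_continuous: "continuous_on UNIV (stopped a u)"
proof -
  have "continuous_on UNIV (\<lambda>t. a (min (max 0 t) u))"
    by (rule continuous_on_compose2[of "{0..}" a])
      (use a u in \<open>auto simp: increasing_path_def intro!: continuous_intros\<close>)
  then show ?thesis
    unfolding continuous_on_def using stopped_path_finite by (intro ballI tendsto_enn2real) auto
qed

lemma stopped_right_continuous: "continuous (at_right t) (stopped a u)"
  using stopped_continuous by (auto simp: continuous_on_eq_continuous_at intro: continuous_at_imp_continuous_at_within)

lemma stopped_Ioc: "s \<le> t \<Longrightarrow> emeasure (interval_measure (stopped a u)) {s<..t} = ennreal (stopped a u t - stopped a u s)"
  by (intro emeasure_interval_measure_Ioc stopped_mono stopped_right_continuous)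

lemma stopped_Icc: "s \<le> t \<Longrightarrow> emeasure (interval_measure (stopped a u)) {s..t} = ennreal (stopped a u t - stopped a u s)"
  by (rule emeasure_interval_measure_Icc) (auto intro: stopped_mono stopped_continuous)

lemma stopped_diff: "0 \<le> s \<Longrightarrow> s \<le> t \<Longrightarrow> ennreal (stopped a u t - stopped a u s) = a (min t u) - a (min s u)"
  using stopped_path_finite[of s] stopped_path_finite[of t] by (simp add: ennreal_minus[symmetric])

lemma AE_stopped_pos: "AE t in interval_measure (stopped a u). 0 < t"
proof (rule AE_I')
  have "emeasure (interval_measure (stopped a u)) {- real n..0} = 0" for n
    using stopped_Icc[of "- real n" 0] by simp
  then have "(\<Union>n. {- real n..0}) \<in> null_sets (interval_measure (stopped a u))"
    by (intro null_sets_UN) (auto simp: null_sets_def)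
  then show "(\<Union>n. {- real n..0}) \<in> null_sets (interval_measure (stopped a u))" .
  show "{t \<in> space (interval_measure (stopped a u)). \<not> 0 < t} \<subseteq> (\<Union>n. {- real n..0})"
  proof safe
    fix t :: real assume "\<not> 0 < t"
    moreover obtain n where "- t \<le> real n" using real_arch_simple by blast
    ultimately show "t \<in> (\<Union>n. {- real n..0})" by (intro UN_I[of n]) auto
  qed
qed

text \<open>The stopped path is flat before 0 and after \<zeta>, and continuity excludes atoms at
  these two points. So the measure lives on the times at which the process is in S, where the
  indicator of S equals 1.\<close>

lemma AE_stopped_lifetime: "AE t in interval_measure (stopped a u). 0 < t \<and> ennreal t < \<zeta>"
proof (cases \<zeta>)
  case (real z)
  then have z: "\<zeta> = ennreal z" "0 \<le> z" by auto
  have const: "stopped a u t = stopped a u z" if "z \<le> t" for t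
  proof (cases "u \<le> z")
    case True
    then show ?thesis using that u by simp
  next
    case False
    then have "a (min t u) = a z"
      by (intro path_const) (use that z in auto)
    then show ?thesis using that z False by simp
  qed
  have "AE t in interval_measure (stopped a u). t < z"
  proof (rule AE_I')
    have "emeasure (interval_measure (stopped a u)) {z..z + real n} = 0" for n
      using stopped_Icc[of z "z + real n"] const[of "z + real n"] by simp
    then show "(\<Union>n. {z..z + real n}) \<in> null_sets (interval_measure (stopped a u))"
      by (intro null_sets_UN) (auto simp: null_sets_def)
    show "{t \<in> space (interval_measure (stopped a u)). \<not> t < z} \<subseteq> (\<Union>n. {z..z + real n})"
    proof safe
      fix t :: real assume "\<not> t < z"
      moreover obtain n where "t - z \<le> real n" using real_arch_simple by blast
      ultimately show "t \<in> (\<Union>n. {z..z + real n})" by (intro UN_I[of n]) auto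
    qed
  qed
  with AE_stopped_pos show ?thesis
    by eventually_elim (simp add: z(1) ennreal_less_iff)
next
  case top
  from AE_stopped_pos show ?thesis by eventually_elim (simp add: top)
qed

lemma stieltjes_upper:
  assumes "0 < \<eta>" "0 < \<alpha>" and g: "\<And>t. g t \<le> 1"
  shows "(\<integral>\<^sup>+t. ennreal (exp (- \<alpha> * t)) * g t \<partial>interval_measure (stopped a u)) \<le>
    (\<Sum>i. ennreal (exp (- \<alpha> * (real i * \<eta>))) * (a (real (Suc i) * \<eta>) - a (real i * \<eta>)))"
proof -
  let ?I = "\<lambda>i. {real i * \<eta><..real (Suc i) * \<eta>}"
  have le: "real i * \<eta> \<le> real (Suc i) * \<eta>" "0 \<le> real i * \<eta>" for i
    using assms(1) by (auto intro: mult_right_mono)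
  have "AE t in interval_measure (stopped a u). ennreal (exp (- \<alpha> * t)) * g t \<le>
      (\<Sum>i. ennreal (exp (- \<alpha> * (real i * \<eta>))) * indicator (?I i) t)"
    using AE_stopped_pos
  proof eventually_elim
    case (elim t)
    \<comment> \<open>The cells are open on the left, so the index of the cell of t is the ceiling
      minus one; since t > 0 the ceiling is at least 1 and \<open>nat\<close> truncates
      nothing.\<close>
    define k where "k = nat (\<lceil>t / \<eta>\<rceil> - 1)"
    have "0 < t / \<eta>" using elim assms(1) by simp
    then have k: "real k = real_of_int \<lceil>t / \<eta>\<rceil> - 1" by (simp add: k_def)
    then have "real k < t / \<eta>" "t / \<eta> \<le> real (Suc k)" by linarith+
    then have kt: "t \<in> ?I k" using assms(1) by (simp add: field_simps)
    define h :: "nat \<Rightarrow> ennreal" where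
      "h i = ennreal (exp (- \<alpha> * (real i * \<eta>))) * indicator (?I i) t" for i
    have "ennreal (exp (- \<alpha> * t)) * g t \<le> ennreal (exp (- \<alpha> * (real k * \<eta>))) * 1"
      using kt assms(2) by (intro mult_mono g ennreal_leI) auto
    also have "\<dots> = h k" using kt by (simp add: h_def)
    also have "\<dots> \<le> (\<Sum>i. h i)" using sum_le_suminf[of h "{k}"] by simp
    finally show ?case by (simp only: h_def)
  qed
  then have "(\<integral>\<^sup>+t. ennreal (exp (- \<alpha> * t)) * g t \<partial>interval_measure (stopped a u)) \<le>
      (\<integral>\<^sup>+t. (\<Sum>i. ennreal (exp (- \<alpha> * (real i * \<eta>))) * indicator (?I i) t) \<partial>interval_measure (stopped a u))"
    by (rule nn_integral_mono_AE)
  also have "\<dots> = (\<Sum>i. ennreal (exp (- \<alpha> * (real i * \<eta>))) * emeasure (interval_measure (stopped a u)) (?I i))"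
    by (subst nn_integral_suminf) (auto simp: nn_integral_cmult)
  also have "\<dots> \<le> (\<Sum>i. ennreal (exp (- \<alpha> * (real i * \<eta>))) * (a (real (Suc i) * \<eta>) - a (real i * \<eta>)))"
  proof (intro suminf_le mult_left_mono)
    fix i
    have "a (min (real (Suc i) * \<eta>) u) - a (min (real i * \<eta>) u) \<le> a (real (Suc i) * \<eta>) - a (real i * \<eta>)"
    proof (cases "u \<le> real i * \<eta>")
      case True
      then have "min (real (Suc i) * \<eta>) u = u" "min (real i * \<eta>) u = u" using le(1)[of i] by auto
      then show ?thesis using u(2) by (simp add: ennreal_diff_self less_top[symmetric])
    next
      case False
      then have "min (real i * \<eta>) u = real i * \<eta>" by simp
      then show ?thesis
        using le[of i] u by (auto intro!: ennreal_minus_mono path_mono)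
    qed
    then show "emeasure (interval_measure (stopped a u)) (?I i) \<le> a (real (Suc i) * \<eta>) - a (real i * \<eta>)"
      using stopped_Ioc[OF le(1)] stopped_diff[OF le(2) le(1)] by simp
  qed auto
  finally show ?thesis .
qed

text \<open>The discount decreases in time, so right endpoints of the cells give a lower bound. With
  u a grid point, the first K cells lie entirely below u, where stopping has no effect.\<close>

lemma stieltjes_lower:
  assumes "0 < \<eta>" "0 < \<alpha>" and u_eq: "u = real K * \<eta>" and g: "\<And>t. 0 < t \<Longrightarrow> ennreal t < \<zeta> \<Longrightarrow> g t = 1"
  shows "(\<Sum>i<K. ennreal (exp (- \<alpha> * (real (Suc i) * \<eta>))) * (a (real (Suc i) * \<eta>) - a (real i * \<eta>)))
    \<le> (\<integral>\<^sup>+t. ennreal (exp (- \<alpha> * t)) * g t \<partial>interval_measure (stopped a u))"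
proof -
  let ?I = "\<lambda>i. {real i * \<eta><..real (Suc i) * \<eta>}"
  have le: "real i * \<eta> \<le> real (Suc i) * \<eta>" "0 \<le> real i * \<eta>" for i
    using assms(1) by (auto intro: mult_right_mono)
  have "(\<Sum>i<K. ennreal (exp (- \<alpha> * (real (Suc i) * \<eta>))) * (a (real (Suc i) * \<eta>) - a (real i * \<eta>)))
     = (\<Sum>i<K. ennreal (exp (- \<alpha> * (real (Suc i) * \<eta>))) * emeasure (interval_measure (stopped a u)) (?I i))"
  proof (rule sum.cong[OF refl])
    fix i assume "i \<in> {..<K}"
    then have "real (Suc i) * \<eta> \<le> u" unfolding u_eq using assms(1) by (intro mult_right_mono) auto
    then show "ennreal (exp (- \<alpha> * (real (Suc i) * \<eta>))) * (a (real (Suc i) * \<eta>) - a (real i * \<eta>)) =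
        ennreal (exp (- \<alpha> * (real (Suc i) * \<eta>))) * emeasure (interval_measure (stopped a u)) (?I i)"
      using stopped_Ioc[OF le(1)] stopped_diff[OF le(2) le(1)] le(1)[of i] by (simp add: min_absorb1)
  qed
  also have "\<dots> = (\<integral>\<^sup>+t. (\<Sum>i<K. ennreal (exp (- \<alpha> * (real (Suc i) * \<eta>))) * indicator (?I i) t) \<partial>interval_measure (stopped a u))"
    by (subst nn_integral_sum) (auto simp: nn_integral_cmult)
  also have "\<dots> \<le> (\<integral>\<^sup>+t. ennreal (exp (- \<alpha> * t)) * g t \<partial>interval_measure (stopped a u))"
  proof (rule nn_integral_mono_AE)
    show "AE t in interval_measure (stopped a u). (\<Sum>i<K. ennreal (exp (- \<alpha> * (real (Suc i) * \<eta>))) * indicator (?I i) t)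
        \<le> ennreal (exp (- \<alpha> * t)) * g t"
      using AE_stopped_lifetime
    proof eventually_elim
      case (elim t)
      show ?case
      proof (cases "\<exists>k<K. t \<in> ?I k")
        case False
        then have "(\<Sum>i<K. ennreal (exp (- \<alpha> * (real (Suc i) * \<eta>))) * indicator (?I i) t) = 0"
          by (intro sum.neutral) auto
        then show ?thesis by (metis zero_le)
      next
        case True
        then obtain k where k: "k < K" "t \<in> ?I k" by blast
        have "indicator (?I i) t = (0 :: ennreal)" if "i \<noteq> k" for i
        proof -
          have "t \<notin> ?I i"
          proof
            assume "t \<in> ?I i"
            with k(2) have "real i * \<eta> < real (Suc k) * \<eta>" "real k * \<eta> < real (Suc i) * \<eta>" by auto
            then have "i < Suc k" "k < Suc i" using assms(1) by (auto simp: mult_less_cancel_right)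
            then show False using that by simp
          qed
          then show ?thesis by simp
        qed
        then have "(\<Sum>i<K. ennreal (exp (- \<alpha> * (real (Suc i) * \<eta>))) * indicator (?I i) t)
            = (\<Sum>i<K. if i = k then ennreal (exp (- \<alpha> * (real (Suc k) * \<eta>))) else 0)"
          using k(2) by (intro sum.cong) auto
        also have "\<dots> = ennreal (exp (- \<alpha> * (real (Suc k) * \<eta>)))" using k(1) by simp
        also have "\<dots> \<le> ennreal (exp (- \<alpha> * t))"
          using k(2) assms(2) by (intro ennreal_leI) simp
        also have "\<dots> = ennreal (exp (- \<alpha> * t)) * g t"
          using g[of t] elim by simp
        finally show ?thesis .
      qed
    qed
  qed
  finally show ?thesis .
qed

end

lemma stieltjes_integral_upper:
  assumes "0 < \<eta>" "0 < \<alpha>" "\<And>t. g t \<le> 1"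
  shows "stieltjes_integral (\<lambda>t. ennreal (exp (- \<alpha> * t)) * g t) a \<le>
    (\<Sum>i. ennreal (exp (- \<alpha> * (real i * \<eta>))) * (a (real (Suc i) * \<eta>) - a (real i * \<eta>)))"
  unfolding stieltjes_integral_def
  by (rule SUP_least) (use stieltjes_upper[OF _ _ assms] in auto)

lemma stieltjes_integral_lower:
  assumes "0 < \<eta>" "0 < \<alpha>" "a (real K * \<eta>) < \<infinity>" and g: "\<And>t. 0 < t \<Longrightarrow> ennreal t < \<zeta> \<Longrightarrow> g t = 1"
  shows "(\<Sum>i<K. ennreal (exp (- \<alpha> * (real (Suc i) * \<eta>))) * (a (real (Suc i) * \<eta>) - a (real i * \<eta>)))
    \<le> stieltjes_integral (\<lambda>t. ennreal (exp (- \<alpha> * t)) * g t) a"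
proof -
  have "0 \<le> real K * \<eta>" using assms(1) by simp
  from stieltjes_lower[OF this assms(3,1,2) refl g]
  show ?thesis
    unfolding stieltjes_integral_def
    by (rule order_trans) (use \<open>0 \<le> real K * \<eta>\<close> assms(3) in \<open>auto intro!: SUP_upper\<close>)
qed

text \<open>The lower sum with a single cell of mesh u.\<close>

lemma stieltjes_integral_ge:
  assumes "0 < \<alpha>" "0 \<le> u" "a u < \<infinity>" and g: "\<And>t. 0 < t \<Longrightarrow> ennreal t < \<zeta> \<Longrightarrow> g t = 1"
  shows "ennreal (exp (- \<alpha> * u)) * a u \<le> stieltjes_integral (\<lambda>t. ennreal (exp (- \<alpha> * t)) * g t) a"
proof (cases "u = 0")
  case True
  then show ?thesis using a by (simp add: increasing_path_def)
next
  case False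
  then show ?thesis
    using stieltjes_integral_lower[of u \<alpha> 1 g] assms a by (simp add: increasing_path_def)
qed

text \<open>A path that reaches infinity does so continuously, hence takes arbitrarily large finite
  values first, and each of these bounds the integral from below. This works because
  \<open>stieltjes_integral\<close> is a supremum over all u at which the path is still
  finite.\<close>

lemma path_finite:
  assumes "0 < \<alpha>" and g: "\<And>t. 0 < t \<Longrightarrow> ennreal t < \<zeta> \<Longrightarrow> g t = 1"
    and fin: "stieltjes_integral (\<lambda>t. ennreal (exp (- \<alpha> * t)) * g t) a < \<infinity>" and "0 \<le> t"
  shows "a t < \<infinity>"
proof (rule ccontr)
  assume "\<not> a t < \<infinity>"
  then have top: "a t = \<infinity>" by (simp add: less_top[symmetric])
  define S where "S = enn2real (stieltjes_integral (\<lambda>t. ennreal (exp (- \<alpha> * t)) * g t) a)"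
  have S: "stieltjes_integral (\<lambda>t. ennreal (exp (- \<alpha> * t)) * g t) a = ennreal S" "0 \<le> S"
    using fin by (simp_all add: S_def)
  \<comment> \<open>The level is chosen so that even after the discount, which is at least
    exp(-\<alpha> t), it exceeds the integral S by 1.\<close>
  have "\<exists>s. 0 \<le> s \<and> s \<le> t \<and> a s = ennreal (exp (\<alpha> * t) * (S + 1))"
    by (rule IVT') (use a top assms(4) in \<open>auto simp: increasing_path_def intro: continuous_on_subset\<close>)
  then obtain s where s: "0 \<le> s" "s \<le> t" "a s = ennreal (exp (\<alpha> * t) * (S + 1))" by blast
  have "ennreal (S + 1) \<le> ennreal (exp (- \<alpha> * s)) * a s"
  proof -
    have "1 * (S + 1) \<le> (exp (- \<alpha> * s) * exp (\<alpha> * t)) * (S + 1)"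
      using s assms(1) S(2) by (intro mult_right_mono) (auto simp: exp_add[symmetric] intro: mult_left_mono)
    then have "ennreal (S + 1) \<le> ennreal (exp (- \<alpha> * s) * (exp (\<alpha> * t) * (S + 1)))"
      by (intro ennreal_leI) (simp only: mult.assoc mult_1)
    then show ?thesis
      unfolding s(3) using S(2) by (simp only: ennreal_mult'[OF exp_ge_zero])
  qed
  also have "\<dots> \<le> ennreal S"
    unfolding S(1)[symmetric] by (rule stieltjes_integral_ge[OF assms(1) s(1) _ g]) (use s(3) in auto)
  finally show False using S(2) by (simp add: ennreal_le_iff)
qed

end

section \<open>Dyadic grids\<close>

text \<open>The sum of squares is at most the largest increment times the total increment, and by
  uniform continuity the largest increment tends to 0.\<close>

lemma dyadic_square_sum_tendsto_0:
  fixes b :: "real \<Rightarrow> real"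
  assumes "0 < T" and cont: "continuous_on {0..T} b" and mono: "mono_on {0..T} b"
  shows "(\<lambda>n. \<Sum>i<2^n. (b (real (Suc i) * (T / 2^n)) - b (real i * (T / 2^n)))\<^sup>2) \<longlonglongrightarrow> 0"
proof (rule LIMSEQ_I)
  fix r :: real assume "0 < r"
  define B where "B = b T - b 0"
  have B: "0 \<le> B" using mono assms(1) by (auto simp: B_def mono_on_def)
  \<comment> \<open>Dividing by B + 1 covers B = 0 and makes e * B strictly smaller than r.\<close>
  define e where "e = r / (B + 1)"
  have e: "0 < e" using \<open>0 < r\<close> B by (simp add: e_def)
  have "uniformly_continuous_on {0..T} b" by (rule compact_uniformly_continuous[OF cont]) simp
  then obtain d where d: "0 < d" "\<And>s t. s \<in> {0..T} \<Longrightarrow> t \<in> {0..T} \<Longrightarrow> dist t s < d \<Longrightarrow> dist (b t) (b s) < e"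
    using e unfolding uniformly_continuous_on_def by meson
  have "(\<lambda>n. T / 2^n) \<longlonglongrightarrow> 0"
    by (rule LIMSEQ_divide_realpow_zero) simp
  then obtain n0 where n0: "\<And>n. n0 \<le> n \<Longrightarrow> T / 2^n < d"
    using LIMSEQ_D[OF _ d(1), of "\<lambda>n. T / 2^n" 0] assms(1) by auto
  have "norm ((\<Sum>i<2^n. (b (real (Suc i) * (T / 2^n)) - b (real i * (T / 2^n)))\<^sup>2) - 0) < r" if "n0 \<le> n" for n
  proof -
    let ?t = "\<lambda>i. real i * (T / 2^n)"
    have mem: "?t i \<in> {0..T}" if "i \<le> 2^n" for i
    proof -
      have "real i \<le> 2^n" using that by (metis of_nat_le_iff of_nat_numeral of_nat_power)
      then have "?t i \<le> 2^n * (T / 2^n)" using assms(1) by (intro mult_right_mono) auto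
      then show ?thesis using assms(1) by simp
    qed
    have step: "?t (Suc i) = ?t i + T / 2^n" for i by (simp add: field_simps)
    have "(\<Sum>i<2^n. (b (?t (Suc i)) - b (?t i))\<^sup>2) \<le> (\<Sum>i<2^n. e * (b (?t (Suc i)) - b (?t i)))"
    proof (rule sum_mono)
      fix i :: nat assume i: "i \<in> {..<2^n}"
      have 0: "0 \<le> b (?t (Suc i)) - b (?t i)"
        using mono mem[of i] mem[of "Suc i"] i step[of i] assms(1) by (auto simp: mono_on_def)
      have "dist (b (?t (Suc i))) (b (?t i)) < e"
        by (rule d(2)) (use mem[of i] mem[of "Suc i"] i step[of i] n0[OF that] assms(1) in \<open>auto simp: dist_real_def\<close>)
      then show "(b (?t (Suc i)) - b (?t i))\<^sup>2 \<le> e * (b (?t (Suc i)) - b (?t i))"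
        using 0 unfolding power2_eq_square by (intro mult_right_mono) (auto simp: dist_real_def)
    qed
    also have "\<dots> = e * B"
      using sum_lessThan_telescope[of "\<lambda>i. b (?t i)" "2^n"] by (simp add: sum_distrib_left[symmetric] B_def)
    also have "\<dots> < r" using B \<open>0 < r\<close> by (simp add: e_def field_simps)
    finally show ?thesis by (simp add: sum_nonneg)
  qed
  then show "\<exists>no. \<forall>n\<ge>no. norm ((\<Sum>i<2^n. (b (real (Suc i) * (T / 2^n)) - b (real i * (T / 2^n)))\<^sup>2) - 0) < r"
    by blast
qed

text \<open>Each t is the limit of its left neighbours on the grids, and continuity carries the
  bound over to t.\<close>

lemma SUP_le_dyadic_SUP:
  fixes f :: "real \<Rightarrow> real"
  assumes "0 < T" and cont: "continuous_on {0..T} f"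
  shows "(SUP t\<in>{0..T}. ennreal (f t)) \<le> (SUP n. ennreal (Max ((\<lambda>k. f (real k * (T / 2^n))) ` {..2^n})))"
    (is "_ \<le> ?S")
proof (rule SUP_least)
  fix t assume t: "t \<in> {0..T}"
  define k where "k n = nat \<lfloor>t * 2^n / T\<rfloor>" for n
  define s where "s n = real (k n) * (T / 2^n)" for n
  have kr: "real (k n) = real_of_int \<lfloor>t * 2^n / T\<rfloor>" for n
    using t assms(1) by (simp add: k_def)
  have k: "real (k n) \<le> t * 2^n / T" "t * 2^n / T < real (k n) + 1" for n
    unfolding kr by linarith+
  have s: "s n \<le> t" "t < s n + T / 2^n" "0 \<le> s n" for n
    using k[of n] assms(1) by (simp_all add: s_def pos_le_divide_eq pos_divide_less_eq pos_divide_le_eq pos_less_divide_eq field_simps)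
  have kle: "k n \<le> 2^n" for n
  proof -
    have "t * 2^n / T \<le> 2^n" using t assms(1) by (simp add: pos_divide_le_eq)
    then have "real (k n) \<le> real (2^n)" using k(1)[of n] unfolding of_nat_power of_nat_numeral by (rule order_trans[rotated])
    then show ?thesis unfolding of_nat_le_iff .
  qed
  have "(\<lambda>n. T / 2^n) \<longlonglongrightarrow> 0" by (rule LIMSEQ_divide_realpow_zero) simp
  then have "(\<lambda>n. t - T / 2^n) \<longlonglongrightarrow> t - 0" by (intro tendsto_diff tendsto_const)
  then have lim: "(\<lambda>n. t - T / 2^n) \<longlonglongrightarrow> t" by simp
  have "t - T / 2^n \<le> s n" for n using s(2)[of n] by simp
  then have "s \<longlonglongrightarrow> t"
    by (intro tendsto_sandwich[OF always_eventually always_eventually lim tendsto_const] allI s(1))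
  then have "(\<lambda>n. f (s n)) \<longlonglongrightarrow> f t"
  proof (rule continuous_on_tendsto_compose[OF cont])
    have "s n \<in> {0..T}" for n using s(1,3)[of n] t by auto
    then show "\<forall>\<^sub>F n in sequentially. s n \<in> {0..T}" by simp
  qed (rule t)
  then have "(\<lambda>n. ennreal (f (s n))) \<longlonglongrightarrow> ennreal (f t)" by (rule tendsto_ennrealI)
  moreover have "ennreal (f (s n)) \<le> ?S" for n
  proof -
    have "f (s n) \<le> Max ((\<lambda>k. f (real k * (T / 2^n))) ` {..2^n})"
      unfolding s_def using kle by (intro Max_ge) auto
    then have "ennreal (f (s n)) \<le> ennreal (Max ((\<lambda>k. f (real k * (T / 2^n))) ` {..2^n}))" by (rule ennreal_leI)
    also have "\<dots> \<le> ?S" by (rule SUP_upper) simp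
    finally show ?thesis .
  qed
  ultimately show "ennreal (f t) \<le> ?S" by (intro LIMSEQ_le_const2) auto
qed

text \<open>The grids are nested: index k at level m is index k * 2^(n - m) at level n. This is what
  permits monotone convergence at the end.\<close>

lemma dyadic_Max_mono:
  fixes f :: "real \<Rightarrow> real"
  assumes "m \<le> n"
  shows "Max ((\<lambda>k. f (real k * (T / 2^m))) ` {..2^m}) \<le> Max ((\<lambda>k. f (real k * (T / 2^n))) ` {..2^n})"
proof (rule Max_mono)
  show "(\<lambda>k. f (real k * (T / 2^m))) ` {..2^m} \<subseteq> (\<lambda>k. f (real k * (T / 2^n))) ` {..2^n}"
  proof safe
    fix k :: nat assume k: "k \<le> 2^m"
    have p: "(2::nat)^n = 2^m * 2^(n - m)" using assms by (simp add: power_add[symmetric])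
    have pr: "(2::real)^n = 2^m * 2^(n - m)" using assms by (simp add: power_add[symmetric])
    have "f (real k * (T / 2^m)) = f (real (k * 2^(n - m)) * (T / 2^n))"
      by (rule arg_cong[of _ _ f]) (simp add: pr)
    moreover have "k * 2^(n - m) \<le> 2^n" unfolding p using k by simp
    ultimately show "f (real k * (T / 2^m)) \<in> (\<lambda>k. f (real k * (T / 2^n))) ` {..2^n}" by blast
  qed
qed auto

section \<open>The Markov property for the augmented filtration\<close>

lemma space_borel_\<Delta> [simp]: "space borel_\<Delta> = UNIV"
  by (simp add: borel_\<Delta>_def space_measure_of_conv)

lemma openin_borel_\<Delta>: "openin top_\<Delta> U \<Longrightarrow> U \<in> sets borel_\<Delta>"
  by (simp add: borel_\<Delta>_def)

text \<open>Both kinds of complement are open: that of \<Delta> is the copy of S, and that of a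
  point of S is a neighbourhood of \<Delta> because a point is compact and closed.\<close>

lemma singleton_borel_\<Delta> [simp]: "{x :: 's::t2_space option} \<in> sets borel_\<Delta>"
proof (cases x)
  case None
  have "openin top_\<Delta> (Some ` UNIV :: 's option set)" by simp
  then have "UNIV - Some ` (UNIV :: 's set) \<in> sets borel_\<Delta>"
    using sets.compl_sets[OF openin_borel_\<Delta>, of "Some ` UNIV"] by simp
  moreover have "UNIV - Some ` (UNIV :: 's set) = {None}"
    by (auto simp: UNIV_option_conv)
  ultimately show ?thesis using None by simp
next
  case (Some y)
  have "openin top_\<Delta> (insert None (Some ` (topspace euclidean - {y})))"
    unfolding openin_Alexandroff_compactification
    by (rule disjI2) (rule exI[of _ "{y}"], simp)
  then have "UNIV - insert None (Some ` (topspace euclidean - {y})) \<in> sets borel_\<Delta>"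
    using sets.compl_sets[OF openin_borel_\<Delta>] by simp
  moreover have "UNIV - insert None (Some ` (topspace euclidean - {y})) = {Some y}"
    by (auto simp: UNIV_option_conv)
  ultimately show ?thesis using Some by simp
qed

lemma measurable_completion_AE:
  assumes f: "f \<in> completion M \<rightarrow>\<^sub>M N" and eq: "AE x in M. f x = g x" and g: "g \<in> space M \<rightarrow> space N"
  shows "g \<in> completion M \<rightarrow>\<^sub>M N"
proof (rule measurableI)
  show "g x \<in> space N" if "x \<in> space (completion M)" for x using that g by auto
  fix B assume B: "B \<in> sets N"
  obtain K where K: "{x\<in>space M. f x \<noteq> g x} \<subseteq> K" "K \<in> null_sets M"
    using AE_E[OF eq] by (metis null_setsI)
  have "f -` B \<inter> space (completion M) - K \<in> sets (completion M)"
    using measurable_sets[OF f B] K(2) by (intro sets.Diff) auto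
  moreover have "g -` B \<inter> space M \<inter> K \<in> sets (completion M)"
    by (rule sets_completionI[of _ "{}" _ K]) (use K(2) in auto)
  ultimately have "(f -` B \<inter> space (completion M) - K) \<union> (g -` B \<inter> space M \<inter> K) \<in> sets (completion M)"
    by (rule sets.Un)
  also have "(f -` B \<inter> space (completion M) - K) \<union> (g -` B \<inter> space M \<inter> K) = g -` B \<inter> space (completion M)"
    using K(1) by auto
  finally show "g -` B \<inter> space (completion M) \<in> sets (completion M)" .
qed

locale std_proc =
  fixes Z :: "('w, 's::t2_space) process"
  assumes std: "standard_process Z"
begin

abbreviation "\<Omega> \<equiv> space (msp Z)"
abbreviation "X \<equiv> path Z"
abbreviation "\<theta> \<equiv> shift Z"
abbreviation "raw \<equiv> raw_filtration Z"
abbreviation "aug \<equiv> aug_filtration Z"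

text \<open>Completing the laws makes every \<open>aug t\<close> a subalgebra
  (\<open>subalgebra_\<P>\<close>) and changes neither nonnegative integrals nor almost sure
  statements.\<close>

definition "\<P> x = completion (law Z x)"

lemma prob_law: "prob_space (law Z x)" and sets_law: "sets (law Z x) = sets (msp Z)"
  and X_msp: "X t \<in> msp Z \<rightarrow>\<^sub>M borel_\<Delta>"
  and kernel_X: "B \<in> sets borel_\<Delta> \<Longrightarrow>
    (\<lambda>x. emeasure (law Z x) {w\<in>\<Omega>. X t w \<in> B}) \<in> borel_measurable borel_\<Delta>"
  using std by (auto simp: standard_process_def normal_process_def)

lemma space_law [simp]: "space (law Z x) = \<Omega>"
  using sets_law sets_eq_imp_space_eq by blast

lemma space_\<P> [simp]: "space (\<P> x) = \<Omega>"
  by (simp add: \<P>_def)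

lemma sets_\<P>: "A \<in> sets (msp Z) \<Longrightarrow> A \<in> sets (\<P> x)"
  by (simp add: \<P>_def sets_law)

lemma measurable_\<P>: "f \<in> msp Z \<rightarrow>\<^sub>M N \<Longrightarrow> f \<in> \<P> x \<rightarrow>\<^sub>M N"
  unfolding \<P>_def by (rule measurable_completion) (simp cong: measurable_cong_sets add: sets_law)

lemma emeasure_\<P>: "A \<in> sets (msp Z) \<Longrightarrow> emeasure (\<P> x) A = emeasure (law Z x) A"
  by (simp add: \<P>_def sets_law)

lemma nn_integral_\<P>: "integral\<^sup>N (\<P> x) f = integral\<^sup>N (law Z x) f"
  by (simp add: \<P>_def nn_integral_completion)

lemma AE_\<P>: "(AE w in \<P> x. Q w) \<longleftrightarrow> (AE w in law Z x. Q w)"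
  unfolding \<P>_def by (rule AE_completion_iff)

lemma prob_\<P>: "prob_space (\<P> x)"
proof
  interpret prob_space "law Z x" by (rule prob_law)
  show "emeasure (\<P> x) (space (\<P> x)) = 1"
    using emeasure_space_1 by (simp add: emeasure_\<P>)
qed

lemma X_shift: "w \<in> \<Omega> \<Longrightarrow> X s (\<theta> t w) = X (s + t) w"
  and shift_space: "w \<in> \<Omega> \<Longrightarrow> \<theta> t w \<in> \<Omega>"
  using std by (auto simp: standard_process_def shift_operators_def)

lemma space_raw [simp]: "space (raw t) = \<Omega>"
  by (simp add: raw_filtration_def space_measure_of_conv)

lemma sets_raw: "sets (raw t) = sigma_sets \<Omega> {X s -` B \<inter> \<Omega> | s B. s \<le> t \<and> B \<in> sets borel_\<Delta>}"
  unfolding raw_filtration_def by (rule sets_measure_of) auto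

lemma raw_subset_msp: "sets (raw t) \<subseteq> sets (msp Z)"
  unfolding sets_raw
  by (rule sets.sigma_sets_subset) (use X_msp in \<open>auto simp: measurable_def\<close>)

lemma X_raw: "s \<le> t \<Longrightarrow> X s \<in> raw t \<rightarrow>\<^sub>M borel_\<Delta>"
  by (rule measurableI) (auto simp: sets_raw intro!: sigma_sets.Basic)

lemma raw_mono: "s \<le> t \<Longrightarrow> sets (raw s) \<subseteq> sets (raw t)"
  unfolding sets_raw by (rule sigma_sets_mono') (auto intro: order_trans)

lemma space_aug [simp]: "space (aug t) = \<Omega>"
  by (simp add: aug_filtration_def space_measure_of_conv)

text \<open>The generators of \<open>aug t\<close>, named so that inclusions can be checked on them
  without first showing that they form a \<sigma>-algebra.\<close>

definition "augm t = {A. A \<subseteq> \<Omega> \<and>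
         (\<forall>\<pi>. initial_distribution \<pi> \<longrightarrow>
            (\<exists>B\<in>sets (raw t). \<exists>N\<in>null_sets (init_law Z \<pi>). (A - B) \<union> (B - A) \<subseteq> N))}"

lemma sets_aug: "sets (aug t) = sigma_sets \<Omega> (augm t)"
  unfolding aug_filtration_def augm_def by (rule sets_measure_of) auto

lemma raw_subset_aug: "sets (raw t) \<subseteq> sets (aug t)"
proof
  fix A assume A: "A \<in> sets (raw t)"
  have "\<exists>N\<in>null_sets (init_law Z \<pi>). (A - A) \<union> (A - A) \<subseteq> N" for \<pi>
    by (rule bexI[where x="{}"]) simp_all
  then have *: "\<exists>B\<in>sets (raw t). \<exists>N\<in>null_sets (init_law Z \<pi>). (A - B) \<union> (B - A) \<subseteq> N" for \<pi>
    by (rule bexI[where x=A]) (rule A)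
  have "A \<in> augm t"
    unfolding augm_def mem_Collect_eq
    by (intro conjI allI impI *) (use sets.sets_into_space[OF A] in simp)
  then show "A \<in> sets (aug t)"
    unfolding sets_aug by (rule sigma_sets.Basic)
qed

lemma aug_mono:
  assumes "s \<le> t" shows "sets (aug s) \<subseteq> sets (aug t)"
  unfolding sets_aug
proof (rule sigma_sets_mono', rule subsetI)
  fix A assume "A \<in> augm s"
  then have sub: "A \<subseteq> \<Omega>" and A: "\<And>\<pi>. initial_distribution \<pi> \<Longrightarrow>
      \<exists>B\<in>sets (raw s). \<exists>N\<in>null_sets (init_law Z \<pi>). (A - B) \<union> (B - A) \<subseteq> N"
    unfolding augm_def mem_Collect_eq by iprover+
  show "A \<in> augm t"
    unfolding augm_def mem_Collect_eq
  proof (intro conjI allI impI)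
    show "A \<subseteq> \<Omega>" by (rule sub)
    fix \<pi> :: "'s option measure" assume "initial_distribution \<pi>"
    from A[OF this] show "\<exists>B\<in>sets (raw t). \<exists>N\<in>null_sets (init_law Z \<pi>). (A - B) \<union> (B - A) \<subseteq> N"
      by (rule bexE) (rule bexI, assumption, rule subsetD[OF raw_mono[OF assms]])
  qed
qed

lemma measurable_raw_aug: "f \<in> raw t \<rightarrow>\<^sub>M N \<Longrightarrow> f \<in> aug t \<rightarrow>\<^sub>M N"
  by (rule measurable_from_subalg[of "aug t" "raw t"]) (simp_all add: subalgebra_def raw_subset_aug)

lemma measurable_aug_mono: "f \<in> aug s \<rightarrow>\<^sub>M N \<Longrightarrow> s \<le> t \<Longrightarrow> f \<in> aug t \<rightarrow>\<^sub>M N"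
  by (rule measurable_from_subalg[of "aug t" "aug s"]) (simp_all add: subalgebra_def aug_mono)

lemma filtration_aug: "filtration \<Omega> aug"
  by standard (simp, rule aug_mono)

lemma X_aug: "s \<le> t \<Longrightarrow> X s \<in> aug t \<rightarrow>\<^sub>M borel_\<Delta>"
  by (intro measurable_raw_aug X_raw)

text \<open>The strong Markov property at the constant stopping time t. For fixed u the condition t
  \<le> u holds everywhere or nowhere, so an event of \<open>aug t\<close> belongs to the
  \<sigma>-algebra of this stopping time.\<close>

lemma Markov_sets:
  assumes \<Lambda>: "\<Lambda> \<in> sets (aug t)" and B: "B \<in> sets borel_\<Delta>"
  shows "emeasure (\<P> x) {w\<in>\<Lambda>. X (t + s) w \<in> B} =
    (\<integral>\<^sup>+w\<in>\<Lambda>. emeasure (law Z (X t w)) {w'\<in>\<Omega>. X s w' \<in> B} \<partial>\<P> x)"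
proof -
  interpret filtration \<Omega> aug by (rule filtration_aug)
  have st: "stopping_time aug (\<lambda>_. t)" by (rule stopping_time_const)
  have "\<Lambda> \<in> sets (filtration.pre_sigma \<Omega> aug (\<lambda>_. t))"
  proof (rule sets_pre_sigmaI[OF st])
    fix u show "{w \<in> \<Lambda>. t \<le> u} \<in> sets (aug u)"
      using \<Lambda> aug_mono by (cases "t \<le> u") auto
  qed
  moreover have "strong_Markov Z" using std by (simp add: standard_process_def)
  note conjunct2[OF this[unfolded strong_Markov_def], rule_format, OF B st, folded \<P>_def]
  ultimately show ?thesis by blast
qed

text \<open>The transition kernel over a time span s, in the form required by
  \<open>bind\<close>.\<close>

definition "path_kernel s x = distr (law Z x) borel_\<Delta> (X s)"

lemma X_law: "X s \<in> law Z x \<rightarrow>\<^sub>M borel_\<Delta>"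
  using X_msp by (simp cong: measurable_cong_sets add: sets_law)

lemma emeasure_path_kernel:
  "B \<in> sets borel_\<Delta> \<Longrightarrow> emeasure (path_kernel s x) B = emeasure (law Z x) {w\<in>\<Omega>. X s w \<in> B}"
  unfolding path_kernel_def by (simp add: emeasure_distr[OF X_law] vimage_def Collect_conj_eq Int_commute)

lemma path_kernel_measurable: "path_kernel s \<in> borel_\<Delta> \<rightarrow>\<^sub>M subprob_algebra borel_\<Delta>"
proof (rule measurable_subprob_algebra)
  fix x
  interpret prob_space "law Z x" by (rule prob_law)
  show "subprob_space (path_kernel s x)"
    unfolding path_kernel_def by (intro prob_space_imp_subprob_space prob_space_distr X_law)
  show "sets (path_kernel s x) = sets borel_\<Delta>" by (simp add: path_kernel_def)
qed (simp add: emeasure_path_kernel kernel_X)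

lemma nn_integral_X_measurable:
  assumes "\<phi> \<in> borel_measurable borel_\<Delta>"
  shows "(\<lambda>x. \<integral>\<^sup>+w. \<phi> (X s w) \<partial>law Z x) \<in> borel_measurable borel_\<Delta>"
proof -
  have "(\<lambda>x. \<integral>\<^sup>+y. \<phi> y \<partial>path_kernel s x) \<in> borel_measurable borel_\<Delta>"
    by (rule measurable_compose[OF path_kernel_measurable nn_integral_measurable_subprob_algebra[OF assms]])
  moreover have "(\<integral>\<^sup>+y. \<phi> y \<partial>path_kernel s x) = (\<integral>\<^sup>+w. \<phi> (X s w) \<partial>law Z x)" for x
    unfolding path_kernel_def using assms by (intro nn_integral_distr X_law) simp
  ultimately show ?thesis by simp
qed

lemma X_\<P>: "X s \<in> \<P> x \<rightarrow>\<^sub>M borel_\<Delta>"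
  by (intro measurable_\<P> X_msp)

lemma X_Collect:
  assumes "X s \<in> M \<rightarrow>\<^sub>M borel_\<Delta>" "\<Lambda> \<in> sets M" "B \<in> sets borel_\<Delta>"
  shows "{w\<in>\<Lambda>. X s w \<in> B} \<in> sets M"
proof -
  have "{w\<in>\<Lambda>. X s w \<in> B} = \<Lambda> \<inter> (X s -` B \<inter> space M)"
    using sets.sets_into_space[OF assms(2)] by auto
  then show ?thesis using assms measurable_sets[OF assms(1,3)] by auto
qed

text \<open>Both sides integrate \<phi> against a measure: the law of X at time t + s on \<Lambda>,
  and the law of X at time t on \<Lambda> followed by the kernel. By \<open>Markov_sets\<close>
  these measures agree on sets, so no separate approximation of \<phi> is needed.\<close>

lemma Markov_fun:
  assumes \<Lambda>: "\<Lambda> \<in> sets (aug t)" "\<Lambda> \<in> sets (\<P> x)" and \<phi>: "\<phi> \<in> borel_measurable borel_\<Delta>"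
  shows "(\<integral>\<^sup>+w\<in>\<Lambda>. \<phi> (X (t + s) w) \<partial>\<P> x) =
    (\<integral>\<^sup>+w\<in>\<Lambda>. (\<integral>\<^sup>+w'. \<phi> (X s w') \<partial>law Z (X t w)) \<partial>\<P> x)"
proof -
  let ?M = "density (\<P> x) (indicator \<Lambda>)" and ?N = "distr (density (\<P> x) (indicator \<Lambda>)) borel_\<Delta> (X t)"
  note [measurable] = \<Lambda>(2) \<phi> X_\<P>
  have XM: "X u \<in> ?M \<rightarrow>\<^sub>M borel_\<Delta>" for u by (simp add: X_\<P>)
  have k: "path_kernel s \<in> ?N \<rightarrow>\<^sub>M subprob_algebra borel_\<Delta>"
    using path_kernel_measurable by (simp cong: measurable_cong_sets)
  have sets_b: "sets (bind ?N (path_kernel s)) = sets borel_\<Delta>"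
    by (rule sets_bind[OF sets_kernel[OF k]]) auto
  have eq: "distr ?M borel_\<Delta> (X (t + s)) = bind ?N (path_kernel s)"
  proof (rule measure_eqI)
    fix B assume "B \<in> sets (distr ?M borel_\<Delta> (X (t + s)))"
    then have B: "B \<in> sets borel_\<Delta>" by simp
    have [measurable]: "(\<lambda>w. emeasure (path_kernel s (X t w)) B) \<in> borel_measurable (\<P> x)"
      using measurable_compose[OF X_\<P> measurable_emeasure_kernel[OF path_kernel_measurable B]] .
    have "emeasure (distr ?M borel_\<Delta> (X (t + s))) B = emeasure ?M (X (t + s) -` B \<inter> \<Omega>)"
      by (simp add: emeasure_distr[OF XM B])
    also have "\<dots> = emeasure (\<P> x) (\<Lambda> \<inter> (X (t + s) -` B \<inter> \<Omega>))"
      using measurable_sets[OF X_\<P> B] by (subst emeasure_density) (auto simp: indicator_inter_arith[symmetric])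
    also have "\<Lambda> \<inter> (X (t + s) -` B \<inter> \<Omega>) = {w\<in>\<Lambda>. X (t + s) w \<in> B}"
      using sets.sets_into_space[OF \<Lambda>(2)] by auto
    also have "emeasure (\<P> x) \<dots> = (\<integral>\<^sup>+w\<in>\<Lambda>. emeasure (path_kernel s (X t w)) B \<partial>\<P> x)"
      by (simp add: Markov_sets[OF \<Lambda>(1) B] emeasure_path_kernel[OF B])
    also have "\<dots> = (\<integral>\<^sup>+w. emeasure (path_kernel s (X t w)) B \<partial>?M)"
      by (simp add: nn_integral_density mult.commute)
    also have "\<dots> = (\<integral>\<^sup>+y. emeasure (path_kernel s y) B \<partial>?N)"
      by (rule nn_integral_distr[OF XM, symmetric])
        (use measurable_emeasure_kernel[OF path_kernel_measurable B] in simp)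
    also have "\<dots> = emeasure (bind ?N (path_kernel s)) B"
      by (rule emeasure_bind[OF _ k B, symmetric]) simp
    finally show "emeasure (distr ?M borel_\<Delta> (X (t + s))) B = emeasure (bind ?N (path_kernel s)) B" .
  qed (simp add: sets_b)
  have E: "integral\<^sup>N (path_kernel s y) \<phi> = (\<integral>\<^sup>+w'. \<phi> (X s w') \<partial>law Z y)" for y
    unfolding path_kernel_def using \<phi> by (intro nn_integral_distr X_law) simp
  have [measurable]: "(\<lambda>w. \<integral>\<^sup>+w'. \<phi> (X s w') \<partial>law Z (X t w)) \<in> borel_measurable (\<P> x)"
    by (rule measurable_compose[OF X_\<P> nn_integral_X_measurable[OF \<phi>]])
  have "(\<integral>\<^sup>+w\<in>\<Lambda>. \<phi> (X (t + s) w) \<partial>\<P> x) = (\<integral>\<^sup>+w. \<phi> (X (t + s) w) \<partial>?M)"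
    by (simp add: nn_integral_density mult.commute)
  also have "\<dots> = integral\<^sup>N (bind ?N (path_kernel s)) \<phi>"
    unfolding eq[symmetric] by (rule nn_integral_distr[OF XM, symmetric]) simp
  also have "\<dots> = (\<integral>\<^sup>+y. (\<integral>\<^sup>+w'. \<phi> (X s w') \<partial>law Z y) \<partial>?N)"
    unfolding E[symmetric] by (rule nn_integral_bind[OF \<phi> k])
  also have "\<dots> = (\<integral>\<^sup>+w. (\<integral>\<^sup>+w'. \<phi> (X s w') \<partial>law Z (X t w)) \<partial>?M)"
    by (rule nn_integral_distr[OF XM]) (simp add: nn_integral_X_measurable[OF \<phi>])
  finally show ?thesis by (simp add: nn_integral_density mult.commute)
qed

text \<open>Whether \<^const>\<open>init_law\<close> is a measure at all, and hence whether \<open>aug\<close> is a sensible augmentation, depends on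
  the measurability of \<open>P\<^sub>x(A)\<close> in \<open>x\<close>. It is proved together with the Markov property, for which the
  events \<open>\<Lambda>\<close> are for the time being required to be measurable for the completed law.\<close>

definition "cyl J B = {w\<in>\<Omega>. \<forall>s\<in>J. X s w \<in> B s}"

definition "Markov_event A \<longleftrightarrow> A \<in> sets (raw \<infinity>) \<and>
   (\<lambda>y. emeasure (law Z y) A) \<in> borel_measurable borel_\<Delta> \<and>
   (\<forall>x t \<Lambda>. \<Lambda> \<in> sets (aug t) \<longrightarrow> \<Lambda> \<in> sets (\<P> x) \<longrightarrow>
      emeasure (\<P> x) {w\<in>\<Lambda>. \<theta> t w \<in> A} = (\<integral>\<^sup>+w\<in>\<Lambda>. emeasure (law Z (X t w)) A \<partial>\<P> x))"

lemma raw_law: "A \<in> sets (raw t) \<Longrightarrow> A \<in> sets (law Z x)"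
  using raw_subset_msp sets_law by blast

lemma cyl_raw:
  assumes "finite J" "\<And>s. B s \<in> sets borel_\<Delta>"
  shows "cyl J B \<in> sets (raw \<infinity>)"
proof -
  have "{w\<in>space (raw \<infinity>). X s w \<in> B s} \<in> sets (raw \<infinity>)" for s
    using X_Collect[OF X_raw sets.top assms(2)] by simp
  then have "{w\<in>space (raw \<infinity>). \<forall>s\<in>J. X s w \<in> B s} \<in> sets (raw \<infinity>)"
    by (intro sets.sets_Collect_finite_All assms)
  then show ?thesis by (simp add: cyl_def)
qed

lemma Markov_eventD:
  assumes "Markov_event A"
  shows "A \<in> sets (raw \<infinity>)" "(\<lambda>y. emeasure (law Z y) A) \<in> borel_measurable borel_\<Delta>"
    "\<Lambda> \<in> sets (aug t) \<Longrightarrow> \<Lambda> \<in> sets (\<P> x) \<Longrightarrow>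
      emeasure (\<P> x) {w\<in>\<Lambda>. \<theta> t w \<in> A} = (\<integral>\<^sup>+w\<in>\<Lambda>. emeasure (law Z (X t w)) A \<partial>\<P> x)"
  using assms unfolding Markov_event_def by blast+

lemma emeasure_law_space: "emeasure (law Z x) \<Omega> = 1"
  using prob_space.emeasure_space_1[OF prob_law, of x] by simp

lemma space_in_aug: "\<Omega> \<in> sets (aug t)" and space_in_\<P>: "\<Omega> \<in> sets (\<P> x)"
  using sets.top[of "aug t"] sets.top[of "\<P> x"] by auto

lemma Markov_event_space: "Markov_event \<Omega>"
  unfolding Markov_event_def
proof (intro conjI allI impI)
  show "\<Omega> \<in> sets (raw \<infinity>)" using sets.top[of "raw \<infinity>"] by simp
  show "(\<lambda>y. emeasure (law Z y) \<Omega>) \<in> borel_measurable borel_\<Delta>"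
    by (simp add: emeasure_law_space)
  fix x t \<Lambda> assume "\<Lambda> \<in> sets (\<P> x)"
  moreover have "{w\<in>\<Lambda>. \<theta> t w \<in> \<Omega>} = \<Lambda>"
    using sets.sets_into_space[OF \<open>\<Lambda> \<in> sets (\<P> x)\<close>] shift_space by auto
  ultimately show "emeasure (\<P> x) {w\<in>\<Lambda>. \<theta> t w \<in> \<Omega>} = (\<integral>\<^sup>+w\<in>\<Lambda>. emeasure (law Z (X t w)) \<Omega> \<partial>\<P> x)"
    by (simp add: emeasure_law_space)
qed

text \<open>Induction on the number of times. The earliest time u is split off: the cylinder occurs
  iff X at time u lies in \<open>B u\<close> and the path shifted by u lies in a cylinder with one
  time fewer. The induction hypothesis is used at time t + u on the smaller event, then
  \<open>Markov_fun\<close> leads back from t + u to t.\<close>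

lemma Markov_event_cyl:
  assumes "finite J" "\<And>s. B s \<in> sets borel_\<Delta>"
  shows "Markov_event (cyl J B)"
  using assms
proof (induction "card J" arbitrary: J B rule: less_induct)
  case less
  show ?case
  proof (cases "J = {}")
    case True
    then show ?thesis using Markov_event_space by (simp add: cyl_def)
  next
    case False
    define u where "u = Min J"
    have u: "u \<in> J" "\<And>s. s \<in> J \<Longrightarrow> u \<le> s"
      using False less.prems(1) by (auto simp: u_def)
    define J' where "J' = (\<lambda>s. s - u) ` (J - {u})"
    define B' where "B' s = B (s + u)" for s
    have "card J' \<le> card (J - {u})" unfolding J'_def
      by (rule card_image_le) (use less.prems(1) in simp)
    also have "\<dots> < card J" using u(1) less.prems(1) by (intro card_Diff1_less) auto
    finally have "card J' < card J" .
    then have G: "Markov_event (cyl J' B')"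
      by (rule less.hyps) (use less.prems in \<open>auto simp: J'_def B'_def\<close>)
    \<comment> \<open>The conditional probability of the cylinder when X is at z at the earliest
      time u.\<close>
    define \<phi> where "\<phi> z = indicator (B u) z * emeasure (law Z z) (cyl J' B')" for z
    have \<phi>: "\<phi> \<in> borel_measurable borel_\<Delta>"
      unfolding \<phi>_def using Markov_eventD(2)[OF G] less.prems(2)[of u] by measurable
    have cyl_shift: "\<theta> t w \<in> cyl J B \<longleftrightarrow> X (t + u) w \<in> B u \<and> \<theta> (t + u) w \<in> cyl J' B'"
      if w: "w \<in> \<Omega>" for t w
    proof -
      have "X (s - u) (\<theta> (t + u) w) = X (s + t) w" "B' (s - u) = B s" if "s \<in> J" for s
      proof -
        have "s - u + u = s" by (rule diff_add_cancel_ennreal[OF u(2)[OF that]])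
        then show "X (s - u) (\<theta> (t + u) w) = X (s + t) w" "B' (s - u) = B s"
          using X_shift[OF w] by (simp_all add: B'_def) (metis add.assoc add.commute)
      qed
      then have "\<theta> (t + u) w \<in> cyl J' B' \<longleftrightarrow> (\<forall>s\<in>J - {u}. X (s + t) w \<in> B s)"
        using shift_space[OF w] by (auto simp: cyl_def J'_def)
      moreover have "\<theta> t w \<in> cyl J B \<longleftrightarrow> (\<forall>s\<in>J. X (s + t) w \<in> B s)"
        using shift_space[OF w] X_shift[OF w] by (auto simp: cyl_def)
      ultimately show ?thesis using u(1) by (auto simp: add.commute)
    qed
    have main: "emeasure (\<P> x) {w\<in>\<Lambda>. \<theta> t w \<in> cyl J B} = (\<integral>\<^sup>+w\<in>\<Lambda>. \<phi> (X (t + u) w) \<partial>\<P> x)"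
      if \<Lambda>: "\<Lambda> \<in> sets (aug t)" "\<Lambda> \<in> sets (\<P> x)" for x t \<Lambda>
    proof -
      let ?\<Lambda> = "{w\<in>\<Lambda>. X (t + u) w \<in> B u}"
      have "\<Lambda> \<in> sets (aug (t + u))" using \<Lambda>(1) aug_mono[of t "t + u"] by auto
      then have 1: "?\<Lambda> \<in> sets (aug (t + u))"
        by (intro X_Collect X_aug less.prems) auto
      have 2: "?\<Lambda> \<in> sets (\<P> x)"
        by (intro X_Collect X_\<P> less.prems \<Lambda>)
      have "{w\<in>\<Lambda>. \<theta> t w \<in> cyl J B} = {w\<in>?\<Lambda>. \<theta> (t + u) w \<in> cyl J' B'}"
        using sets.sets_into_space[OF \<Lambda>(2)] cyl_shift by auto
      then have "emeasure (\<P> x) {w\<in>\<Lambda>. \<theta> t w \<in> cyl J B} =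
          (\<integral>\<^sup>+w\<in>?\<Lambda>. emeasure (law Z (X (t + u) w)) (cyl J' B') \<partial>\<P> x)"
        using Markov_eventD(3)[OF G 1 2] by simp
      also have "\<dots> = (\<integral>\<^sup>+w\<in>\<Lambda>. \<phi> (X (t + u) w) \<partial>\<P> x)"
        by (intro nn_integral_cong) (auto simp: \<phi>_def split: split_indicator)
      finally show ?thesis .
    qed
    have law_cyl: "emeasure (law Z y) (cyl J B) = (\<integral>\<^sup>+w. \<phi> (X u w) \<partial>law Z y)" for y
    proof -
      \<comment> \<open>The shift by 0 is not assumed to be the identity, but it preserves all
        coordinates, and a cylinder sees nothing else.\<close>
      have "{w\<in>\<Omega>. \<theta> 0 w \<in> cyl J B} = cyl J B"
        using shift_space X_shift by (auto simp: cyl_def)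
      then have "emeasure (\<P> y) (cyl J B) = (\<integral>\<^sup>+w\<in>\<Omega>. \<phi> (X u w) \<partial>\<P> y)"
        using main[OF space_in_aug[of 0] space_in_\<P>[of y]] by simp
      also have "\<dots> = (\<integral>\<^sup>+w. \<phi> (X u w) \<partial>\<P> y)"
        by (intro nn_integral_cong) simp
      finally show ?thesis
        using emeasure_\<P>[OF subsetD[OF raw_subset_msp cyl_raw[OF less.prems]], of y] by (simp add: nn_integral_\<P>)
    qed
    show ?thesis
      unfolding Markov_event_def
    proof (intro conjI allI impI)
      show "cyl J B \<in> sets (raw \<infinity>)" by (rule cyl_raw[OF less.prems])
      show "(\<lambda>y. emeasure (law Z y) (cyl J B)) \<in> borel_measurable borel_\<Delta>"
        unfolding law_cyl by (rule nn_integral_X_measurable[OF \<phi>])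
      fix x t \<Lambda> assume \<Lambda>: "\<Lambda> \<in> sets (aug t)" "\<Lambda> \<in> sets (\<P> x)"
      show "emeasure (\<P> x) {w\<in>\<Lambda>. \<theta> t w \<in> cyl J B} = (\<integral>\<^sup>+w\<in>\<Lambda>. emeasure (law Z (X t w)) (cyl J B) \<partial>\<P> x)"
        unfolding main[OF \<Lambda>] law_cyl by (rule Markov_fun[OF \<Lambda> \<phi>])
    qed
  qed
qed

lemma shift_raw: "\<theta> t \<in> msp Z \<rightarrow>\<^sub>M raw \<infinity>"
  unfolding raw_filtration_def
proof (rule measurable_measure_of)
  show "\<theta> t \<in> \<Omega> \<rightarrow> \<Omega>" using shift_space by auto
  fix A assume "A \<in> {X s -` B \<inter> \<Omega> |s B. s \<le> \<infinity> \<and> B \<in> sets borel_\<Delta>}"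
  then obtain s B where A: "A = X s -` B \<inter> \<Omega>" and B: "B \<in> sets borel_\<Delta>" by blast
  have "\<theta> t -` A \<inter> \<Omega> = {w\<in>\<Omega>. X (s + t) w \<in> B}"
    using shift_space X_shift by (auto simp: A)
  then show "\<theta> t -` A \<inter> \<Omega> \<in> sets (msp Z)"
    using X_Collect[OF X_msp sets.top B] by simp
qed auto

lemma shift_\<P>: "\<theta> t \<in> \<P> x \<rightarrow>\<^sub>M raw \<infinity>"
  by (rule measurable_\<P>[OF shift_raw])

lemma shift_Collect:
  assumes "\<Lambda> \<in> sets (\<P> x)" "A \<in> sets (raw \<infinity>)"
  shows "{w\<in>\<Lambda>. \<theta> t w \<in> A} \<in> sets (\<P> x)"
proof -
  have "{w\<in>\<Lambda>. \<theta> t w \<in> A} = \<Lambda> \<inter> (\<theta> t -` A \<inter> space (\<P> x))"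
    using sets.sets_into_space[OF assms(1)] by auto
  then show ?thesis using assms(1) measurable_sets[OF shift_\<P> assms(2)] by auto
qed

text \<open>Dynkin's argument: cylinders are stable under intersection and generate the raw
  \<sigma>-algebra, while complements and disjoint countable unions preserve both the measurability
  and the Markov identity.\<close>

lemma Markov_event_raw:
  assumes "A \<in> sets (raw \<infinity>)"
  shows "Markov_event A"
proof -
  let ?G = "{cyl J B | J B. finite J \<and> (\<forall>s. B s \<in> sets borel_\<Delta>)}"
  have Int: "Int_stable ?G"
  proof (rule Int_stableI)
    fix a b assume "a \<in> ?G" "b \<in> ?G"
    then obtain J B J' B' where a: "a = cyl J B" "finite J" "\<And>s. B s \<in> sets borel_\<Delta>"
      and b: "b = cyl J' B'" "finite J'" "\<And>s. B' s \<in> sets borel_\<Delta>" by blast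
    \<comment> \<open>Times that occur in only one of the two cylinders are left unconstrained by
      the other.\<close>
    let ?B = "\<lambda>s. (if s \<in> J then B s else UNIV) \<inter> (if s \<in> J' then B' s else UNIV)"
    have "a \<inter> b = cyl (J \<union> J') ?B"
      unfolding a b cyl_def by auto
    moreover have "?B s \<in> sets borel_\<Delta>" for s
      using a(3)[of s] b(3)[of s] sets.top[of borel_\<Delta>] by auto
    ultimately show "a \<inter> b \<in> ?G" using a(2) b(2) by blast
  qed
  have "sets (raw \<infinity>) \<subseteq> sigma_sets \<Omega> ?G"
    unfolding sets_raw
  proof (rule sigma_sets_mono', rule subsetI)
    fix A assume "A \<in> {X s -` B \<inter> \<Omega> |s B. s \<le> \<infinity> \<and> B \<in> sets borel_\<Delta>}"
    then obtain s B where A: "A = X s -` B \<inter> \<Omega>" and B: "B \<in> sets borel_\<Delta>" by blast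
    have "A = cyl {s} (\<lambda>_. B)" by (auto simp: A cyl_def)
    then show "A \<in> ?G" using B by blast
  qed
  with assms have A: "A \<in> sigma_sets \<Omega> ?G" by blast
  have "?G \<subseteq> Pow \<Omega>" by (auto simp: cyl_def)
  from Int this A show ?thesis
  proof (induction rule: sigma_sets_induct_disjoint)
    case (basic A)
    then show ?case using Markov_event_cyl by blast
  next
    case empty
    show ?case unfolding Markov_event_def by simp
  next
    case (compl A)
    note A = Markov_eventD[OF compl.IH]
    have "emeasure (law Z y) (\<Omega> - A) = 1 - emeasure (law Z y) A" for y
      using emeasure_compl[OF raw_law[OF A(1), of y]] prob_space.emeasure_space_1[OF prob_law, of y]
        prob_space.finite_measure[OF prob_law, of y] finite_measure.emeasure_finite by fastforce
    note compl_law = this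
    have sum1: "emeasure (law Z y) A + emeasure (law Z y) (\<Omega> - A) = 1" for y
    proof -
      have "emeasure (law Z y) A \<le> 1"
        using prob_space.measure_le_1[OF prob_law] by blast
      then show ?thesis unfolding compl_law by (simp add: ennreal_add_diff_cancel)
    qed
    have Ac: "\<Omega> - A \<in> sets (raw \<infinity>)" using sets.compl_sets[OF A(1)] by simp
    have [measurable]: "(\<lambda>y. emeasure (law Z y) (\<Omega> - A)) \<in> borel_measurable borel_\<Delta>"
      unfolding compl_law using A(2) by measurable
    show ?case
      unfolding Markov_event_def
    proof (intro conjI allI impI)
      show "\<Omega> - A \<in> sets (raw \<infinity>)" by (rule Ac)
      show "(\<lambda>y. emeasure (law Z y) (\<Omega> - A)) \<in> borel_measurable borel_\<Delta>" by measurable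
      fix x t \<Lambda> assume \<Lambda>: "\<Lambda> \<in> sets (aug t)" and \<Lambda>P[measurable]: "\<Lambda> \<in> sets (\<P> x)"
      interpret prob_space "\<P> x" by (rule prob_\<P>)
      note [measurable] = X_\<P> A(2)
      let ?L = "\<lambda>A. emeasure (\<P> x) {w\<in>\<Lambda>. \<theta> t w \<in> A}"
      let ?R = "\<lambda>A. \<integral>\<^sup>+w\<in>\<Lambda>. emeasure (law Z (X t w)) A \<partial>\<P> x"
      \<comment> \<open>On either side the contributions of A and of its complement add up to the
        probability of \<Lambda>; that of A is known and finite, so it cancels.\<close>
      have "{w\<in>\<Lambda>. \<theta> t w \<in> A} \<union> {w\<in>\<Lambda>. \<theta> t w \<in> \<Omega> - A} = \<Lambda>"
        using sets.sets_into_space[OF \<Lambda>P] shift_space by auto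
      then have "?L A + ?L (\<Omega> - A) = emeasure (\<P> x) \<Lambda>"
        using plus_emeasure[OF shift_Collect[OF \<Lambda>P A(1), of t] shift_Collect[OF \<Lambda>P Ac, of t]] by (simp add: disjoint_iff)
      also have "\<dots> = (\<integral>\<^sup>+w. emeasure (law Z (X t w)) A * indicator \<Lambda> w + emeasure (law Z (X t w)) (\<Omega> - A) * indicator \<Lambda> w \<partial>\<P> x)"
        by (simp add: distrib_right[symmetric] sum1)
      also have "\<dots> = ?R A + ?R (\<Omega> - A)"
        by (intro nn_integral_add) auto
      finally have "?L A + ?L (\<Omega> - A) = ?L A + ?R (\<Omega> - A)"
        by (simp add: A(3)[OF \<Lambda> \<Lambda>P])
      then show "?L (\<Omega> - A) = ?R (\<Omega> - A)"
        by (simp add: ennreal_add_left_cancel)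
    qed
  next
    case (union A)
    note A = Markov_eventD[OF union.IH]
    have law_UN: "emeasure (law Z y) (\<Union>i. A i) = (\<Sum>i. emeasure (law Z y) (A i))" for y
      using union(1) raw_law[OF A(1)] by (intro suminf_emeasure[symmetric]) auto
    show ?case
      unfolding Markov_event_def
    proof (intro conjI allI impI)
      show "(\<Union>i. A i) \<in> sets (raw \<infinity>)" using A(1) by auto
      show "(\<lambda>y. emeasure (law Z y) (\<Union>i. A i)) \<in> borel_measurable borel_\<Delta>"
        unfolding law_UN using A(2) by measurable
      fix x t \<Lambda> assume \<Lambda>: "\<Lambda> \<in> sets (aug t)" and \<Lambda>P[measurable]: "\<Lambda> \<in> sets (\<P> x)"
      note [measurable] = X_\<P> A(2)
      have "{w\<in>\<Lambda>. \<theta> t w \<in> (\<Union>i. A i)} = (\<Union>i. {w\<in>\<Lambda>. \<theta> t w \<in> A i})" by auto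
      then have "emeasure (\<P> x) {w\<in>\<Lambda>. \<theta> t w \<in> (\<Union>i. A i)} = (\<Sum>i. emeasure (\<P> x) {w\<in>\<Lambda>. \<theta> t w \<in> A i})"
        using union(1) by (subst suminf_emeasure)
          (auto intro!: shift_Collect \<Lambda>P A(1) simp: disjoint_family_on_def)
      also have "\<dots> = (\<Sum>i. \<integral>\<^sup>+w\<in>\<Lambda>. emeasure (law Z (X t w)) (A i) \<partial>\<P> x)"
        by (simp add: A(3)[OF \<Lambda> \<Lambda>P])
      also have "\<dots> = (\<integral>\<^sup>+w. (\<Sum>i. emeasure (law Z (X t w)) (A i) * indicator \<Lambda> w) \<partial>\<P> x)"
        by (intro nn_integral_suminf[symmetric]) auto
      also have "\<dots> = (\<integral>\<^sup>+w\<in>\<Lambda>. emeasure (law Z (X t w)) (\<Union>i. A i) \<partial>\<P> x)"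
        by (simp add: law_UN)
      finally show "emeasure (\<P> x) {w\<in>\<Lambda>. \<theta> t w \<in> (\<Union>i. A i)} =
        (\<integral>\<^sup>+w\<in>\<Lambda>. emeasure (law Z (X t w)) (\<Union>i. A i) \<partial>\<P> x)" .
    qed
  qed
qed

section \<open>From the raw to the augmented filtration\<close>

text \<open>The law restricted to the raw \<sigma>-algebra at time infinity, on which its
  measurability in the starting point has just been established.\<close>

definition "law_kernel y = distr (law Z y) (raw \<infinity>) (\<lambda>w. w)"

lemma ident_law_raw: "(\<lambda>w. w) \<in> law Z y \<rightarrow>\<^sub>M raw \<infinity>"
proof (rule measurableI)
  fix A assume A: "A \<in> sets (raw \<infinity>)"
  have "(\<lambda>w. w) -` A \<inter> space (law Z y) = A" using sets.sets_into_space[OF A] by auto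
  then show "(\<lambda>w. w) -` A \<inter> space (law Z y) \<in> sets (law Z y)" using raw_law[OF A] by simp
qed simp

lemma emeasure_law_kernel: "A \<in> sets (raw \<infinity>) \<Longrightarrow> emeasure (law_kernel y) A = emeasure (law Z y) A"
  using sets.sets_into_space[of A "raw \<infinity>"]
  unfolding law_kernel_def by (subst emeasure_distr[OF ident_law_raw]) (auto simp: Int_absorb2)

lemma law_kernel_measurable: "law_kernel \<in> borel_\<Delta> \<rightarrow>\<^sub>M subprob_algebra (raw \<infinity>)"
proof (rule measurable_subprob_algebra)
  fix y
  interpret prob_space "law Z y" by (rule prob_law)
  show "subprob_space (law_kernel y)"
    unfolding law_kernel_def by (intro prob_space_imp_subprob_space prob_space_distr ident_law_raw)
  show "sets (law_kernel y) = sets (raw \<infinity>)" by (simp add: law_kernel_def)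
next
  fix A assume "A \<in> sets (raw \<infinity>)"
  then show "(\<lambda>y. emeasure (law_kernel y) A) \<in> borel_measurable borel_\<Delta>"
    using Markov_eventD(2)[OF Markov_event_raw] by (simp add: emeasure_law_kernel)
qed

lemma law_kernel_measurable': "sets \<pi> = sets borel_\<Delta> \<Longrightarrow> law_kernel \<in> \<pi> \<rightarrow>\<^sub>M subprob_algebra (raw \<infinity>)"
  using law_kernel_measurable by (simp cong: measurable_cong_sets)

lemma nn_integral_law_kernel:
  "C \<in> borel_measurable (raw \<infinity>) \<Longrightarrow> integral\<^sup>N (law_kernel y) C = integral\<^sup>N (law Z y) C"
  unfolding law_kernel_def by (rule nn_integral_distr[OF ident_law_raw]) simp

text \<open>\<open>measure_of\<close> assigns 0 everywhere unless its set function is a measure.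
  Recognising the set function as that of a mixture of kernels excludes this degenerate
  case.\<close>

lemma init_law_bind:
  assumes "initial_distribution \<pi>"
  shows "init_law Z \<pi> = bind \<pi> law_kernel"
proof -
  have \<pi>: "sets \<pi> = sets borel_\<Delta>" "prob_space \<pi>" using assms by (auto simp: initial_distribution_def)
  then have sp: "space \<pi> = UNIV" using sets_eq_imp_space_eq by fastforce
  have k: "law_kernel \<in> \<pi> \<rightarrow>\<^sub>M subprob_algebra (raw \<infinity>)" by (rule law_kernel_measurable'[OF \<pi>(1)])
  have sets_b: "sets (bind \<pi> law_kernel) = sets (raw \<infinity>)"
    by (rule sets_bind[OF sets_kernel[OF k]]) (use sp in auto)
  have space_b: "space (bind \<pi> law_kernel) = \<Omega>" using sets_eq_imp_space_eq[OF sets_b] by simp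
  have "init_law Z \<pi> = measure_of \<Omega> (sets (raw \<infinity>)) (emeasure (bind \<pi> law_kernel))"
    unfolding init_law_def
  proof (rule measure_of_eq)
    show "sets (raw \<infinity>) \<subseteq> Pow \<Omega>" using sets.space_closed[of "raw \<infinity>"] by simp
    fix A assume "A \<in> sigma_sets \<Omega> (sets (raw \<infinity>))"
    then have A: "A \<in> sets (raw \<infinity>)" using sets.sigma_sets_eq[of "raw \<infinity>"] by simp
    show "(\<integral>\<^sup>+x. emeasure (law Z x) A \<partial>\<pi>) = emeasure (bind \<pi> law_kernel) A"
      by (subst emeasure_bind[OF _ k A]) (use sp in \<open>auto simp: emeasure_law_kernel[OF A]\<close>)
  qed
  also have "\<dots> = bind \<pi> law_kernel"
    using measure_of_of_measure[of "bind \<pi> law_kernel"] by (simp add: sets_b space_b)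
  finally show ?thesis .
qed

lemma
  assumes "initial_distribution \<pi>"
  shows sets_init_law: "sets (init_law Z \<pi>) = sets (raw \<infinity>)"
    and emeasure_init_law: "A \<in> sets (raw \<infinity>) \<Longrightarrow> emeasure (init_law Z \<pi>) A = (\<integral>\<^sup>+x. emeasure (law Z x) A \<partial>\<pi>)"
proof -
  have \<pi>: "sets \<pi> = sets borel_\<Delta>" "prob_space \<pi>" using assms by (auto simp: initial_distribution_def)
  then have sp: "space \<pi> = UNIV" using sets_eq_imp_space_eq by fastforce
  have k: "law_kernel \<in> \<pi> \<rightarrow>\<^sub>M subprob_algebra (raw \<infinity>)" by (rule law_kernel_measurable'[OF \<pi>(1)])
  show "sets (init_law Z \<pi>) = sets (raw \<infinity>)"
    unfolding init_law_bind[OF assms] by (rule sets_bind[OF sets_kernel[OF k]]) (use sp in auto)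
  assume A: "A \<in> sets (raw \<infinity>)"
  show "emeasure (init_law Z \<pi>) A = (\<integral>\<^sup>+x. emeasure (law Z x) A \<partial>\<pi>)"
    unfolding init_law_bind[OF assms]
    by (subst emeasure_bind[OF _ k A]) (use sp in \<open>auto simp: emeasure_law_kernel[OF A]\<close>)
qed

text \<open>A differs from the raw event B only inside N, so it is B - N together with a part of N.
  A single initial distribution is enough, provided that its null sets are null for M.\<close>

lemma augm_in_completion:
  assumes A: "A \<in> augm t" and \<pi>: "initial_distribution \<pi>"
    and M: "sets (raw \<infinity>) \<subseteq> sets M"
    and null: "\<And>N. N \<in> sets (raw \<infinity>) \<Longrightarrow> emeasure (init_law Z \<pi>) N = 0 \<Longrightarrow> emeasure M N = 0"
  shows "A \<in> sets (completion M)"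
proof -
  obtain B N where B: "B \<in> sets (raw t)" and N: "N \<in> null_sets (init_law Z \<pi>)"
    and AB: "(A - B) \<union> (B - A) \<subseteq> N"
    using A \<pi> unfolding augm_def by blast
  have "N \<in> sets (raw \<infinity>)" "emeasure (init_law Z \<pi>) N = 0"
    using N sets_init_law[OF \<pi>] by (auto simp: null_sets_def)
  then have N': "N \<in> sets M" "N \<in> null_sets M" using M null by (auto simp: null_sets_def)
  have "B \<in> sets M" using B raw_mono[of t \<infinity>] M by auto
  then show ?thesis
    by (intro sets_completionI[of A "B - N" "A \<inter> N" N]) (use AB N' in auto)
qed

lemma aug_in_completion:
  assumes \<pi>: "initial_distribution \<pi>" and M: "sets (raw \<infinity>) \<subseteq> sets M" "space M = \<Omega>"
    and null: "\<And>N. N \<in> sets (raw \<infinity>) \<Longrightarrow> emeasure (init_law Z \<pi>) N = 0 \<Longrightarrow> emeasure M N = 0"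
  shows "sets (aug t) \<subseteq> sets (completion M)"
proof -
  have "augm t \<subseteq> sets (completion M)"
    using augm_in_completion[OF _ \<pi> M(1) null] by (rule subsetI)
  then show ?thesis
    using sets.sigma_sets_subset[of "augm t" "completion M"] by (simp add: sets_aug M(2))
qed

text \<open>Apply this to the unit mass at x, whose initial law agrees with the law at x on raw
  events. This discharges the provisional measurability condition on \<Lambda> in
  \<open>Markov_event\<close>.\<close>

lemma aug_\<P>: "sets (aug t) \<subseteq> sets (\<P> x)"
  unfolding \<P>_def
proof (rule aug_in_completion)
  show \<pi>: "initial_distribution (return borel_\<Delta> x)"
    by (simp add: initial_distribution_def prob_space_return)
  show "sets (raw \<infinity>) \<subseteq> sets (law Z x)" using raw_law by (rule subsetI)
  fix N assume N: "N \<in> sets (raw \<infinity>)" and 0: "emeasure (init_law Z (return borel_\<Delta> x)) N = 0"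
  have "(\<integral>\<^sup>+y. emeasure (law Z y) N \<partial>return borel_\<Delta> x) = emeasure (law Z x) N"
    by (rule nn_integral_return) (use Markov_eventD(2)[OF Markov_event_raw[OF N]] in auto)
  then show "emeasure (law Z x) N = 0" using 0 by (simp add: emeasure_init_law[OF \<pi> N])
qed simp

lemma subalgebra_\<P>: "subalgebra (\<P> x) (aug t)"
  using aug_\<P> by (simp add: subalgebra_def)

lemma measurable_aug_\<P>: "f \<in> aug t \<rightarrow>\<^sub>M N \<Longrightarrow> f \<in> \<P> x \<rightarrow>\<^sub>M N"
  by (rule measurable_from_subalg[OF subalgebra_\<P>])

lemma Markov_weight:
  fixes V :: "'w \<Rightarrow> ennreal"
  assumes Z: "V \<in> borel_measurable (aug t)" and A: "A \<in> sets (raw \<infinity>)"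
  shows "(\<integral>\<^sup>+w. V w * indicator A (\<theta> t w) \<partial>\<P> x) = (\<integral>\<^sup>+w. V w * emeasure (law Z (X t w)) A \<partial>\<P> x)"
proof -
  have [measurable]: "(\<lambda>w. emeasure (law Z (X t w)) A) \<in> borel_measurable (\<P> x)"
    by (rule measurable_compose[OF X_\<P> Markov_eventD(2)[OF Markov_event_raw[OF A]]])
  have [measurable]: "(\<lambda>w. indicator A (\<theta> t w) :: ennreal) \<in> borel_measurable (\<P> x)"
    by (rule measurable_compose[OF shift_\<P>]) (use A in measurable)
  from Z show ?thesis
  proof induction
    case (cong f g)
    have "(\<integral>\<^sup>+w. f w * h w \<partial>\<P> x) = (\<integral>\<^sup>+w. g w * h w \<partial>\<P> x)" for h
      by (intro nn_integral_cong) (use cong(3) in simp)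
    then show ?case using cong.IH by simp
  next
    case (set \<Lambda>)
    have \<Lambda>P: "\<Lambda> \<in> sets (\<P> x)" using set aug_\<P> by blast
    have "(\<integral>\<^sup>+w. indicator \<Lambda> w * indicator A (\<theta> t w) \<partial>\<P> x) = (\<integral>\<^sup>+w. indicator {w\<in>\<Lambda>. \<theta> t w \<in> A} w \<partial>\<P> x)"
      by (intro nn_integral_cong) (auto split: split_indicator)
    also have "\<dots> = (\<integral>\<^sup>+w\<in>\<Lambda>. emeasure (law Z (X t w)) A \<partial>\<P> x)"
      using shift_Collect[OF \<Lambda>P A] Markov_eventD(3)[OF Markov_event_raw[OF A] set \<Lambda>P] by simp
    finally show ?case by (simp add: mult.commute)
  next
    case (mult u c)
    note [measurable] = measurable_aug_\<P>[OF mult(2)]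
    show ?case using mult.IH by (simp add: nn_integral_cmult mult.assoc)
  next
    case (add u v)
    note [measurable] = measurable_aug_\<P>[OF add(1)] measurable_aug_\<P>[OF add(3)]
    show ?case using add.IH by (simp add: nn_integral_add distrib_right)
  next
    case (seq U)
    note [measurable] = measurable_aug_\<P>[OF seq(1)]
    have incU: "U i y \<le> U j y" if "i \<le> j" for i j y
      using seq(3) that by (auto simp: incseq_def le_fun_def)
    have "(\<integral>\<^sup>+w. (SUP i. U i) w * g w \<partial>\<P> x) = (SUP i. \<integral>\<^sup>+w. U i w * g w \<partial>\<P> x)"
      if [measurable]: "g \<in> borel_measurable (\<P> x)" for g
    proof -
      have "(\<integral>\<^sup>+w. (SUP i. U i) w * g w \<partial>\<P> x) = (\<integral>\<^sup>+w. (SUP i. U i w * g w) \<partial>\<P> x)"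
        by (simp add: SUP_mult_right_ennreal image_comp)
      also have "\<dots> = (SUP i. \<integral>\<^sup>+w. U i w * g w \<partial>\<P> x)"
        by (rule nn_integral_monotone_convergence_SUP)
          (auto simp: incseq_def le_fun_def incU intro!: mult_right_mono)
      finally show ?thesis .
    qed
    then show ?case by (simp add: seq.IH)
  qed
qed

text \<open>With V absorbed into a density, the claim says that the image under the shift is the
  mixture of the laws over the distribution of X at time t. This is checked on sets by
  \<open>Markov_weight\<close> and then integrated.\<close>

lemma Markov_weight_raw:
  assumes V: "V \<in> borel_measurable (aug t)" and C: "C \<in> borel_measurable (raw \<infinity>)"
  shows "(\<integral>\<^sup>+w. V w * C (\<theta> t w) \<partial>\<P> x) = (\<integral>\<^sup>+w. V w * integral\<^sup>N (law Z (X t w)) C \<partial>\<P> x)"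
proof -
  note [measurable] = measurable_aug_\<P>[OF V, of x]
  let ?M = "density (\<P> x) V"
  have \<theta>M: "\<theta> t \<in> ?M \<rightarrow>\<^sub>M raw \<infinity>" and XM: "X t \<in> ?M \<rightarrow>\<^sub>M borel_\<Delta>"
    using shift_\<P> X_\<P> by simp_all
  have k: "law_kernel \<in> distr ?M borel_\<Delta> (X t) \<rightarrow>\<^sub>M subprob_algebra (raw \<infinity>)"
    by (rule law_kernel_measurable') simp
  have sets_b: "sets (bind (distr ?M borel_\<Delta> (X t)) law_kernel) = sets (raw \<infinity>)"
    by (rule sets_bind[OF sets_kernel[OF k]]) auto
  have "distr ?M (raw \<infinity>) (\<theta> t) = bind (distr ?M borel_\<Delta> (X t)) law_kernel"
  proof (rule measure_eqI)
    fix A assume "A \<in> sets (distr ?M (raw \<infinity>) (\<theta> t))"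
    then have A: "A \<in> sets (raw \<infinity>)" by simp
    note mA = Markov_eventD(2)[OF Markov_event_raw[OF A]]
    have [measurable]: "(\<lambda>w. emeasure (law Z (X t w)) A) \<in> borel_measurable (\<P> x)"
      by (rule measurable_compose[OF X_\<P> mA])
    have "\<theta> t -` A \<inter> \<Omega> \<in> sets (\<P> x)"
      using measurable_sets[OF shift_\<P> A] by simp
    then have "emeasure (distr ?M (raw \<infinity>) (\<theta> t)) A = (\<integral>\<^sup>+w. V w * indicator (\<theta> t -` A \<inter> \<Omega>) w \<partial>\<P> x)"
      unfolding emeasure_distr[OF \<theta>M A] by (simp add: emeasure_density)
    also have "\<dots> = (\<integral>\<^sup>+w. V w * indicator A (\<theta> t w) \<partial>\<P> x)"
      by (intro nn_integral_cong) (auto split: split_indicator)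
    also have "\<dots> = (\<integral>\<^sup>+w. V w * emeasure (law Z (X t w)) A \<partial>\<P> x)"
      by (rule Markov_weight[OF V A])
    also have "\<dots> = (\<integral>\<^sup>+w. emeasure (law Z (X t w)) A \<partial>?M)"
      by (simp add: nn_integral_density)
    also have "\<dots> = (\<integral>\<^sup>+y. emeasure (law Z y) A \<partial>distr ?M borel_\<Delta> (X t))"
      by (rule nn_integral_distr[OF XM, symmetric]) (use mA in simp)
    also have "\<dots> = emeasure (bind (distr ?M borel_\<Delta> (X t)) law_kernel) A"
      by (subst emeasure_bind[OF _ k A]) (auto simp: emeasure_law_kernel[OF A])
    finally show "emeasure (distr ?M (raw \<infinity>) (\<theta> t)) A = emeasure (bind (distr ?M borel_\<Delta> (X t)) law_kernel) A" .
  qed (simp add: sets_b)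
  note eq = this
  have Cmeas: "(\<lambda>y. integral\<^sup>N (law Z y) C) \<in> borel_measurable borel_\<Delta>"
    using measurable_compose[OF law_kernel_measurable nn_integral_measurable_subprob_algebra[OF C]]
    by (simp add: nn_integral_law_kernel[OF C])
  have [measurable]: "(\<lambda>w. integral\<^sup>N (law Z (X t w)) C) \<in> borel_measurable (\<P> x)"
    by (rule measurable_compose[OF X_\<P> Cmeas])
  have [measurable]: "(\<lambda>w. C (\<theta> t w)) \<in> borel_measurable (\<P> x)"
    by (rule measurable_compose[OF shift_\<P> C])
  have "(\<integral>\<^sup>+w. V w * C (\<theta> t w) \<partial>\<P> x) = (\<integral>\<^sup>+w. C (\<theta> t w) \<partial>?M)"
    by (simp add: nn_integral_density)
  also have "\<dots> = integral\<^sup>N (distr ?M (raw \<infinity>) (\<theta> t)) C"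
    by (rule nn_integral_distr[OF \<theta>M, symmetric]) (use C in simp)
  also have "\<dots> = (\<integral>\<^sup>+y. integral\<^sup>N (law_kernel y) C \<partial>distr ?M borel_\<Delta> (X t))"
    unfolding eq by (rule nn_integral_bind[OF C k])
  also have "\<dots> = (\<integral>\<^sup>+y. integral\<^sup>N (law Z y) C \<partial>distr ?M borel_\<Delta> (X t))"
    by (simp add: nn_integral_law_kernel[OF C])
  also have "\<dots> = (\<integral>\<^sup>+w. integral\<^sup>N (law Z (X t w)) C \<partial>?M)"
    by (rule nn_integral_distr[OF XM]) (use Cmeas in simp)
  also have "\<dots> = (\<integral>\<^sup>+w. V w * integral\<^sup>N (law Z (X t w)) C \<partial>\<P> x)"
    by (simp add: nn_integral_density)
  finally show ?thesis .
qed

text \<open>For C measurable only with respect to the augmentation, E_y[C] is replaced by a Borel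
  function g that agrees with it at y = X_t almost surely. The version g depends on x and t.\<close>

lemma Markov_functional:
  fixes C :: "'w \<Rightarrow> ennreal"
  assumes C: "C \<in> borel_measurable (aug \<infinity>)"
  obtains g where "g \<in> borel_measurable borel_\<Delta>"
    "AE w in \<P> x. g (X t w) = integral\<^sup>N (law Z (X t w)) C"
    "(\<lambda>w. C (\<theta> t w)) \<in> borel_measurable (\<P> x)"
    "\<And>V. V \<in> borel_measurable (aug t) \<Longrightarrow>
      (\<integral>\<^sup>+w. V w * C (\<theta> t w) \<partial>\<P> x) = (\<integral>\<^sup>+w. V w * g (X t w) \<partial>\<P> x)"
proof -
  \<comment> \<open>The distribution of X at time t is the right initial law: a null set N of the
    mixture satisfies E_x[P_(X_t)(N)] = 0. Hence N is null for almost every law started at X_t, and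
    its preimage under the shift is null as well, so C may be replaced by a raw C' both inside the
    inner expectation and along the shift.\<close>
  let ?\<pi> = "distr (\<P> x) borel_\<Delta> (X t)"
  have \<pi>: "initial_distribution ?\<pi>"
    using prob_space.prob_space_distr[OF prob_\<P> X_\<P>] by (simp add: initial_distribution_def)
  let ?I = "init_law Z ?\<pi>"
  have sets_I: "sets ?I = sets (raw \<infinity>)" by (rule sets_init_law[OF \<pi>])
  have space_I: "space ?I = \<Omega>" using sets_eq_imp_space_eq[OF sets_I] by simp
  have "sets (aug \<infinity>) \<subseteq> sets (completion ?I)"
    by (rule aug_in_completion[OF \<pi>]) (simp_all add: sets_I space_I)
  then have "subalgebra (completion ?I) (aug \<infinity>)"
    by (simp add: subalgebra_def space_I)
  from measurable_from_subalg[OF this C]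
  obtain C' where C': "C' \<in> borel_measurable ?I" "AE w in ?I. C w = C' w"
    using completion_ex_borel_measurable by blast
  have C'r: "C' \<in> borel_measurable (raw \<infinity>)"
    using C'(1) by (simp cong: measurable_cong_sets add: sets_I)
  obtain N where N: "{w\<in>\<Omega>. C w \<noteq> C' w} \<subseteq> N" "N \<in> sets (raw \<infinity>)" "emeasure ?I N = 0"
    using AE_E[OF C'(2)] space_I sets_I by metis
  note mN = Markov_eventD[OF Markov_event_raw[OF N(2)]]
  have [measurable]: "(\<lambda>w. emeasure (law Z (X t w)) N) \<in> borel_measurable (\<P> x)"
    by (rule measurable_compose[OF X_\<P> mN(2)])
  have "(\<integral>\<^sup>+w. emeasure (law Z (X t w)) N \<partial>\<P> x) = emeasure ?I N"
    unfolding emeasure_init_law[OF \<pi> N(2)]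
    by (rule nn_integral_distr[OF X_\<P>, symmetric]) (use mN(2) in simp)
  then have int0: "(\<integral>\<^sup>+w. emeasure (law Z (X t w)) N \<partial>\<P> x) = 0" using N(3) by simp
  then have AE0: "AE w in \<P> x. emeasure (law Z (X t w)) N = 0"
    by (simp add: nn_integral_0_iff_AE)
  have "emeasure (\<P> x) {w\<in>\<Omega>. \<theta> t w \<in> N} = (\<integral>\<^sup>+w\<in>\<Omega>. emeasure (law Z (X t w)) N \<partial>\<P> x)"
    by (rule mN(3)[OF space_in_aug space_in_\<P>])
  also have "\<dots> = (\<integral>\<^sup>+w. emeasure (law Z (X t w)) N \<partial>\<P> x)"
    by (intro nn_integral_cong) simp
  finally have "{w\<in>\<Omega>. \<theta> t w \<in> N} \<in> null_sets (\<P> x)"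
    using int0 shift_Collect[OF space_in_\<P> N(2)] by (simp add: null_sets_def)
  then have AE\<theta>: "AE w in \<P> x. C (\<theta> t w) = C' (\<theta> t w)"
    by (rule AE_I') (use N(1) shift_space in auto)
  have AEg: "AE w in \<P> x. integral\<^sup>N (law Z (X t w)) C' = integral\<^sup>N (law Z (X t w)) C"
    using AE0
  proof eventually_elim
    case (elim w)
    have "N \<in> null_sets (law Z (X t w))" using elim raw_law[OF N(2)] by (simp add: null_sets_def)
    then have "AE w' in law Z (X t w). C w' = C' w'"
      by (rule AE_I') (use N(1) in simp)
    then show ?case by (intro nn_integral_cong_AE) auto
  qed
  have C'\<theta>: "(\<lambda>w. C' (\<theta> t w)) \<in> borel_measurable (\<P> x)"
    by (rule measurable_compose[OF shift_\<P> C'r])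
  have AE\<theta>': "AE w in law Z x. C' (\<theta> t w) = C (\<theta> t w)"
    using AE\<theta> unfolding AE_\<P> by eventually_elim simp
  show ?thesis
  proof (rule that)
    show "(\<lambda>y. integral\<^sup>N (law Z y) C') \<in> borel_measurable borel_\<Delta>"
      using measurable_compose[OF law_kernel_measurable nn_integral_measurable_subprob_algebra[OF C'r]]
      by (simp add: nn_integral_law_kernel[OF C'r])
    show "AE w in \<P> x. integral\<^sup>N (law Z (X t w)) C' = integral\<^sup>N (law Z (X t w)) C" by (rule AEg)
    show "(\<lambda>w. C (\<theta> t w)) \<in> borel_measurable (\<P> x)"
      using measurable_completion_AE[OF C'\<theta>[unfolded \<P>_def] AE\<theta>'] by (simp add: \<P>_def)
    fix V :: "'w \<Rightarrow> ennreal" assume V: "V \<in> borel_measurable (aug t)"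
    have "(\<integral>\<^sup>+w. V w * C (\<theta> t w) \<partial>\<P> x) = (\<integral>\<^sup>+w. V w * C' (\<theta> t w) \<partial>\<P> x)"
      by (rule nn_integral_cong_AE) (use AE\<theta> in auto)
    also have "\<dots> = (\<integral>\<^sup>+w. V w * integral\<^sup>N (law Z (X t w)) C' \<partial>\<P> x)"
      by (rule Markov_weight_raw[OF V C'r])
    finally show "(\<integral>\<^sup>+w. V w * C (\<theta> t w) \<partial>\<P> x) = (\<integral>\<^sup>+w. V w * integral\<^sup>N (law Z (X t w)) C' \<partial>\<P> x)" .
  qed
qed

end

section \<open>Functionals with bounded potential\<close>

lemma (in std_proc) measurable_shift:
  fixes C :: "'w \<Rightarrow> ennreal"
  assumes "C \<in> borel_measurable (aug \<infinity>)"
  shows "(\<lambda>w. C (\<theta> t w)) \<in> borel_measurable (\<P> x)"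
  using Markov_functional[OF assms, where x=x and t=t] by blast

text \<open>The Revuz correspondence gives no information about the law started at \<Delta>. As C
  vanishes along the shift of a dead path, the version may be set to 0 there, and only starting
  points in S remain.\<close>

lemma (in std_proc) Markov_potential:
  fixes C :: "'w \<Rightarrow> ennreal"
  assumes C: "C \<in> borel_measurable (aug \<infinity>)"
    and dead: "AE w in \<P> x. X t w = None \<longrightarrow> C (\<theta> t w) = 0"
  obtains Y where "Y \<in> borel_measurable (aug t)"
    "AE w in \<P> x. Y w = (case X t w of None \<Rightarrow> 0 | Some y \<Rightarrow> integral\<^sup>N (law Z (Some y)) C)"
    "(\<lambda>w. C (\<theta> t w)) \<in> borel_measurable (\<P> x)"
    "\<And>V. V \<in> borel_measurable (aug t) \<Longrightarrow>
      (\<integral>\<^sup>+w. V w * C (\<theta> t w) \<partial>\<P> x) = (\<integral>\<^sup>+w. V w * Y w \<partial>\<P> x)"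
proof -
  obtain g where g: "g \<in> borel_measurable borel_\<Delta>"
    "AE w in \<P> x. g (X t w) = integral\<^sup>N (law Z (X t w)) C"
    "(\<lambda>w. C (\<theta> t w)) \<in> borel_measurable (\<P> x)"
    "\<And>V. V \<in> borel_measurable (aug t) \<Longrightarrow>
      (\<integral>\<^sup>+w. V w * C (\<theta> t w) \<partial>\<P> x) = (\<integral>\<^sup>+w. V w * g (X t w) \<partial>\<P> x)"
    using Markov_functional[OF C, where x=x and t=t] by blast
  have ind: "(\<lambda>z :: 's option. indicator (- {None}) z :: ennreal) \<in> borel_measurable borel_\<Delta>"
    by (rule borel_measurable_indicator) (use sets.compl_sets[OF singleton_borel_\<Delta>[of None]] in \<open>simp add: Compl_eq_Diff_UNIV\<close>)
  have I: "(\<lambda>w. indicator (- {None}) (X t w) :: ennreal) \<in> borel_measurable (aug t)"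
    by (rule measurable_compose[OF X_aug[OF order_refl] ind])
  have G: "(\<lambda>w. g (X t w)) \<in> borel_measurable (aug t)"
    by (rule measurable_compose[OF X_aug[OF order_refl] g(1)])
  show ?thesis
  proof (rule that)
    show "(\<lambda>w. indicator (- {None}) (X t w) * g (X t w)) \<in> borel_measurable (aug t)"
      using I G by (rule borel_measurable_times_ennreal)
    show "AE w in \<P> x. indicator (- {None}) (X t w) * g (X t w) =
        (case X t w of None \<Rightarrow> 0 | Some y \<Rightarrow> integral\<^sup>N (law Z (Some y)) C)"
      using g(2) by eventually_elim (auto split: option.split)
    show "(\<lambda>w. C (\<theta> t w)) \<in> borel_measurable (\<P> x)" by (rule g(3))
    fix V :: "'w \<Rightarrow> ennreal" assume V: "V \<in> borel_measurable (aug t)"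
    have "(\<integral>\<^sup>+w. V w * C (\<theta> t w) \<partial>\<P> x) = (\<integral>\<^sup>+w. (V w * indicator (- {None}) (X t w)) * C (\<theta> t w) \<partial>\<P> x)"
      by (rule nn_integral_cong_AE) (use dead in \<open>eventually_elim, auto split: split_indicator\<close>)
    also have "\<dots> = (\<integral>\<^sup>+w. (V w * indicator (- {None}) (X t w)) * g (X t w) \<partial>\<P> x)"
      by (rule g(4)) (rule borel_measurable_times_ennreal[OF V I])
    finally show "(\<integral>\<^sup>+w. V w * C (\<theta> t w) \<partial>\<P> x) = (\<integral>\<^sup>+w. V w * (indicator (- {None}) (X t w) * g (X t w)) \<partial>\<P> x)"
      by (simp add: mult.assoc)
  qed
qed

lemma (in std_proc) Markov_le:
  fixes C V :: "'w \<Rightarrow> ennreal"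
  assumes C: "C \<in> borel_measurable (aug \<infinity>)" and V: "V \<in> borel_measurable (aug t)"
    and dead: "AE w in \<P> x. X t w = None \<longrightarrow> C (\<theta> t w) = 0"
    and le: "\<And>y. integral\<^sup>N (law Z (Some y)) C \<le> c"
  shows "(\<integral>\<^sup>+w. V w * C (\<theta> t w) \<partial>\<P> x) \<le> c * (\<integral>\<^sup>+w. V w \<partial>\<P> x)"
proof -
  obtain Y where Y: "AE w in \<P> x. Y w = (case X t w of None \<Rightarrow> 0 | Some y \<Rightarrow> integral\<^sup>N (law Z (Some y)) C)"
    "\<And>V. V \<in> borel_measurable (aug t) \<Longrightarrow>
      (\<integral>\<^sup>+w. V w * C (\<theta> t w) \<partial>\<P> x) = (\<integral>\<^sup>+w. V w * Y w \<partial>\<P> x)"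
    by (rule Markov_potential[OF C dead]) blast
  have "(\<integral>\<^sup>+w. V w * Y w \<partial>\<P> x) \<le> (\<integral>\<^sup>+w. c * V w \<partial>\<P> x)"
  proof (rule nn_integral_mono_AE)
    show "AE w in \<P> x. V w * Y w \<le> c * V w"
      using Y(1)
    proof eventually_elim
      case (elim w)
      have "Y w \<le> c" unfolding elim using le by (simp split: option.split)
      then show ?case by (simp add: mult.commute[of c] mult_left_mono)
    qed
  qed
  also have "\<dots> = c * (\<integral>\<^sup>+w. V w \<partial>\<P> x)"
    by (rule nn_integral_cmult[OF measurable_aug_\<P>[OF V]])
  finally show ?thesis unfolding Y(2)[OF V] .
qed

locale revuz_functional = std_proc Z for Z :: "('w, 's::t2_space) process" +
  fixes p :: "real \<Rightarrow> 's \<Rightarrow> 's \<Rightarrow> ennreal" and A :: "real \<Rightarrow> 'w \<Rightarrow> ennreal" and \<mu> :: "'s measure"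
  assumes PCAF: "PCAF Z A" and Revuz: "Revuz Z p A \<mu>" and bounded: "sup_norm (potential p 1 \<mu>) < \<infinity>"
begin

text \<open>What membership in a defining set says about a single path, without reference to the set
  itself.\<close>

definition "regular w \<longleftrightarrow> w \<in> \<Omega> \<and> increasing_path (lifetime Z w) (\<lambda>t. A t w) \<and>
  (\<forall>s\<ge>0. \<forall>t\<ge>0. A (t + s) w = A t w + A s (\<theta> (ennreal t) w))"

text \<open>Finiteness is required also at and after the lifetime. The definition of a PCAF does not
  provide this; the bounded 1-potential does, almost surely.\<close>

definition "finite_path w \<longleftrightarrow> regular w \<and> (\<forall>t\<ge>0. A t w < \<infinity>)"

text \<open>The integrand that \<open>Revuz\<close> produces for the constant function 1: one on S
  and zero at \<Delta>.\<close>

definition "alive w t = ext_\<Delta> (\<lambda>_. 1) (X (ennreal t) w)"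

lemma alive_le: "alive w t \<le> 1"
  by (simp add: alive_def ext_\<Delta>_def split: option.split)

lemma lifetime_le: "X t w = None \<Longrightarrow> lifetime Z w \<le> t"
  by (auto simp: lifetime_def intro: Inf_lower)

lemma alive_eq: "ennreal t < lifetime Z w \<Longrightarrow> alive w t = 1"
  using lifetime_le[of "ennreal t" w] by (cases "X (ennreal t) w") (auto simp: alive_def ext_\<Delta>_def)

definition "disc \<alpha> w = stieltjes_integral (\<lambda>t. ennreal (exp (- \<alpha> * t)) * alive w t) (\<lambda>t. A t w)"

lemma integral_disc: "0 < \<alpha> \<Longrightarrow> (\<integral>\<^sup>+w. disc \<alpha> w \<partial>\<P> (Some x)) = potential p \<alpha> \<mu> x"
  using Revuz[unfolded Revuz_def, rule_format, of \<alpha> "\<lambda>_. 1" x]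
  by (simp add: nn_integral_\<P> disc_def alive_def potential_def)

lemma potential_le: "potential p \<alpha> \<mu> x \<le> sup_norm (potential p \<alpha> \<mu>)"
  unfolding sup_norm_def by (rule SUP_upper) simp

lemma A_aug: "0 \<le> t \<Longrightarrow> A t \<in> borel_measurable (aug (ennreal t))"
  using PCAF by (simp add: PCAF_def)

lemma A_aug': "0 \<le> t \<Longrightarrow> ennreal t \<le> s \<Longrightarrow> A t \<in> borel_measurable (aug s)"
  by (rule measurable_aug_mono[OF A_aug])

lemma A_\<P>: "0 \<le> t \<Longrightarrow> A t \<in> borel_measurable (\<P> x)"
  by (rule measurable_aug_\<P>[OF A_aug])

lemma AE_regular: "AE w in \<P> (Some x). regular w"
proof -
  obtain \<Lambda> where \<Lambda>: "defining_set Z A \<Lambda>" using PCAF by (auto simp: PCAF_def)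
  have reg: "regular w" if w: "w \<in> \<Lambda>" for w
  proof -
    have \<Omega>: "w \<in> \<Omega>" using sets.sets_into_space[of \<Lambda> "aug \<infinity>"] \<Lambda> w by (auto simp: defining_set_def)
    have 0: "A 0 w = 0" and cont: "continuous_on {0..} (\<lambda>t. A t w)"
      and const: "\<And>t. 0 \<le> t \<Longrightarrow> lifetime Z w \<le> ennreal t \<Longrightarrow> A t w = A (enn2real (lifetime Z w)) w"
      and add: "\<And>s t. 0 \<le> s \<Longrightarrow> 0 \<le> t \<Longrightarrow> A (t + s) w = A t w + A s (\<theta> (ennreal t) w)"
      using \<Lambda> w by (auto simp: defining_set_def)
    have "mono_on {0..} (\<lambda>t. A t w)"
    proof (rule mono_onI)
      fix s t :: real assume "s \<in> {0..}" "t \<in> {0..}" "s \<le> t"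
      then show "A s w \<le> A t w" using add[of "t - s" s] by simp
    qed
    moreover have "A t w = A s w" if "0 \<le> s" "s \<le> t" "lifetime Z w \<le> ennreal s" for s t
      using const[of s] const[of t] that ennreal_leI[of s t] by (metis order_trans)
    ultimately show ?thesis
      using \<Omega> 0 cont add unfolding regular_def increasing_path_def by blast
  qed
  have "AE w in law Z (Some x). w \<in> \<Lambda>" using \<Lambda> by (auto simp: defining_set_def)
  then show ?thesis unfolding AE_\<P> by eventually_elim (rule reg)
qed

lemma regular_path: "regular w \<Longrightarrow> increasing_path (lifetime Z w) (\<lambda>t. A t w)"
  by (simp add: regular_def)

lemma AE_finite_path: "AE w in \<P> (Some x). finite_path w"
proof -
  have "AE w in \<P> (Some x). \<not> A (real n) w = \<infinity>" for n
  proof -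
    have [measurable]: "A (real n) \<in> borel_measurable (\<P> (Some x))" by (rule A_\<P>) simp
    let ?E = "{w\<in>space (\<P> (Some x)). A (real n) w = \<infinity>}"
    have E: "?E \<in> sets (\<P> (Some x))" by measurable
    \<comment> \<open>The functional \<open>disc\<close> is not known to be measurable, so
      finiteness of its integral does not directly yield almost sure finiteness. Instead it is
      bounded from below by infinity times the indicator of a measurable event, for which
      monotonicity of the integral suffices.\<close>
    have "\<infinity> * emeasure (\<P> (Some x)) ?E = (\<integral>\<^sup>+w. \<infinity> * indicator ?E w \<partial>\<P> (Some x))"
      by (rule nn_integral_cmult_indicator[OF E, symmetric])
    also have "\<dots> \<le> (\<integral>\<^sup>+w. disc 1 w \<partial>\<P> (Some x))"
    proof (rule nn_integral_mono_AE)
      show "AE w in \<P> (Some x). \<infinity> * indicator ?E w \<le> disc 1 w"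
        using AE_regular
      proof eventually_elim
        case (elim w)
        have "disc 1 w = \<infinity>" if "A (real n) w = \<infinity>"
        proof (rule ccontr)
          assume "disc 1 w \<noteq> \<infinity>"
          then have "disc 1 w < \<infinity>" by (simp add: top.not_eq_extremum)
          then have "A (real n) w < \<infinity>"
            unfolding disc_def
            by (intro path_finite[OF regular_path[OF elim], where \<alpha>=1 and g="alive w"])
              (auto simp: alive_eq)
          with that show False by simp
        qed
        then show ?case by (auto split: split_indicator)
      qed
    qed
    also have "\<dots> = potential p 1 \<mu> x" by (rule integral_disc) simp
    also have "\<dots> < \<infinity>" using potential_le bounded by (rule le_less_trans)
    finally have "emeasure (\<P> (Some x)) ?E = 0" by (auto simp: ennreal_top_mult split: if_splits)
    then show ?thesis
      by (subst AE_iff_measurable[OF E]) auto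
  qed
  then have "AE w in \<P> (Some x). \<forall>n. \<not> A (real n) w = \<infinity>" unfolding AE_all_countable by (rule allI)
  with AE_regular show ?thesis
  proof eventually_elim
    case elim: (elim w)
    have "A t w < \<infinity>" if "0 \<le> t" for t
    proof -
      obtain n where "t \<le> real n" using real_arch_simple by blast
      then have "A t w \<le> A (real n) w"
        using that by (intro path_mono[OF regular_path[OF elim(1)]])
      also have "A (real n) w < \<infinity>"
        using elim(2)[rule_format, of n] unfolding infinity_ennreal_def top.not_eq_extremum .
      finally show ?thesis .
    qed
    then show ?case using elim by (simp add: finite_path_def)
  qed
qed

lemma finite_pathD:
  assumes "finite_path w"
  shows "w \<in> \<Omega>" "increasing_path (lifetime Z w) (\<lambda>t. A t w)" "A 0 w = 0"
    "\<And>t. 0 \<le> t \<Longrightarrow> A t w < \<infinity>" "\<And>s t. 0 \<le> s \<Longrightarrow> s \<le> t \<Longrightarrow> A s w \<le> A t w"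
    "\<And>s t. 0 \<le> s \<Longrightarrow> 0 \<le> t \<Longrightarrow> A (t + s) w = A t w + A s (\<theta> (ennreal t) w)"
proof -
  show 1: "w \<in> \<Omega>" "increasing_path (lifetime Z w) (\<lambda>t. A t w)"
    "\<And>t. 0 \<le> t \<Longrightarrow> A t w < \<infinity>"
    "\<And>s t. 0 \<le> s \<Longrightarrow> 0 \<le> t \<Longrightarrow> A (t + s) w = A t w + A s (\<theta> (ennreal t) w)"
    using assms by (auto simp: finite_path_def regular_def)
  show "A 0 w = 0" using 1(2) by (simp add: increasing_path_def)
  show "\<And>s t. 0 \<le> s \<Longrightarrow> s \<le> t \<Longrightarrow> A s w \<le> A t w"
    by (rule path_mono[OF 1(2)])
qed

lemma A_shift:
  assumes "finite_path w" "0 \<le> s" "0 \<le> t"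
  shows "A s (\<theta> (ennreal t) w) = A (t + s) w - A t w"
  using finite_pathD(6)[OF assms] finite_pathD(4)[OF assms(1,3)] by simp

lemma A_shift_dead:
  assumes "finite_path w" "0 \<le> s" "0 \<le> t" "X (ennreal t) w = None"
  shows "A s (\<theta> (ennreal t) w) = 0"
proof -
  have "A (t + s) w = A t w"
    by (rule path_const[OF finite_pathD(2)[OF assms(1)]]) (use assms lifetime_le in auto)
  then show ?thesis using A_shift[OF assms(1-3)] finite_pathD(4)[OF assms(1,3)] by (simp add: ennreal_diff_self)
qed

lemma AE_dead:
  assumes "0 \<le> s" "0 \<le> t"
  shows "AE w in \<P> (Some x). X (ennreal t) w = None \<longrightarrow> A s (\<theta> (ennreal t) w) = 0"
  using AE_finite_path by eventually_elim (use A_shift_dead assms in blast)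

abbreviation "a \<equiv> sup_norm (potential p 1 \<mu>)"

text \<open>Up to time T the discount at rate 1 is at least exp(-T), so exp(-T) A_T is below the
  discounted integral, whose mean is the 1-potential.\<close>

lemma expectation_A:
  assumes "0 \<le> T"
  shows "(\<integral>\<^sup>+w. A T w \<partial>\<P> (Some x)) \<le> ennreal (exp T) * a"
proof -
  have "ennreal (exp (- T)) * (\<integral>\<^sup>+w. A T w \<partial>\<P> (Some x)) = (\<integral>\<^sup>+w. ennreal (exp (- T)) * A T w \<partial>\<P> (Some x))"
    by (rule nn_integral_cmult[symmetric, OF A_\<P>[OF assms]])
  also have "\<dots> \<le> (\<integral>\<^sup>+w. disc 1 w \<partial>\<P> (Some x))"
  proof (rule nn_integral_mono_AE)
    show "AE w in \<P> (Some x). ennreal (exp (- T)) * A T w \<le> disc 1 w"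
      using AE_finite_path
    proof eventually_elim
      case (elim w)
      show ?case
        using stieltjes_integral_ge[OF finite_pathD(2)[OF elim], of 1 T "alive w"] finite_pathD(4)[OF elim assms] assms
        by (simp add: disc_def alive_eq)
    qed
  qed
  also have "\<dots> \<le> a" using integral_disc[of 1 x] potential_le[of 1 x] by simp
  finally have "ennreal (exp T) * (ennreal (exp (- T)) * (\<integral>\<^sup>+w. A T w \<partial>\<P> (Some x))) \<le> ennreal (exp T) * a"
    by (rule mult_left_mono) simp
  then show ?thesis
    by (simp add: mult.assoc[symmetric] ennreal_mult'[symmetric] exp_add[symmetric])
qed

lemma A_increment:
  assumes "finite_path w" "0 \<le> \<eta>"
  shows "A (real (Suc i) * \<eta>) w - A (real i * \<eta>) w = A \<eta> (\<theta> (ennreal (real i * \<eta>)) w)"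
  using A_shift[OF assms(1,2), of "real i * \<eta>"] assms(2) by (simp add: algebra_simps)

text \<open>For \<alpha> < 1 this is not monotonicity in \<alpha>. Time is cut into unit intervals;
  by the Markov property each contributes at most exp(-\<alpha> i) times a uniform bound for E[A_1],
  and the geometric series converges.\<close>

lemma potential_finite:
  assumes "0 < \<alpha>"
  shows "sup_norm (potential p \<alpha> \<mu>) < \<infinity>"
proof -
  let ?c = "ennreal (exp 1) * a"
  have "potential p \<alpha> \<mu> x \<le> (\<Sum>i. ennreal (exp (- \<alpha> * real i)) * ?c)" for x
  proof -
    have "potential p \<alpha> \<mu> x = (\<integral>\<^sup>+w. disc \<alpha> w \<partial>\<P> (Some x))"
      by (rule integral_disc[OF assms, symmetric])
    also have "\<dots> \<le> (\<integral>\<^sup>+w. (\<Sum>i. ennreal (exp (- \<alpha> * real i)) * A 1 (\<theta> (ennreal (real i)) w)) \<partial>\<P> (Some x))"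
    proof (rule nn_integral_mono_AE)
      show "AE w in \<P> (Some x). disc \<alpha> w \<le> (\<Sum>i. ennreal (exp (- \<alpha> * real i)) * A 1 (\<theta> (ennreal (real i)) w))"
        using AE_finite_path
      proof eventually_elim
        case (elim w)
        show ?case
          using stieltjes_integral_upper[OF finite_pathD(2)[OF elim], of 1 \<alpha> "alive w"] assms
            A_increment[OF elim, of 1]
          by (simp add: disc_def alive_le del: of_nat_Suc)
      qed
    qed
    also have "\<dots> = (\<Sum>i. \<integral>\<^sup>+w. ennreal (exp (- \<alpha> * real i)) * A 1 (\<theta> (ennreal (real i)) w) \<partial>\<P> (Some x))"
    proof (rule nn_integral_suminf)
      fix i
      have "(\<lambda>w. A 1 (\<theta> (ennreal (real i)) w)) \<in> borel_measurable (\<P> (Some x))"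
        by (rule measurable_shift[OF A_aug']) auto
      then show "(\<lambda>w. ennreal (exp (- \<alpha> * real i)) * A 1 (\<theta> (ennreal (real i)) w)) \<in> borel_measurable (\<P> (Some x))"
        by measurable
    qed
    also have "\<dots> \<le> (\<Sum>i. ennreal (exp (- \<alpha> * real i)) * ?c)"
    proof (rule suminf_le)
      fix i
      have "(\<integral>\<^sup>+w. ennreal (exp (- \<alpha> * real i)) * A 1 (\<theta> (ennreal (real i)) w) \<partial>\<P> (Some x)) \<le>
          ?c * (\<integral>\<^sup>+w. ennreal (exp (- \<alpha> * real i)) \<partial>\<P> (Some x))"
        by (rule Markov_le[OF A_aug' _ AE_dead]) (use expectation_A[of 1] in \<open>auto simp: nn_integral_\<P>\<close>)
      also have "\<dots> = ennreal (exp (- \<alpha> * real i)) * ?c"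
        using prob_space.emeasure_space_1[OF prob_\<P>] by (simp add: mult.commute)
      finally show "(\<integral>\<^sup>+w. ennreal (exp (- \<alpha> * real i)) * A 1 (\<theta> (ennreal (real i)) w) \<partial>\<P> (Some x)) \<le>
          ennreal (exp (- \<alpha> * real i)) * ?c" .
    qed auto
    finally show ?thesis .
  qed
  then have "sup_norm (potential p \<alpha> \<mu>) \<le> (\<Sum>i. ennreal (exp (- \<alpha> * real i)) * ?c)"
    unfolding sup_norm_def by (rule SUP_least)
  also have "\<dots> = (\<Sum>i. ennreal (exp (- \<alpha> * real i))) * ?c" by simp
  also have "\<dots> < \<infinity>"
  proof -
    have "summable (\<lambda>i. exp (- \<alpha>) ^ i)" using assms by (intro summable_geometric) simp
    then have "(\<Sum>i. ennreal (exp (- \<alpha> * real i))) = ennreal (\<Sum>i. exp (- \<alpha>) ^ i)"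
      unfolding exp_of_nat2_mult by (intro suminf_ennreal2) auto
    then show ?thesis using bounded by (simp add: ennreal_mult_less_top)
  qed
  finally show ?thesis .
qed

abbreviation "Ar t w \<equiv> enn2real (A t w)"

lemma finite_path_real:
  assumes "finite_path w"
  shows "Ar 0 w = 0" "\<And>t. 0 \<le> t \<Longrightarrow> A t w = ennreal (Ar t w)"
    "\<And>s t. 0 \<le> s \<Longrightarrow> s \<le> t \<Longrightarrow> Ar s w \<le> Ar t w"
    "\<And>s t. 0 \<le> s \<Longrightarrow> s \<le> t \<Longrightarrow> A t w - A s w = ennreal (Ar t w - Ar s w)"
    "continuous_on {0..} (\<lambda>t. Ar t w)"
proof -
  note f = finite_pathD[OF assms]
  show "Ar 0 w = 0" by (simp add: f(3))
  show 1: "A t w = ennreal (Ar t w)" if "0 \<le> t" for t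
    using f(4)[OF that] by simp
  show "Ar s w \<le> Ar t w" if "0 \<le> s" "s \<le> t" for s t
    using f(5)[OF that] f(4)[of t] that by (intro enn2real_mono) auto
  show "A t w - A s w = ennreal (Ar t w - Ar s w)" if "0 \<le> s" "s \<le> t" for s t
    using 1[of s] 1[of t] that ennreal_minus[of "Ar s w" "Ar t w"] by simp
  have "continuous_on {0..} (\<lambda>t. A t w)" using f(2) by (simp add: increasing_path_def)
  then show "continuous_on {0..} (\<lambda>t. Ar t w)"
    unfolding continuous_on_def using f(4) by (intro ballI tendsto_enn2real) auto
qed

lemma Ar_aug: "0 \<le> t \<Longrightarrow> ennreal t \<le> s \<Longrightarrow> Ar t \<in> borel_measurable (aug s)"
  using measurable_compose[OF A_aug' borel_measurable_enn2real[OF measurable_ident]] by simp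

lemma Ar_\<P>: "0 \<le> t \<Longrightarrow> Ar t \<in> borel_measurable (\<P> x)"
  by (rule measurable_aug_\<P>[OF Ar_aug[OF _ order_refl]])

section \<open>Discrete quadratic variation and the second moment\<close>

definition "square_sum T n w = (\<Sum>i<2^n. (Ar (real (Suc i) * (T / 2^n)) w - Ar (real i * (T / 2^n)) w)\<^sup>2)"

lemma square_sum_tendsto:
  assumes "0 < T" "finite_path w"
  shows "(\<lambda>n. square_sum T n w) \<longlonglongrightarrow> 0"
  unfolding square_sum_def
  using finite_path_real[OF assms(2)] assms(1)
  by (intro dyadic_square_sum_tendsto_0) (auto intro: continuous_on_subset mono_onI)

lemma square_sum_le:
  assumes "0 < T" "finite_path w"
  shows "square_sum T n w \<le> (Ar T w)\<^sup>2"
proof -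
  let ?b = "\<lambda>i. Ar (real i * (T / 2^n)) w"
  have mono: "?b i \<le> ?b j" if "i \<le> j" for i j
    using that assms(1) by (intro finite_path_real(3)[OF assms(2)] mult_right_mono) auto
  have "(?b (2^n) - ?b 0)\<^sup>2 = square_sum T n w + 2 * (\<Sum>i<2^n. (?b (Suc i) - ?b i) * (?b (2^n) - ?b (Suc i)))"
    unfolding square_sum_def by (rule square_telescope)
  moreover have "0 \<le> (\<Sum>i<2^n. (?b (Suc i) - ?b i) * (?b (2^n) - ?b (Suc i)))"
    using mono by (intro sum_nonneg mult_nonneg_nonneg) (auto simp del: of_nat_Suc of_nat_power)
  moreover have "?b (2^n) = Ar T w" "?b 0 = 0" using finite_path_real(1)[OF assms(2)] by simp_all
  ultimately show ?thesis by simp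
qed

text \<open>Without its diagonal, A_T^2 is twice a sum of increments times what accumulates
  afterwards. By the Markov property the expected future is at most exp(T) a, and the increments
  themselves sum to A_T, with the same bound for the mean. The diagonal disappears in the
  limit.\<close>

lemma second_moment:
  assumes "0 < T"
  shows "(\<integral>\<^sup>+w. ennreal ((Ar T w)\<^sup>2) \<partial>\<P> (Some x)) \<le> 2 * (ennreal (exp T) * a)\<^sup>2"
proof -
  let ?P = "\<P> (Some x)" and ?c = "ennreal (exp T) * a"
  have [measurable]: "Ar t \<in> borel_measurable ?P" if "0 \<le> t" for t using that by (rule Ar_\<P>)
  have Tm[measurable]: "Ar T \<in> borel_measurable ?P" using assms by simp
  have qm[measurable]: "square_sum T n \<in> borel_measurable ?P" for n
    unfolding square_sum_def using assms by (intro borel_measurable_sum borel_measurable_power borel_measurable_diff Ar_\<P>) auto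
  have bound: "(\<integral>\<^sup>+w. ennreal ((Ar T w)\<^sup>2 - square_sum T n w) \<partial>?P) \<le> 2 * ?c\<^sup>2" for n
  proof -
    define t where "t i = real i * (T / 2^n)" for i
    have t0: "0 \<le> t i" "t i \<le> t (Suc i)" for i
      unfolding t_def using assms by (simp, intro mult_right_mono) auto
    have tT: "t (2^n) = T" by (simp add: t_def)
    have tle: "t i \<le> T" if "i \<le> 2^n" for i
      using that assms mult_right_mono[of "real i" "2^n" "T / 2^n"] by (simp add: t_def)
    let ?V = "\<lambda>i w. A (t (Suc i)) w - A (t i) w"
    have V: "?V i \<in> borel_measurable (aug (ennreal (t (Suc i))))" for i
      by (intro borel_measurable_minus_ennreal A_aug' t0 ennreal_leI order_refl)
    have C: "A T \<in> borel_measurable (aug \<infinity>)" using assms by (intro A_aug') auto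
    have "(\<integral>\<^sup>+w. ennreal ((Ar T w)\<^sup>2 - square_sum T n w) \<partial>?P)
        \<le> (\<integral>\<^sup>+w. 2 * (\<Sum>i<2^n. ?V i w * A T (\<theta> (ennreal (t (Suc i))) w)) \<partial>?P)"
    proof (rule nn_integral_mono_AE)
      show "AE w in ?P. ennreal ((Ar T w)\<^sup>2 - square_sum T n w)
          \<le> 2 * (\<Sum>i<2^n. ?V i w * A T (\<theta> (ennreal (t (Suc i))) w))"
        using AE_finite_path
      proof eventually_elim
        case (elim w)
        note f = finite_path_real[OF elim]
        have "(Ar T w)\<^sup>2 - square_sum T n w = 2 * (\<Sum>i<2^n. (Ar (t (Suc i)) w - Ar (t i) w) * (Ar T w - Ar (t (Suc i)) w))"
          using square_telescope[of "\<lambda>i. Ar (t i) w" "2^n"] f(1) unfolding tT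
          by (simp add: t_def square_sum_def)
        also have "ennreal \<dots> = 2 * (\<Sum>i<2^n. ennreal (Ar (t (Suc i)) w - Ar (t i) w) * ennreal (Ar T w - Ar (t (Suc i)) w))"
        proof -
          have nn: "0 \<le> Ar (t (Suc i)) w - Ar (t i) w" "i < 2^n \<Longrightarrow> 0 \<le> Ar T w - Ar (t (Suc i)) w" for i
            using f(3)[OF t0] f(3)[of "t (Suc i)" T] t0[of "Suc i"] tle[of "Suc i"] by auto
          then have "(\<Sum>i<2^n. ennreal (Ar (t (Suc i)) w - Ar (t i) w) * ennreal (Ar T w - Ar (t (Suc i)) w))
              = (\<Sum>i<2^n. ennreal ((Ar (t (Suc i)) w - Ar (t i) w) * (Ar T w - Ar (t (Suc i)) w)))"
            by (intro sum.cong) (auto simp: ennreal_mult')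
          also have "\<dots> = ennreal (\<Sum>i<2^n. (Ar (t (Suc i)) w - Ar (t i) w) * (Ar T w - Ar (t (Suc i)) w))"
            using nn by (intro sum_ennreal) auto
          finally show ?thesis by (simp add: ennreal_mult')
        qed
        also have "\<dots> \<le> 2 * (\<Sum>i<2^n. ?V i w * A T (\<theta> (ennreal (t (Suc i))) w))"
        proof (intro mult_left_mono sum_mono mult_mono)
          fix i :: nat assume i: "i \<in> {..<2^n}"
          show "ennreal (Ar (t (Suc i)) w - Ar (t i) w) \<le> ?V i w"
            using f(4)[OF t0(1) t0(2)[of i]] by simp
          \<comment> \<open>The remaining time is enlarged to a full span T after each grid point,
            so that one functional serves for all i.\<close>
          have "A T (\<theta> (ennreal (t (Suc i))) w) = A (t (Suc i) + T) w - A (t (Suc i)) w"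
            by (rule A_shift[OF elim]) (use assms t0 in auto)
          also have "\<dots> \<ge> A T w - A (t (Suc i)) w"
            using finite_pathD(5)[OF elim, of T "t (Suc i) + T"] assms t0(1)[of "Suc i"]
            by (intro ennreal_minus_mono) auto
          finally show "ennreal (Ar T w - Ar (t (Suc i)) w) \<le> A T (\<theta> (ennreal (t (Suc i))) w)"
            using f(4)[of "t (Suc i)" T] t0(1)[of "Suc i"] tle[of "Suc i"] i by simp
        qed auto
        finally show ?case .
      qed
    qed
    also have "\<dots> = 2 * (\<Sum>i<2^n. \<integral>\<^sup>+w. ?V i w * A T (\<theta> (ennreal (t (Suc i))) w) \<partial>?P)"
    proof -
      have m: "(\<lambda>w. ?V i w * A T (\<theta> (ennreal (t (Suc i))) w)) \<in> borel_measurable ?P" for i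
        by (intro borel_measurable_times_ennreal measurable_aug_\<P>[OF V] measurable_shift[OF C])
      then show ?thesis by (subst nn_integral_cmult) (auto simp: nn_integral_sum)
    qed
    also have "\<dots> \<le> 2 * (\<Sum>i<2^n. ?c * (\<integral>\<^sup>+w. ?V i w \<partial>?P))"
    proof (intro mult_left_mono sum_mono)
      fix i
      show "(\<integral>\<^sup>+w. ?V i w * A T (\<theta> (ennreal (t (Suc i))) w) \<partial>?P) \<le> ?c * (\<integral>\<^sup>+w. ?V i w \<partial>?P)"
      proof (rule Markov_le[OF C V])
        show "AE w in ?P. X (ennreal (t (Suc i))) w = None \<longrightarrow> A T (\<theta> (ennreal (t (Suc i))) w) = 0"
          by (rule AE_dead) (use assms t0 in auto)
        show "integral\<^sup>N (law Z (Some y)) (A T) \<le> ?c" for y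
          using expectation_A[of T y] assms by (simp add: nn_integral_\<P>)
      qed
    qed auto
    also have "\<dots> = 2 * (?c * (\<integral>\<^sup>+w. (\<Sum>i<2^n. ?V i w) \<partial>?P))"
      using measurable_aug_\<P>[OF V] by (simp add: sum_distrib_left nn_integral_sum)
    also have "(\<integral>\<^sup>+w. (\<Sum>i<2^n. ?V i w) \<partial>?P) = (\<integral>\<^sup>+w. A T w \<partial>?P)"
    proof (rule nn_integral_cong_AE)
      show "AE w in ?P. (\<Sum>i<2^n. ?V i w) = A T w"
        using AE_finite_path
      proof eventually_elim
        case (elim w)
        note f = finite_path_real[OF elim]
        have "(\<Sum>i<2^n. ?V i w) = (\<Sum>i<2^n. ennreal (Ar (t (Suc i)) w - Ar (t i) w))"
          by (intro sum.cong refl f(4) t0)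
        also have "\<dots> = ennreal (\<Sum>i<2^n. Ar (t (Suc i)) w - Ar (t i) w)"
          using f(3)[OF t0] by (intro sum_ennreal) auto
        also have "(\<Sum>i<2^n. Ar (t (Suc i)) w - Ar (t i) w) = Ar T w"
          using sum_lessThan_telescope[of "\<lambda>i. Ar (t i) w" "2^n"] f(1) unfolding tT by (simp add: t_def)
        finally show ?case using f(2)[of T] assms by simp
      qed
    qed
    also have "2 * (?c * (\<integral>\<^sup>+w. A T w \<partial>?P)) \<le> 2 * (?c * ?c)"
      using expectation_A[of T x] assms by (intro mult_left_mono) auto
    finally show ?thesis by (simp add: power2_eq_square)
  qed
  \<comment> \<open>Fatou rather than dominated convergence: the natural dominating function is the
    square of A_T, whose integrability is what is being proved.\<close>
  have "(\<integral>\<^sup>+w. ennreal ((Ar T w)\<^sup>2) \<partial>?P) = (\<integral>\<^sup>+w. liminf (\<lambda>n. ennreal ((Ar T w)\<^sup>2 - square_sum T n w)) \<partial>?P)"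
  proof (rule nn_integral_cong_AE)
    show "AE w in ?P. ennreal ((Ar T w)\<^sup>2) = liminf (\<lambda>n. ennreal ((Ar T w)\<^sup>2 - square_sum T n w))"
      using AE_finite_path
    proof eventually_elim
      case (elim w)
      have "(\<lambda>n. ennreal ((Ar T w)\<^sup>2 - square_sum T n w)) \<longlonglongrightarrow> ennreal ((Ar T w)\<^sup>2 - 0)"
        by (intro tendsto_ennrealI tendsto_diff tendsto_const square_sum_tendsto assms elim)
      from lim_imp_Liminf[OF trivial_limit_sequentially this] show ?case by simp
    qed
  qed
  also have "\<dots> \<le> liminf (\<lambda>n. \<integral>\<^sup>+w. ennreal ((Ar T w)\<^sup>2 - square_sum T n w) \<partial>?P)"
    by (rule nn_integral_liminf) measurable
  also have "\<dots> \<le> liminf (\<lambda>n. 2 * ?c\<^sup>2)"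
    by (intro Liminf_mono always_eventually allI bound)
  also have "\<dots> = 2 * ?c\<^sup>2" by (simp add: Liminf_const)
  finally show ?thesis .
qed

lemma square_integrable_A:
  assumes "0 < T"
  shows "square_integrable (\<P> (Some x)) (Ar T)"
  unfolding square_integrable_def
proof
  show [measurable]: "Ar T \<in> borel_measurable (\<P> (Some x))" using assms by (simp add: Ar_\<P>)
  have "2 * (ennreal (exp T) * a)\<^sup>2 < \<infinity>"
    using bounded by (simp add: ennreal_mult_less_top power2_eq_square)
  then have "(\<integral>\<^sup>+w. ennreal ((Ar T w)\<^sup>2) \<partial>\<P> (Some x)) < \<infinity>"
    by (rule le_less_trans[OF second_moment[OF assms]])
  then show "integrable (\<P> (Some x)) (\<lambda>w. (Ar T w)\<^sup>2)"
    by (intro integrableI_nonneg) auto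
qed

lemma second_moment_real:
  assumes "0 < T"
  shows "ennreal (\<integral>w. (Ar T w)\<^sup>2 \<partial>\<P> (Some x)) \<le> 2 * (ennreal (exp T) * a)\<^sup>2"
  using second_moment[OF assms, of x] square_integrable_A[OF assms, of x]
  by (subst nn_integral_eq_integral[symmetric]) (auto simp: square_integrable_def)

lemma square_sum_\<P>:
  assumes "0 < T"
  shows "square_sum T n \<in> borel_measurable (\<P> x)"
  unfolding square_sum_def
  using assms by (intro borel_measurable_sum borel_measurable_power borel_measurable_diff Ar_\<P>) auto

lemma square_sum_nonneg: "0 \<le> square_sum T n w"
  unfolding square_sum_def by (intro sum_nonneg) simp

lemma expectation_square_sum_tendsto:
  assumes "0 < T"
  shows "(\<lambda>n. \<integral>w. square_sum T n w \<partial>\<P> (Some x)) \<longlonglongrightarrow> 0"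
proof -
  have "(\<lambda>n. \<integral>w. square_sum T n w \<partial>\<P> (Some x)) \<longlonglongrightarrow> (\<integral>w. 0 \<partial>\<P> (Some x))"
  proof (rule integral_dominated_convergence[where w="\<lambda>w. (Ar T w)\<^sup>2"])
    show "AE w in \<P> (Some x). (\<lambda>n. square_sum T n w) \<longlonglongrightarrow> 0"
      using AE_finite_path by eventually_elim (rule square_sum_tendsto[OF assms])
    show "AE w in \<P> (Some x). norm (square_sum T n w) \<le> (Ar T w)\<^sup>2" for n
      using AE_finite_path by eventually_elim (simp add: square_sum_nonneg square_sum_le[OF assms])
    show "integrable (\<P> (Some x)) (\<lambda>w. (Ar T w)\<^sup>2)"
      using square_integrable_A[OF assms] by (simp add: square_integrable_def)
  qed (simp_all add: square_sum_\<P>[OF assms])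
  then show ?thesis by simp
qed

lemma integrable_square_sum:
  assumes "0 < T"
  shows "integrable (\<P> (Some x)) (square_sum T n)"
proof (rule Bochner_Integration.integrable_bound)
  show "integrable (\<P> (Some x)) (\<lambda>w. (Ar T w)\<^sup>2)"
    using square_integrable_A[OF assms] by (simp add: square_integrable_def)
  show "AE w in \<P> (Some x). norm (square_sum T n w) \<le> norm ((Ar T w)\<^sup>2)"
    using AE_finite_path by eventually_elim (simp add: square_sum_nonneg square_sum_le[OF assms])
qed (rule square_sum_\<P>[OF assms])

section \<open>Riemann sums and their potentials\<close>

text \<open>\<open>total_sum\<close> is the lower Riemann sum of \<open>\<integral> e\<^sup>-\<^sup>\<alpha>\<^sup>t dA\<^sub>t\<close> on the grid of mesh \<open>\<eta>\<close>. Its potential lies between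
  \<open>e\<^sup>-\<^sup>\<alpha>\<^sup>\<eta> R\<^sub>\<alpha>\<mu>\<close> and \<open>R\<^sub>\<alpha>\<mu>\<close>, and unlike the integral it is plainly measurable.\<close>

definition "weight \<alpha> \<eta> i = exp (- \<alpha> * (real (Suc i) * \<eta>))"

definition "partial_sum \<alpha> \<eta> k w = (\<Sum>i<k. weight \<alpha> \<eta> i * (Ar (real (Suc i) * \<eta>) w - Ar (real i * \<eta>) w))"

definition "total_sum \<alpha> \<eta> w = (\<Sum>i. ennreal (weight \<alpha> \<eta> i) * (A (real (Suc i) * \<eta>) w - A (real i * \<eta>) w))"

definition "sum_potential \<alpha> \<eta> y = integral\<^sup>N (law Z (Some y)) (total_sum \<alpha> \<eta>)"

context
  fixes \<alpha> \<eta> :: real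
  assumes \<alpha>: "0 < \<alpha>" and \<eta>: "0 < \<eta>"
begin

lemma grid: "0 \<le> real i * \<eta>" "real i * \<eta> \<le> real (Suc i) * \<eta>" "i \<le> j \<Longrightarrow> real i * \<eta> \<le> real j * \<eta>"
  using \<eta> by (simp, intro mult_right_mono, simp_all)

lemma total_sum_aug: "total_sum \<alpha> \<eta> \<in> borel_measurable (aug \<infinity>)"
  unfolding total_sum_def
  by (intro borel_measurable_suminf_order borel_measurable_times_ennreal borel_measurable_minus_ennreal
      borel_measurable_const A_aug' grid) auto

lemma sum_potential_le: "sum_potential \<alpha> \<eta> y \<le> potential p \<alpha> \<mu> y"
proof -
  have "sum_potential \<alpha> \<eta> y \<le> (\<integral>\<^sup>+w. disc \<alpha> w \<partial>\<P> (Some y))"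
    unfolding sum_potential_def nn_integral_\<P>[symmetric]
  proof (rule nn_integral_mono_AE)
    show "AE w in \<P> (Some y). total_sum \<alpha> \<eta> w \<le> disc \<alpha> w"
      using AE_finite_path
    proof eventually_elim
      case (elim w)
      have "(\<Sum>i<K. ennreal (weight \<alpha> \<eta> i) * (A (real (Suc i) * \<eta>) w - A (real i * \<eta>) w)) \<le> disc \<alpha> w" for K
        unfolding disc_def weight_def
        by (rule stieltjes_integral_lower[OF finite_pathD(2)[OF elim] \<eta> \<alpha> finite_pathD(4)[OF elim grid(1)]])
          (rule alive_eq)
      then show ?case
        unfolding total_sum_def by (intro suminf_le_const) auto
    qed
  qed
  then show ?thesis using integral_disc[OF \<alpha>] by simp
qed

lemma sum_potential_ge: "potential p \<alpha> \<mu> y \<le> ennreal (exp (\<alpha> * \<eta>)) * sum_potential \<alpha> \<eta> y"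
proof -
  have "potential p \<alpha> \<mu> y = (\<integral>\<^sup>+w. disc \<alpha> w \<partial>\<P> (Some y))" by (rule integral_disc[OF \<alpha>, symmetric])
  also have "\<dots> \<le> (\<integral>\<^sup>+w. ennreal (exp (\<alpha> * \<eta>)) * total_sum \<alpha> \<eta> w \<partial>\<P> (Some y))"
  proof (rule nn_integral_mono_AE)
    show "AE w in \<P> (Some y). disc \<alpha> w \<le> ennreal (exp (\<alpha> * \<eta>)) * total_sum \<alpha> \<eta> w"
      using AE_finite_path
    proof eventually_elim
      case (elim w)
      have e: "exp (- \<alpha> * (real i * \<eta>)) = exp (\<alpha> * \<eta>) * weight \<alpha> \<eta> i" for i
        by (simp add: weight_def exp_add[symmetric] algebra_simps)
      have "disc \<alpha> w \<le> (\<Sum>i. ennreal (exp (- \<alpha> * (real i * \<eta>))) * (A (real (Suc i) * \<eta>) w - A (real i * \<eta>) w))"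
        unfolding disc_def by (rule stieltjes_integral_upper[OF finite_pathD(2)[OF elim] \<eta> \<alpha> alive_le])
      also have "\<dots> = (\<Sum>i. ennreal (exp (\<alpha> * \<eta>)) * (ennreal (weight \<alpha> \<eta> i) * (A (real (Suc i) * \<eta>) w - A (real i * \<eta>) w)))"
        unfolding e by (simp only: ennreal_mult'[OF exp_ge_zero] mult.assoc)
      also have "\<dots> = ennreal (exp (\<alpha> * \<eta>)) * total_sum \<alpha> \<eta> w"
        unfolding total_sum_def by (rule ennreal_suminf_cmult)
      finally show ?case .
    qed
  qed
  also have "\<dots> = ennreal (exp (\<alpha> * \<eta>)) * sum_potential \<alpha> \<eta> y"
    unfolding sum_potential_def nn_integral_\<P>[symmetric]
    by (rule nn_integral_cmult[OF measurable_aug_\<P>[OF total_sum_aug]])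
  finally show ?thesis .
qed

lemma total_sum_dead:
  assumes "finite_path w" "0 \<le> t" "X (ennreal t) w = None"
  shows "total_sum \<alpha> \<eta> (\<theta> (ennreal t) w) = 0"
  unfolding total_sum_def using A_shift_dead[OF assms(1) grid(1) assms(2,3)] by (simp del: of_nat_Suc)

text \<open>The weights are geometric, so an index shift by k factors out exp(-\<alpha> k \<eta>),
  and additivity of A turns the shifted increments into increments along the shifted path.\<close>

lemma total_sum_split:
  assumes "finite_path w"
  shows "total_sum \<alpha> \<eta> w = ennreal (partial_sum \<alpha> \<eta> k w) +
    ennreal (exp (- \<alpha> * (real k * \<eta>))) * total_sum \<alpha> \<eta> (\<theta> (ennreal (real k * \<eta>)) w)"
proof -
  note f = finite_path_real[OF assms]
  let ?t = "real k * \<eta>"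
  define F where "F i = ennreal (weight \<alpha> \<eta> i) * (A (real (Suc i) * \<eta>) w - A (real i * \<eta>) w)" for i
  have "total_sum \<alpha> \<eta> w = (\<Sum>i. F (i + k)) + (\<Sum>i<k. F i)"
    unfolding total_sum_def F_def[symmetric] by (rule suminf_offset) simp
  moreover have "(\<Sum>i<k. F i) = ennreal (partial_sum \<alpha> \<eta> k w)"
  proof -
    have "(\<Sum>i<k. F i) = (\<Sum>i<k. ennreal (weight \<alpha> \<eta> i * (Ar (real (Suc i) * \<eta>) w - Ar (real i * \<eta>) w)))"
      unfolding F_def by (simp only: f(4)[OF grid(1,2)] ennreal_mult'[of "weight \<alpha> \<eta> _", unfolded weight_def, OF exp_ge_zero] weight_def)
    also have "\<dots> = ennreal (partial_sum \<alpha> \<eta> k w)"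
      unfolding partial_sum_def using f(3)[OF grid(1,2)] by (intro sum_ennreal) (auto simp: weight_def)
    finally show ?thesis .
  qed
  moreover have "(\<Sum>i. F (i + k)) = ennreal (exp (- \<alpha> * ?t)) * total_sum \<alpha> \<eta> (\<theta> (ennreal ?t) w)"
  proof -
    have "F (i + k) = ennreal (exp (- \<alpha> * ?t)) * (ennreal (weight \<alpha> \<eta> i) *
        (A (real (Suc i) * \<eta>) (\<theta> (ennreal ?t) w) - A (real i * \<eta>) (\<theta> (ennreal ?t) w)))" for i
    proof -
      \<comment> \<open>Values along the shifted path are written as real differences, so that
        truncated subtraction and infinite values cannot interfere when they are subtracted
        again.\<close>
      have s: "A (real j * \<eta>) (\<theta> (ennreal ?t) w) = ennreal (Ar (real (j + k) * \<eta>) w - Ar ?t w)" for j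
        using A_shift[OF assms grid(1)[of j] grid(1)[of k]] f(4)[OF grid(1)[of k] grid(3), of "j + k"]
        by (simp add: algebra_simps)
      have "A (real (Suc i) * \<eta>) (\<theta> (ennreal ?t) w) - A (real i * \<eta>) (\<theta> (ennreal ?t) w)
          = ennreal (Ar (real (Suc (i + k)) * \<eta>) w - Ar (real (i + k) * \<eta>) w)"
        unfolding s using f(3)[OF grid(1)[of k] grid(3)[of k "i + k"]] by (simp add: ennreal_minus del: of_nat_add of_nat_Suc)
      also have "\<dots> = A (real (Suc (i + k)) * \<eta>) w - A (real (i + k) * \<eta>) w"
        by (rule f(4)[OF grid(1,2), symmetric])
      finally have d: "A (real (Suc (i + k)) * \<eta>) w - A (real (i + k) * \<eta>) w =
        A (real (Suc i) * \<eta>) (\<theta> (ennreal ?t) w) - A (real i * \<eta>) (\<theta> (ennreal ?t) w)" by simp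
      have e: "weight \<alpha> \<eta> (i + k) = exp (- \<alpha> * ?t) * weight \<alpha> \<eta> i"
        by (simp add: weight_def exp_add[symmetric] algebra_simps)
      show ?thesis unfolding F_def d e by (simp only: ennreal_mult'[OF exp_ge_zero] mult.assoc)
    qed
    then show ?thesis unfolding total_sum_def by simp
  qed
  ultimately show ?thesis by (simp add: add.commute)
qed

lemma partial_sum_bounds:
  assumes "finite_path w"
  shows "0 \<le> partial_sum \<alpha> \<eta> k w" "partial_sum \<alpha> \<eta> k w \<le> Ar (real k * \<eta>) w" "partial_sum \<alpha> \<eta> k w \<le> partial_sum \<alpha> \<eta> (Suc k) w"
proof -
  note f = finite_path_real[OF assms]
  have d: "0 \<le> Ar (real (Suc i) * \<eta>) w - Ar (real i * \<eta>) w" for i using f(3)[OF grid(1,2)] by simp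
  have w: "0 \<le> weight \<alpha> \<eta> i" "weight \<alpha> \<eta> i \<le> 1" for i
    using \<alpha> \<eta> by (simp_all add: weight_def)
  show "0 \<le> partial_sum \<alpha> \<eta> k w" "partial_sum \<alpha> \<eta> k w \<le> partial_sum \<alpha> \<eta> (Suc k) w"
    unfolding partial_sum_def using d w by (auto intro!: sum_nonneg mult_nonneg_nonneg simp del: of_nat_Suc)
  have "partial_sum \<alpha> \<eta> k w \<le> (\<Sum>i<k. 1 * (Ar (real (Suc i) * \<eta>) w - Ar (real i * \<eta>) w))"
    unfolding partial_sum_def by (intro sum_mono mult_right_mono w d)
  also have "\<dots> = Ar (real k * \<eta>) w"
    using sum_lessThan_telescope[of "\<lambda>i. Ar (real i * \<eta>) w" k] f(1) by simp
  finally show "partial_sum \<alpha> \<eta> k w \<le> Ar (real k * \<eta>) w" .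
qed

lemma partial_sum_aug: "partial_sum \<alpha> \<eta> k \<in> borel_measurable (aug (ennreal (real k * \<eta>)))"
  unfolding partial_sum_def
proof (intro borel_measurable_sum borel_measurable_times borel_measurable_diff borel_measurable_const)
  fix i assume "i \<in> {..<k}"
  then show "Ar (real (Suc i) * \<eta>) \<in> borel_measurable (aug (ennreal (real k * \<eta>)))"
    "Ar (real i * \<eta>) \<in> borel_measurable (aug (ennreal (real k * \<eta>)))"
    by (intro Ar_aug grid ennreal_leI; simp)+
qed

lemma partial_sum_square_integrable: "square_integrable (\<P> (Some x)) (partial_sum \<alpha> \<eta> k)"
proof (rule square_integrable_le)
  show "square_integrable (\<P> (Some x)) (Ar (real (Suc k) * \<eta>))"
    by (rule square_integrable_A) (use \<eta> in simp)
  show "partial_sum \<alpha> \<eta> k \<in> borel_measurable (\<P> (Some x))" by (rule measurable_aug_\<P>[OF partial_sum_aug])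
  show "AE w in \<P> (Some x). \<bar>partial_sum \<alpha> \<eta> k w\<bar> \<le> \<bar>Ar (real (Suc k) * \<eta>) w\<bar>"
    using AE_finite_path
  proof eventually_elim
    case (elim w)
    have "partial_sum \<alpha> \<eta> k w \<le> Ar (real (Suc k) * \<eta>) w"
      using partial_sum_bounds(2)[OF elim, of k] finite_path_real(3)[OF elim grid(1) grid(2)[of k]] by linarith
    then show ?case using partial_sum_bounds(1)[OF elim, of k] by linarith
  qed
qed

lemma sum_potential_finite: "sum_potential \<alpha> \<eta> y < \<infinity>"
  using sum_potential_le potential_le potential_finite[OF \<alpha>] by (meson le_less_trans)

text \<open>\<open>partial_sum\<close> plus Y is a version of the conditional expectation of
  \<open>total_sum\<close> given the grid time, so the sums for different k all come from one
  terminal variable. Y is existential because it rests on a version that depends on x.\<close>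

lemma potential_process:
  "\<exists>Y. Y \<in> borel_measurable (aug (ennreal (real k * \<eta>))) \<and>
    (AE w in \<P> (Some x). Y w = exp (- \<alpha> * (real k * \<eta>)) *
      (case X (ennreal (real k * \<eta>)) w of None \<Rightarrow> 0 | Some y \<Rightarrow> enn2real (sum_potential \<alpha> \<eta> y))) \<and>
    (\<forall>\<Lambda>\<in>sets (aug (ennreal (real k * \<eta>))).
      (\<integral>\<^sup>+w\<in>\<Lambda>. total_sum \<alpha> \<eta> w \<partial>\<P> (Some x)) = (\<integral>\<^sup>+w\<in>\<Lambda>. ennreal (partial_sum \<alpha> \<eta> k w + Y w) \<partial>\<P> (Some x)))"
proof -
  let ?t = "ennreal (real k * \<eta>)" and ?e = "exp (- \<alpha> * (real k * \<eta>))" and ?P = "\<P> (Some x)"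
  have dead: "AE w in ?P. X ?t w = None \<longrightarrow> total_sum \<alpha> \<eta> (\<theta> ?t w) = 0"
    using AE_finite_path by eventually_elim (use total_sum_dead grid in blast)
  obtain Y where Y: "Y \<in> borel_measurable (aug ?t)"
    "AE w in ?P. Y w = (case X ?t w of None \<Rightarrow> 0 | Some y \<Rightarrow> integral\<^sup>N (law Z (Some y)) (total_sum \<alpha> \<eta>))"
    "(\<lambda>w. total_sum \<alpha> \<eta> (\<theta> ?t w)) \<in> borel_measurable ?P"
    "\<And>V. V \<in> borel_measurable (aug ?t) \<Longrightarrow>
      (\<integral>\<^sup>+w. V w * total_sum \<alpha> \<eta> (\<theta> ?t w) \<partial>?P) = (\<integral>\<^sup>+w. V w * Y w \<partial>?P)"
    by (rule Markov_potential[OF total_sum_aug dead]) blast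
  note [measurable] = Y(3) measurable_aug_\<P>[OF Y(1), of "Some x"] measurable_aug_\<P>[OF partial_sum_aug, of k "Some x"]
  have fin: "AE w in ?P. Y w < \<infinity>"
    using Y(2) by eventually_elim (use sum_potential_finite in \<open>simp add: sum_potential_def split: option.split\<close>)
  show ?thesis
  proof (intro exI[of _ "\<lambda>w. ?e * enn2real (Y w)"] conjI ballI)
    show "(\<lambda>w. ?e * enn2real (Y w)) \<in> borel_measurable (aug ?t)" using Y(1) by measurable
    show "AE w in ?P. ?e * enn2real (Y w) = ?e * (case X ?t w of None \<Rightarrow> 0 | Some y \<Rightarrow> enn2real (sum_potential \<alpha> \<eta> y))"
      using Y(2) by eventually_elim (simp add: sum_potential_def split: option.split)
    fix \<Lambda> assume \<Lambda>: "\<Lambda> \<in> sets (aug ?t)"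
    then have [measurable]: "\<Lambda> \<in> sets ?P" using aug_\<P> by blast
    have "(\<integral>\<^sup>+w\<in>\<Lambda>. total_sum \<alpha> \<eta> w \<partial>?P) = (\<integral>\<^sup>+w. ennreal (partial_sum \<alpha> \<eta> k w) * indicator \<Lambda> w + ennreal ?e * (indicator \<Lambda> w * total_sum \<alpha> \<eta> (\<theta> ?t w)) \<partial>?P)"
    proof (rule nn_integral_cong_AE)
      show "AE w in ?P. total_sum \<alpha> \<eta> w * indicator \<Lambda> w =
          ennreal (partial_sum \<alpha> \<eta> k w) * indicator \<Lambda> w + ennreal ?e * (indicator \<Lambda> w * total_sum \<alpha> \<eta> (\<theta> ?t w))"
        using AE_finite_path
      proof eventually_elim
        case (elim w)
        show ?case unfolding total_sum_split[OF elim, of k] by (simp split: split_indicator)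
      qed
    qed
    also have "\<dots> = (\<integral>\<^sup>+w. ennreal (partial_sum \<alpha> \<eta> k w) * indicator \<Lambda> w \<partial>?P) + ennreal ?e * (\<integral>\<^sup>+w. indicator \<Lambda> w * total_sum \<alpha> \<eta> (\<theta> ?t w) \<partial>?P)"
      by (subst nn_integral_add) (auto simp: nn_integral_cmult)
    also have "(\<integral>\<^sup>+w. indicator \<Lambda> w * total_sum \<alpha> \<eta> (\<theta> ?t w) \<partial>?P) = (\<integral>\<^sup>+w. indicator \<Lambda> w * Y w \<partial>?P)"
      by (rule Y(4)) (rule borel_measurable_indicator[OF \<Lambda>])
    also have "(\<integral>\<^sup>+w. ennreal (partial_sum \<alpha> \<eta> k w) * indicator \<Lambda> w \<partial>?P) + ennreal ?e * (\<integral>\<^sup>+w. indicator \<Lambda> w * Y w \<partial>?P)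
        = (\<integral>\<^sup>+w. ennreal (partial_sum \<alpha> \<eta> k w) * indicator \<Lambda> w + ennreal ?e * (indicator \<Lambda> w * Y w) \<partial>?P)"
      by (subst nn_integral_add) (auto simp: nn_integral_cmult)
    also have "\<dots> = (\<integral>\<^sup>+w\<in>\<Lambda>. ennreal (partial_sum \<alpha> \<eta> k w + ?e * enn2real (Y w)) \<partial>?P)"
    proof (rule nn_integral_cong_AE)
      show "AE w in ?P. ennreal (partial_sum \<alpha> \<eta> k w) * indicator \<Lambda> w + ennreal ?e * (indicator \<Lambda> w * Y w) =
          ennreal (partial_sum \<alpha> \<eta> k w + ?e * enn2real (Y w)) * indicator \<Lambda> w"
        using AE_finite_path fin
      proof eventually_elim
        case (elim w)
        have "ennreal (partial_sum \<alpha> \<eta> k w + ?e * enn2real (Y w)) = ennreal (partial_sum \<alpha> \<eta> k w) + ennreal ?e * ennreal (enn2real (Y w))"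
          using partial_sum_bounds(1)[OF elim(1), of k] by (simp add: ennreal_plus ennreal_mult')
        also have "ennreal (enn2real (Y w)) = Y w" using elim(2) by simp
        finally show ?case by (simp split: split_indicator)
      qed
    qed
    finally show "(\<integral>\<^sup>+w\<in>\<Lambda>. total_sum \<alpha> \<eta> w \<partial>?P) = (\<integral>\<^sup>+w\<in>\<Lambda>. ennreal (partial_sum \<alpha> \<eta> k w + ?e * enn2real (Y w)) \<partial>?P)" .
  qed
qed

end

end

section \<open>Comparison of two functionals\<close>

lemma abs_diff_ennreal: "0 \<le> r \<Longrightarrow> 0 \<le> s \<Longrightarrow> abs_diff (ennreal r) (ennreal s) = ennreal \<bar>r - s\<bar>"
  by (auto simp: abs_diff_def ennreal_minus max_def abs_if ennreal_neg ennreal_le_iff2)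

lemma (in revuz_functional) finite_potential:
  assumes "0 < \<alpha>"
  shows "potential p \<alpha> \<mu> y < \<infinity>"
  using potential_le potential_finite[OF assms] by (rule le_less_trans)

lemma (in revuz_functional) sum_potential_real:
  assumes "0 < \<alpha>" "0 < \<eta>"
  shows "0 \<le> enn2real (sum_potential \<alpha> \<eta> y)" "enn2real (sum_potential \<alpha> \<eta> y) \<le> enn2real (potential p \<alpha> \<mu> y)"
    "exp (- \<alpha> * \<eta>) * enn2real (potential p \<alpha> \<mu> y) \<le> enn2real (sum_potential \<alpha> \<eta> y)"
    "enn2real (potential p \<alpha> \<mu> y) \<le> enn2real (sup_norm (potential p \<alpha> \<mu>))"
proof -
  note fin = finite_potential[OF assms(1), of y] sum_potential_finite[OF assms, of y] potential_finite[OF assms(1)]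
  show "0 \<le> enn2real (sum_potential \<alpha> \<eta> y)" by simp
  show "enn2real (sum_potential \<alpha> \<eta> y) \<le> enn2real (potential p \<alpha> \<mu> y)"
    by (rule enn2real_mono[OF sum_potential_le[OF assms]]) (use fin in simp)
  show "enn2real (potential p \<alpha> \<mu> y) \<le> enn2real (sup_norm (potential p \<alpha> \<mu>))"
    by (rule enn2real_mono[OF potential_le]) (use fin in simp)
  have "enn2real (potential p \<alpha> \<mu> y) \<le> enn2real (ennreal (exp (\<alpha> * \<eta>)) * sum_potential \<alpha> \<eta> y)"
    by (rule enn2real_mono[OF sum_potential_ge[OF assms]]) (use fin in \<open>simp add: ennreal_mult_less_top\<close>)
  then have "enn2real (potential p \<alpha> \<mu> y) \<le> exp (\<alpha> * \<eta>) * enn2real (sum_potential \<alpha> \<eta> y)"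
    by (simp add: enn2real_mult)
  then have "exp (- \<alpha> * \<eta>) * enn2real (potential p \<alpha> \<mu> y) \<le> exp (- \<alpha> * \<eta>) * (exp (\<alpha> * \<eta>) * enn2real (sum_potential \<alpha> \<eta> y))"
    by (rule mult_left_mono) simp
  then show "exp (- \<alpha> * \<eta>) * enn2real (potential p \<alpha> \<mu> y) \<le> enn2real (sum_potential \<alpha> \<eta> y)"
    by (simp add: mult.assoc[symmetric] exp_add[symmetric])
qed

text \<open>The martingale property is that of successive conditional expectations of
  \<open>total_sum\<close>: an event of stage k is also one of stage k + 1, and both set integrals
  equal that of the terminal variable.\<close>

lemma (in revuz_functional) potential_processes:
  assumes \<alpha>: "0 < \<alpha>" and \<eta>: "0 < \<eta>"
  obtains Y where "\<And>k. Y k \<in> borel_measurable (aug (ennreal (real k * \<eta>)))"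
    "\<And>k. AE w in \<P> (Some x). Y k w = exp (- \<alpha> * (real k * \<eta>)) *
      (case X (ennreal (real k * \<eta>)) w of None \<Rightarrow> 0 | Some y \<Rightarrow> enn2real (sum_potential \<alpha> \<eta> y))"
    "\<And>k \<Lambda>. \<Lambda> \<in> sets (aug (ennreal (real k * \<eta>))) \<Longrightarrow>
      (\<integral>w\<in>\<Lambda>. partial_sum \<alpha> \<eta> (Suc k) w + Y (Suc k) w \<partial>\<P> (Some x)) = (\<integral>w\<in>\<Lambda>. partial_sum \<alpha> \<eta> k w + Y k w \<partial>\<P> (Some x))"
    "\<And>k. AE w in \<P> (Some x). 0 \<le> Y k w \<and> Y k w \<le> enn2real (sup_norm (potential p \<alpha> \<mu>))"
proof -
  let ?P = "\<P> (Some x)"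
  have "\<forall>k. \<exists>Y. Y \<in> borel_measurable (aug (ennreal (real k * \<eta>))) \<and>
    (AE w in ?P. Y w = exp (- \<alpha> * (real k * \<eta>)) *
      (case X (ennreal (real k * \<eta>)) w of None \<Rightarrow> 0 | Some y \<Rightarrow> enn2real (sum_potential \<alpha> \<eta> y))) \<and>
    (\<forall>\<Lambda>\<in>sets (aug (ennreal (real k * \<eta>))).
      (\<integral>\<^sup>+w\<in>\<Lambda>. total_sum \<alpha> \<eta> w \<partial>?P) = (\<integral>\<^sup>+w\<in>\<Lambda>. ennreal (partial_sum \<alpha> \<eta> k w + Y w) \<partial>?P))"
    using potential_process[OF \<alpha> \<eta>] by blast
  from choice[OF this] obtain Y where Y: "\<And>k. Y k \<in> borel_measurable (aug (ennreal (real k * \<eta>)))"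
    "\<And>k. AE w in ?P. Y k w = exp (- \<alpha> * (real k * \<eta>)) *
      (case X (ennreal (real k * \<eta>)) w of None \<Rightarrow> 0 | Some y \<Rightarrow> enn2real (sum_potential \<alpha> \<eta> y))"
    "\<And>k \<Lambda>. \<Lambda> \<in> sets (aug (ennreal (real k * \<eta>))) \<Longrightarrow>
      (\<integral>\<^sup>+w\<in>\<Lambda>. total_sum \<alpha> \<eta> w \<partial>?P) = (\<integral>\<^sup>+w\<in>\<Lambda>. ennreal (partial_sum \<alpha> \<eta> k w + Y k w) \<partial>?P)"
    by blast
  let ?c = "enn2real (sup_norm (potential p \<alpha> \<mu>))"
  have bnd: "AE w in ?P. 0 \<le> Y k w \<and> Y k w \<le> ?c" for k
    using Y(2)[of k]
  proof eventually_elim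
    case (elim w)
    let ?v = "case X (ennreal (real k * \<eta>)) w of None \<Rightarrow> 0 | Some y \<Rightarrow> enn2real (sum_potential \<alpha> \<eta> y)"
    have v: "0 \<le> ?v" "?v \<le> ?c"
      using order_trans[OF sum_potential_real(2)[OF \<alpha> \<eta>] sum_potential_real(4)[OF \<alpha> \<eta>]] by (auto split: option.split)
    have "exp (- \<alpha> * (real k * \<eta>)) \<le> 1" using \<alpha> \<eta> by simp
    then have "exp (- \<alpha> * (real k * \<eta>)) * ?v \<le> 1 * ?v" using v(1) by (rule mult_right_mono)
    then show ?case using v elim by simp
  qed
  have eq: "(\<integral>w\<in>\<Lambda>. partial_sum \<alpha> \<eta> k w + Y k w \<partial>?P) = enn2real (\<integral>\<^sup>+w\<in>\<Lambda>. total_sum \<alpha> \<eta> w \<partial>?P)"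
    if \<Lambda>: "\<Lambda> \<in> sets (aug (ennreal (real k * \<eta>)))" for k \<Lambda>
  proof -
    have [measurable]: "\<Lambda> \<in> sets ?P" using \<Lambda> aug_\<P> by blast
    note [measurable] = measurable_aug_\<P>[OF Y(1)[of k], of "Some x"] measurable_aug_\<P>[OF partial_sum_aug[OF \<alpha> \<eta>], of k "Some x"]
    have "(\<integral>w\<in>\<Lambda>. partial_sum \<alpha> \<eta> k w + Y k w \<partial>?P) = enn2real (\<integral>\<^sup>+w. ennreal (indicator \<Lambda> w *\<^sub>R (partial_sum \<alpha> \<eta> k w + Y k w)) \<partial>?P)"
      unfolding set_lebesgue_integral_def
    proof (rule integral_eq_nn_integral)
      show "AE w in ?P. 0 \<le> indicator \<Lambda> w *\<^sub>R (partial_sum \<alpha> \<eta> k w + Y k w)"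
        using AE_finite_path bnd[of k]
      proof eventually_elim
        case (elim w)
        then show ?case using partial_sum_bounds(1)[OF \<alpha> \<eta> elim(1), of k] by simp
      qed
    qed measurable
    also have "(\<integral>\<^sup>+w. ennreal (indicator \<Lambda> w *\<^sub>R (partial_sum \<alpha> \<eta> k w + Y k w)) \<partial>?P) = (\<integral>\<^sup>+w\<in>\<Lambda>. ennreal (partial_sum \<alpha> \<eta> k w + Y k w) \<partial>?P)"
      by (intro nn_integral_cong) (simp split: split_indicator)
    finally show ?thesis using Y(3)[OF \<Lambda>] by simp
  qed
  show ?thesis
  proof (rule that[OF Y(1,2) _ bnd])
    fix k \<Lambda> assume \<Lambda>: "\<Lambda> \<in> sets (aug (ennreal (real k * \<eta>)))"
    then have "\<Lambda> \<in> sets (aug (ennreal (real (Suc k) * \<eta>)))"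
      using aug_mono[OF ennreal_leI[OF grid(2)[OF \<alpha> \<eta>]]] by blast
    then show "(\<integral>w\<in>\<Lambda>. partial_sum \<alpha> \<eta> (Suc k) w + Y (Suc k) w \<partial>?P) = (\<integral>w\<in>\<Lambda>. partial_sum \<alpha> \<eta> k w + Y k w \<partial>?P)"
      using eq[OF \<Lambda>] eq[of \<Lambda> "Suc k"] by simp
  qed
qed

locale revuz_pair =
  A: revuz_functional Z p A \<mu> + B: revuz_functional Z p B \<nu>
  for Z :: "('w, 's::t2_space) process" and p A \<mu> B \<nu> +
  fixes \<alpha> T :: real
  assumes \<alpha>: "0 < \<alpha>" and T: "0 < T"
begin

definition "c = enn2real (sup_norm (potential p \<alpha> \<mu>)) + enn2real (sup_norm (potential p \<alpha> \<nu>))"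
definition "\<delta> = enn2real (sup_norm (\<lambda>x. abs_diff (potential p \<alpha> \<mu> x) (potential p \<alpha> \<nu> x)))"

lemma abs_diff_potential:
  "abs_diff (potential p \<alpha> \<mu> x) (potential p \<alpha> \<nu> x) =
    ennreal \<bar>enn2real (potential p \<alpha> \<mu> x) - enn2real (potential p \<alpha> \<nu> x)\<bar>"
proof -
  have "potential p \<alpha> \<mu> x = ennreal (enn2real (potential p \<alpha> \<mu> x))"
    "potential p \<alpha> \<nu> x = ennreal (enn2real (potential p \<alpha> \<nu> x))"
    using A.finite_potential[OF \<alpha>, of x] B.finite_potential[OF \<alpha>, of x] by simp_all
  then show ?thesis using abs_diff_ennreal by (metis enn2real_nonneg)
qed

lemma c_nonneg: "0 \<le> c" by (simp add: c_def)

lemma sup_norm_diff_le: "sup_norm (\<lambda>x. abs_diff (potential p \<alpha> \<mu> x) (potential p \<alpha> \<nu> x)) \<le> ennreal c"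
  unfolding sup_norm_def
proof (rule SUP_least)
  fix x
  have "\<bar>enn2real (potential p \<alpha> \<mu> x) - enn2real (potential p \<alpha> \<nu> x)\<bar> \<le> c"
    unfolding c_def
    using A.sum_potential_real(4)[OF \<alpha> \<alpha>, of x] B.sum_potential_real(4)[OF \<alpha> \<alpha>, of x] enn2real_nonneg[of "potential p \<alpha> \<mu> x"]
      enn2real_nonneg[of "potential p \<alpha> \<nu> x"] by linarith
  then show "abs_diff (potential p \<alpha> \<mu> x) (potential p \<alpha> \<nu> x) \<le> ennreal c"
    unfolding abs_diff_potential by (rule ennreal_leI)
qed

lemma \<delta>: "sup_norm (\<lambda>x. abs_diff (potential p \<alpha> \<mu> x) (potential p \<alpha> \<nu> x)) = ennreal \<delta>" "0 \<le> \<delta>" "\<delta> \<le> c"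
proof -
  have "sup_norm (\<lambda>x. abs_diff (potential p \<alpha> \<mu> x) (potential p \<alpha> \<nu> x)) < \<infinity>"
    by (rule le_less_trans[OF sup_norm_diff_le]) simp
  then show "sup_norm (\<lambda>x. abs_diff (potential p \<alpha> \<mu> x) (potential p \<alpha> \<nu> x)) = ennreal \<delta>"
    unfolding \<delta>_def by simp
  show "0 \<le> \<delta>" by (simp add: \<delta>_def)
  show "\<delta> \<le> c" unfolding \<delta>_def
    using enn2real_mono[OF sup_norm_diff_le] c_nonneg by simp
qed

lemma potential_diff_le: "\<bar>enn2real (potential p \<alpha> \<mu> x) - enn2real (potential p \<alpha> \<nu> x)\<bar> \<le> \<delta>"
proof -
  have "ennreal \<bar>enn2real (potential p \<alpha> \<mu> x) - enn2real (potential p \<alpha> \<nu> x)\<bar> \<le> ennreal \<delta>"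
    unfolding \<delta>(1)[symmetric] abs_diff_potential[symmetric] sup_norm_def by (rule SUP_upper) simp
  then show ?thesis using \<delta>(2) by (simp add: ennreal_le_iff)
qed

text \<open>The distance \<delta> of the true potentials plus the largest error that passing to the
  Riemann sums can cause; the error vanishes as the mesh tends to 0.\<close>

definition "\<epsilon> n = \<delta> + (1 - exp (- \<alpha> * (T / 2^n))) * c"

lemma \<epsilon>_tendsto: "\<epsilon> \<longlonglongrightarrow> \<delta>"
proof -
  have "(\<lambda>n. T / 2^n) \<longlonglongrightarrow> 0" by (rule LIMSEQ_divide_realpow_zero) simp
  then have "(\<lambda>n. \<delta> + (1 - exp (- \<alpha> * (T / 2^n))) * c) \<longlonglongrightarrow> \<delta> + (1 - exp (- \<alpha> * 0)) * c"
    by (intro tendsto_intros)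
  then show ?thesis by (simp add: \<epsilon>_def[abs_def])
qed

lemma sum_potential_diff:
  fixes n :: nat
  defines "\<eta> \<equiv> T / 2^n"
  shows "\<bar>enn2real (A.sum_potential \<alpha> \<eta> y) - enn2real (B.sum_potential \<alpha> \<eta> y)\<bar> \<le> \<epsilon> n"
proof -
  have \<eta>: "0 < \<eta>" using T by (simp add: \<eta>_def)
  let ?q = "1 - exp (- \<alpha> * \<eta>)"
  have q: "0 \<le> ?q" using \<alpha> \<eta> by simp
  \<comment> \<open>The worst case has one potential kept in full and the other reduced by
    exp(-\<alpha> \<eta>); this adds (1 - exp(-\<alpha> \<eta>)) s to r - s.\<close>
  have le: "r - exp (- \<alpha> * \<eta>) * s \<le> \<epsilon> n" if "r - s \<le> \<delta>" "s \<le> c" for r s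
  proof -
    have "?q * s \<le> ?q * c" using that(2) q by (rule mult_left_mono)
    then show ?thesis using that(1) by (simp add: \<epsilon>_def \<eta>_def algebra_simps)
  qed
  let ?R = "enn2real (potential p \<alpha> \<mu> y)" and ?R' = "enn2real (potential p \<alpha> \<nu> y)"
  have c: "?R \<le> c" "?R' \<le> c"
    using A.sum_potential_real(4)[OF \<alpha> \<eta>, of y] B.sum_potential_real(4)[OF \<alpha> \<eta>, of y]
      enn2real_nonneg[of "sup_norm (potential p \<alpha> \<mu>)"] enn2real_nonneg[of "sup_norm (potential p \<alpha> \<nu>)"]
    unfolding c_def by linarith+
  have "?R - exp (- \<alpha> * \<eta>) * ?R' \<le> \<epsilon> n" "?R' - exp (- \<alpha> * \<eta>) * ?R \<le> \<epsilon> n"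
    by (rule le; use potential_diff_le[of y] c in linarith)+
  then show ?thesis
    using A.sum_potential_real(2,3)[OF \<alpha> \<eta>, of y] B.sum_potential_real(2,3)[OF \<alpha> \<eta>, of y] by linarith
qed

lemma \<epsilon>_nonneg: "0 \<le> \<epsilon> n"
  using order_trans[OF abs_ge_zero sum_potential_diff] .

text \<open>The martingale estimates for the discounted partial sums of A and B, with Y and W the
  discounted potentials of what remains. Both potentials are zero at \<Delta>, so their distance
  needs to be controlled only on S.\<close>

lemma discounted_maximal:
  fixes n :: nat
  defines "\<eta> \<equiv> T / 2^n"
  defines "S \<equiv> \<lambda>w. Max ((\<lambda>i. \<bar>A.partial_sum \<alpha> \<eta> i w - B.partial_sum \<alpha> \<eta> i w\<bar>) ` {..2^n})"
  shows "integrable (A.\<P> (Some x)) (\<lambda>w. (S w)\<^sup>2)"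
    "(\<integral>w. (S w)\<^sup>2 \<partial>A.\<P> (Some x)) \<le> 8 * (2 * \<epsilon> n * c
      + ((\<integral>w. A.square_sum T n w \<partial>A.\<P> (Some x)) + (\<integral>w. B.square_sum T n w \<partial>A.\<P> (Some x)))) + 2 * (\<epsilon> n)\<^sup>2"
proof -
  have \<eta>: "0 < \<eta>" using T by (simp add: \<eta>_def)
  let ?P = "A.\<P> (Some x)"
  let ?cA = "enn2real (sup_norm (potential p \<alpha> \<mu>))" and ?cB = "enn2real (sup_norm (potential p \<alpha> \<nu>))"
  obtain Y where Y: "\<And>k. Y k \<in> borel_measurable (A.aug (ennreal (real k * \<eta>)))"
    "\<And>k. AE w in ?P. Y k w = exp (- \<alpha> * (real k * \<eta>)) *
      (case A.X (ennreal (real k * \<eta>)) w of None \<Rightarrow> 0 | Some y \<Rightarrow> enn2real (A.sum_potential \<alpha> \<eta> y))"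
    "\<And>k \<Lambda>. \<Lambda> \<in> sets (A.aug (ennreal (real k * \<eta>))) \<Longrightarrow>
      (\<integral>w\<in>\<Lambda>. A.partial_sum \<alpha> \<eta> (Suc k) w + Y (Suc k) w \<partial>?P) = (\<integral>w\<in>\<Lambda>. A.partial_sum \<alpha> \<eta> k w + Y k w \<partial>?P)"
    "\<And>k. AE w in ?P. 0 \<le> Y k w \<and> Y k w \<le> ?cA"
    by (rule A.potential_processes[OF \<alpha> \<eta>]) blast
  obtain W where W: "\<And>k. W k \<in> borel_measurable (A.aug (ennreal (real k * \<eta>)))"
    "\<And>k. AE w in ?P. W k w = exp (- \<alpha> * (real k * \<eta>)) *
      (case A.X (ennreal (real k * \<eta>)) w of None \<Rightarrow> 0 | Some y \<Rightarrow> enn2real (B.sum_potential \<alpha> \<eta> y))"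
    "\<And>k \<Lambda>. \<Lambda> \<in> sets (A.aug (ennreal (real k * \<eta>))) \<Longrightarrow>
      (\<integral>w\<in>\<Lambda>. B.partial_sum \<alpha> \<eta> (Suc k) w + W (Suc k) w \<partial>?P) = (\<integral>w\<in>\<Lambda>. B.partial_sum \<alpha> \<eta> k w + W k w \<partial>?P)"
    "\<And>k. AE w in ?P. 0 \<le> W k w \<and> W k w \<le> ?cB"
    by (rule B.potential_processes[OF \<alpha> \<eta>]) blast
  interpret prob_space ?P by (rule A.prob_\<P>)
  interpret potential_pair ?P "\<lambda>k. A.aug (ennreal (real k * \<eta>))" "A.partial_sum \<alpha> \<eta>" "B.partial_sum \<alpha> \<eta>" Y W c "\<epsilon> n"
  proof
    fix i j k :: nat
    show "subalgebra ?P (A.aug (ennreal (real i * \<eta>)))" by (rule A.subalgebra_\<P>)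
    show "sets (A.aug (ennreal (real i * \<eta>))) \<subseteq> sets (A.aug (ennreal (real j * \<eta>)))" if "i \<le> j"
      by (intro A.aug_mono ennreal_leI A.grid(3)[OF \<alpha> \<eta> that])
    show "A.partial_sum \<alpha> \<eta> i \<in> borel_measurable (A.aug (ennreal (real i * \<eta>)))" by (rule A.partial_sum_aug[OF \<alpha> \<eta>])
    show "B.partial_sum \<alpha> \<eta> i \<in> borel_measurable (A.aug (ennreal (real i * \<eta>)))" by (rule B.partial_sum_aug[OF \<alpha> \<eta>])
    show "Y i \<in> borel_measurable (A.aug (ennreal (real i * \<eta>)))" "W i \<in> borel_measurable (A.aug (ennreal (real i * \<eta>)))"
      by (rule Y(1) W(1))+
    show "A.partial_sum \<alpha> \<eta> 0 w = 0" "B.partial_sum \<alpha> \<eta> 0 w = 0" for w by (simp_all add: A.partial_sum_def B.partial_sum_def)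
    show "AE w in ?P. A.partial_sum \<alpha> \<eta> i w \<le> A.partial_sum \<alpha> \<eta> (Suc i) w"
      using A.AE_finite_path by eventually_elim (rule A.partial_sum_bounds(3)[OF \<alpha> \<eta>])
    show "AE w in ?P. B.partial_sum \<alpha> \<eta> i w \<le> B.partial_sum \<alpha> \<eta> (Suc i) w"
      using B.AE_finite_path by eventually_elim (rule B.partial_sum_bounds(3)[OF \<alpha> \<eta>])
    show "square_integrable ?P (A.partial_sum \<alpha> \<eta> i)" by (rule A.partial_sum_square_integrable[OF \<alpha> \<eta>])
    show "square_integrable ?P (B.partial_sum \<alpha> \<eta> i)" by (rule B.partial_sum_square_integrable[OF \<alpha> \<eta>])
    show "AE w in ?P. 0 \<le> Y i w \<and> Y i w \<le> c"
      using Y(4)[of i] by eventually_elim (auto simp: c_def intro: add_increasing2)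
    show "AE w in ?P. 0 \<le> W i w \<and> W i w \<le> c"
      using W(4)[of i] by eventually_elim (auto simp: c_def intro: add_increasing)
    show "AE w in ?P. \<bar>Y i w - W i w\<bar> \<le> \<epsilon> n"
      using Y(2)[of i] W(2)[of i]
    proof eventually_elim
      case (elim w)
      let ?e = "exp (- \<alpha> * (real i * \<eta>))"
      have e: "?e \<le> 1" using \<alpha> \<eta> by simp
      show ?case
      proof (cases "A.X (ennreal (real i * \<eta>)) w")
        case None
        then show ?thesis using elim \<epsilon>_nonneg by simp
      next
        case (Some y)
        have "\<bar>Y i w - W i w\<bar> = ?e * \<bar>enn2real (A.sum_potential \<alpha> \<eta> y) - enn2real (B.sum_potential \<alpha> \<eta> y)\<bar>"
          unfolding elim Some by (simp add: right_diff_distrib[symmetric] abs_mult)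
        also have "\<dots> \<le> 1 * \<bar>enn2real (A.sum_potential \<alpha> \<eta> y) - enn2real (B.sum_potential \<alpha> \<eta> y)\<bar>"
          by (rule mult_right_mono[OF e]) simp
        also have "\<dots> \<le> \<epsilon> n" using sum_potential_diff[where n=n] unfolding \<eta>_def by simp
        finally show ?thesis .
      qed
    qed
    show "(\<integral>w\<in>\<Lambda>. A.partial_sum \<alpha> \<eta> (Suc i) w + Y (Suc i) w \<partial>?P) = (\<integral>w\<in>\<Lambda>. A.partial_sum \<alpha> \<eta> i w + Y i w \<partial>?P)"
      if "\<Lambda> \<in> sets (A.aug (ennreal (real i * \<eta>)))" for \<Lambda> by (rule Y(3)[OF that])
    show "(\<integral>w\<in>\<Lambda>. B.partial_sum \<alpha> \<eta> (Suc i) w + W (Suc i) w \<partial>?P) = (\<integral>w\<in>\<Lambda>. B.partial_sum \<alpha> \<eta> i w + W i w \<partial>?P)"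
      if "\<Lambda> \<in> sets (A.aug (ennreal (real i * \<eta>)))" for \<Lambda> by (rule W(3)[OF that])
  qed
  have S_eq: "S w = Max ((\<lambda>i. \<bar>D i w\<bar>) ` {..2^n})" for w by (simp add: S_def D_def)
  show "integrable ?P (\<lambda>w. (S w)\<^sup>2)"
    unfolding S_eq by (rule maximal_bound(1))
  have Y0: "(\<integral>w. Y 0 w \<partial>?P) + (\<integral>w. W 0 w \<partial>?P) \<le> c"
  proof -
    have "(\<integral>w. Y 0 w \<partial>?P) \<le> ?cA"
      using Y(4)[of 0] square_integrable_integrable[OF sq_YW(1)] by (intro integral_le_const) auto
    moreover have "(\<integral>w. W 0 w \<partial>?P) \<le> ?cB"
      using W(4)[of 0] square_integrable_integrable[OF sq_YW(2)] by (intro integral_le_const) auto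
    ultimately show ?thesis by (simp add: c_def)
  qed
  \<comment> \<open>Both functionals carry the same weight, at most 1, on each cell, and for
    nonnegative r and s the square of r - s is at most r^2 + s^2. So the quadratic variation of the
    discounted difference is bounded by those of A and B.\<close>
  have Dsum: "(\<Sum>i<2^n. \<integral>w. (D (Suc i) w - D i w)\<^sup>2 \<partial>?P)
      \<le> (\<integral>w. A.square_sum T n w \<partial>?P) + (\<integral>w. B.square_sum T n w \<partial>?P)"
  proof -
    have i: "integrable ?P (\<lambda>w. (D (Suc i) w - D i w)\<^sup>2)" for i
      using square_integrable_diff[OF sq(1)[of "Suc i"] sq(1)[of i]] by (simp add: square_integrable_def)
    have "(\<Sum>i<2^n. \<integral>w. (D (Suc i) w - D i w)\<^sup>2 \<partial>?P) = (\<integral>w. (\<Sum>i<2^n. (D (Suc i) w - D i w)\<^sup>2) \<partial>?P)"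
      by (rule Bochner_Integration.integral_sum[symmetric]) (rule i)
    also have "\<dots> \<le> (\<integral>w. A.square_sum T n w + B.square_sum T n w \<partial>?P)"
    proof (rule integral_mono_AE)
      show "integrable ?P (\<lambda>w. \<Sum>i<2^n. (D (Suc i) w - D i w)\<^sup>2)"
        by (rule Bochner_Integration.integrable_sum) (rule i)
      show "integrable ?P (\<lambda>w. A.square_sum T n w + B.square_sum T n w)"
        by (intro Bochner_Integration.integrable_add A.integrable_square_sum B.integrable_square_sum T)
      show "AE w in ?P. (\<Sum>i<2^n. (D (Suc i) w - D i w)\<^sup>2) \<le> A.square_sum T n w + B.square_sum T n w"
        using A.AE_finite_path B.AE_finite_path
      proof eventually_elim
        case (elim w)
        have "(D (Suc i) w - D i w)\<^sup>2 \<le> (A.Ar (real (Suc i) * \<eta>) w - A.Ar (real i * \<eta>) w)\<^sup>2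
            + (B.Ar (real (Suc i) * \<eta>) w - B.Ar (real i * \<eta>) w)\<^sup>2" for i
        proof -
          define r s where "r = A.Ar (real (Suc i) * \<eta>) w - A.Ar (real i * \<eta>) w"
            and "s = B.Ar (real (Suc i) * \<eta>) w - B.Ar (real i * \<eta>) w"
          have rs: "0 \<le> r" "0 \<le> s"
            using A.finite_path_real(3)[OF elim(1) A.grid(1,2)[OF \<alpha> \<eta>]] B.finite_path_real(3)[OF elim(2) A.grid(1,2)[OF \<alpha> \<eta>]]
            by (simp_all add: r_def s_def)
          let ?w = "exp (- \<alpha> * (real (Suc i) * \<eta>))"
          have "D (Suc i) w - D i w = ?w * (r - s)"
            by (simp add: D_def A.partial_sum_def B.partial_sum_def A.weight_def B.weight_def r_def s_def algebra_simps)
          then have "(D (Suc i) w - D i w)\<^sup>2 = ?w\<^sup>2 * (r - s)\<^sup>2" by (simp add: power_mult_distrib)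
          also have "\<dots> \<le> 1 * (r - s)\<^sup>2"
            using \<alpha> \<eta> by (intro mult_right_mono power_le_one) auto
          also have "\<dots> \<le> r\<^sup>2 + s\<^sup>2" using mult_nonneg_nonneg[OF rs] by (simp add: power2_diff)
          finally show ?thesis by (simp add: r_def s_def)
        qed
        then show ?case
          unfolding A.square_sum_def B.square_sum_def \<eta>_def[symmetric] sum.distrib[symmetric] by (intro sum_mono)
      qed
    qed
    also have "\<dots> = (\<integral>w. A.square_sum T n w \<partial>?P) + (\<integral>w. B.square_sum T n w \<partial>?P)"
      by (intro Bochner_Integration.integral_add A.integrable_square_sum B.integrable_square_sum T)
    finally show ?thesis .
  qed
  have "(\<integral>w. (S w)\<^sup>2 \<partial>?P) \<le> 8 * (2 * \<epsilon> n * ((\<integral>w. Y 0 w \<partial>?P) + (\<integral>w. W 0 w \<partial>?P))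
      + (\<Sum>i<2^n. (\<integral>w. (D (Suc i) w - D i w)\<^sup>2 \<partial>?P))) + 2 * (\<epsilon> n)\<^sup>2"
    unfolding S_eq by (rule maximal_bound(2))
  also have "\<dots> \<le> 8 * (2 * \<epsilon> n * c
      + ((\<integral>w. A.square_sum T n w \<partial>?P) + (\<integral>w. B.square_sum T n w \<partial>?P))) + 2 * (\<epsilon> n)\<^sup>2"
    using \<epsilon>_nonneg by (intro add_mono mult_left_mono Y0 Dsum) auto
  finally show "(\<integral>w. (S w)\<^sup>2 \<partial>?P) \<le> 8 * (2 * \<epsilon> n * c
      + ((\<integral>w. A.square_sum T n w \<partial>?P) + (\<integral>w. B.square_sum T n w \<partial>?P))) + 2 * (\<epsilon> n)\<^sup>2" .
qed

definition "q = 1 - exp (- \<alpha> * T)"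

lemma q_nonneg: "0 \<le> q" using \<alpha> T by (simp add: q_def)

definition "moments x = (\<integral>w. (A.Ar T w)\<^sup>2 \<partial>A.\<P> (Some x)) + (\<integral>w. (B.Ar T w)\<^sup>2 \<partial>A.\<P> (Some x))"

definition "dyadic n w = Max ((\<lambda>k. (A.Ar (real k * (T / 2^n)) w - B.Ar (real k * (T / 2^n)) w)\<^sup>2) ` {..2^n})"

lemma dyadic_measurable: "dyadic n \<in> borel_measurable (A.\<P> x)"
  unfolding dyadic_def
proof (rule borel_measurable_Max)
  fix k :: nat
  have "0 \<le> real k * (T / 2^n)" using T by simp
  then show "(\<lambda>w. (A.Ar (real k * (T / 2^n)) w - B.Ar (real k * (T / 2^n)) w)\<^sup>2) \<in> borel_measurable (A.\<P> x)"
    by (intro borel_measurable_power borel_measurable_diff A.Ar_\<P> B.Ar_\<P>)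
qed auto

text \<open>Up to T every weight is at least exp(-\<alpha> T) = 1 - q, so
  \<open>discounted_square_le\<close> applies at each grid point with the same remainder, which
  therefore passes through the maximum.\<close>

lemma expectation_dyadic:
  "(\<integral>\<^sup>+w. ennreal (dyadic n w) \<partial>A.\<P> (Some x)) \<le> ennreal (8 * (2 * \<epsilon> n * c
      + ((\<integral>w. A.square_sum T n w \<partial>A.\<P> (Some x)) + (\<integral>w. B.square_sum T n w \<partial>A.\<P> (Some x)))) + 2 * (\<epsilon> n)\<^sup>2
      + 2 * q * moments x)"
proof -
  define \<eta> where "\<eta> = T / 2^n"
  have \<eta>: "0 < \<eta>" using T by (simp add: \<eta>_def)
  let ?P = "A.\<P> (Some x)"
  define S where "S w = Max ((\<lambda>i. \<bar>A.partial_sum \<alpha> \<eta> i w - B.partial_sum \<alpha> \<eta> i w\<bar>) ` {..2^n})" for w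
  note S = discounted_maximal[where n=n and x=x, folded \<eta>_def, folded S_def]
  have iA: "integrable ?P (\<lambda>w. (A.Ar T w)\<^sup>2)" "integrable ?P (\<lambda>w. (B.Ar T w)\<^sup>2)"
    using A.square_integrable_A[OF T] B.square_integrable_A[OF T] by (simp_all add: square_integrable_def)
  have int: "integrable ?P (\<lambda>w. (S w)\<^sup>2 + 2 * q * ((A.Ar T w)\<^sup>2 + (B.Ar T w)\<^sup>2))"
    using S(1) iA by simp
  have le: "AE w in ?P. dyadic n w \<le> (S w)\<^sup>2 + 2 * q * ((A.Ar T w)\<^sup>2 + (B.Ar T w)\<^sup>2)"
    using A.AE_finite_path B.AE_finite_path
  proof eventually_elim
    case (elim w)
    note fA = A.finite_path_real[OF elim(1)] and fB = B.finite_path_real[OF elim(2)]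
    show ?case
      unfolding dyadic_def \<eta>_def[symmetric]
    proof (rule Max.boundedI)
      fix v assume "v \<in> (\<lambda>k. (A.Ar (real k * \<eta>) w - B.Ar (real k * \<eta>) w)\<^sup>2) ` {..2^n}"
      then obtain k where k: "k \<le> 2^n" and v: "v = (A.Ar (real k * \<eta>) w - B.Ar (real k * \<eta>) w)\<^sup>2" by auto
      have tT: "real j * \<eta> \<le> T" if "j \<le> 2^n" for j
        using A.grid(3)[OF \<alpha> \<eta> that] by (simp add: \<eta>_def)
      have "v \<le> (A.partial_sum \<alpha> \<eta> k w - B.partial_sum \<alpha> \<eta> k w)\<^sup>2 + 2 * q * ((A.Ar T w)\<^sup>2 + (B.Ar T w)\<^sup>2)"
        unfolding v A.partial_sum_def B.partial_sum_def A.weight_def B.weight_def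
      proof (rule discounted_square_le)
        show "A.Ar (real 0 * \<eta>) w = 0" "B.Ar (real 0 * \<eta>) w = 0" using fA(1) fB(1) by simp_all
        show "A.Ar (real i * \<eta>) w \<le> A.Ar (real (Suc i) * \<eta>) w" "B.Ar (real i * \<eta>) w \<le> B.Ar (real (Suc i) * \<eta>) w" for i
          by (rule fA(3) fB(3); rule A.grid[OF \<alpha> \<eta>])+
        show "1 - q \<le> exp (- \<alpha> * (real (Suc i) * \<eta>))" "exp (- \<alpha> * (real (Suc i) * \<eta>)) \<le> 1" if "i < k" for i
          using tT[of "Suc i"] that k \<alpha> \<eta> by (auto simp: q_def simp del: of_nat_Suc)
        show "A.Ar (real k * \<eta>) w \<le> A.Ar T w" "B.Ar (real k * \<eta>) w \<le> B.Ar T w"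
          by (rule fA(3) fB(3); rule A.grid(1)[OF \<alpha> \<eta>] tT[OF k])+
      qed (rule q_nonneg)
      also have "(A.partial_sum \<alpha> \<eta> k w - B.partial_sum \<alpha> \<eta> k w)\<^sup>2 \<le> (S w)\<^sup>2"
      proof -
        have "\<bar>A.partial_sum \<alpha> \<eta> k w - B.partial_sum \<alpha> \<eta> k w\<bar> \<le> S w" unfolding S_def using k by (intro Max_ge) auto
        then show ?thesis by (metis abs_ge_zero power2_abs power_mono)
      qed
      finally show "v \<le> (S w)\<^sup>2 + 2 * q * ((A.Ar T w)\<^sup>2 + (B.Ar T w)\<^sup>2)" by simp
    qed auto
  qed
  have "(\<integral>\<^sup>+w. ennreal (dyadic n w) \<partial>?P) \<le> (\<integral>\<^sup>+w. ennreal ((S w)\<^sup>2 + 2 * q * ((A.Ar T w)\<^sup>2 + (B.Ar T w)\<^sup>2)) \<partial>?P)"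
  proof (rule nn_integral_mono_AE)
    show "AE w in ?P. ennreal (dyadic n w) \<le> ennreal ((S w)\<^sup>2 + 2 * q * ((A.Ar T w)\<^sup>2 + (B.Ar T w)\<^sup>2))"
      using le by eventually_elim (rule ennreal_leI)
  qed
  also have "\<dots> = ennreal (\<integral>w. (S w)\<^sup>2 + 2 * q * ((A.Ar T w)\<^sup>2 + (B.Ar T w)\<^sup>2) \<partial>?P)"
    by (rule nn_integral_eq_integral[OF int]) (use q_nonneg in simp)
  also have "(\<integral>w. (S w)\<^sup>2 + 2 * q * ((A.Ar T w)\<^sup>2 + (B.Ar T w)\<^sup>2) \<partial>?P) = (\<integral>w. (S w)\<^sup>2 \<partial>?P) + 2 * q * moments x"
    using S(1) iA by (simp add: moments_def)
  finally show ?thesis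
    by (rule order_trans) (intro ennreal_leI add_right_mono S(2))
qed

lemma moments_le: "ennreal (moments x) \<le> ennreal (2 * exp (2 * T)) * ((sup_norm (potential p 1 \<mu>))\<^sup>2 + (sup_norm (potential p 1 \<nu>))\<^sup>2)"
proof -
  have e: "2 * (ennreal (exp T) * r)\<^sup>2 = ennreal (2 * exp (2 * T)) * r\<^sup>2" for r
  proof -
    have "exp (2 * T) = exp T * exp T" by (simp add: exp_add[symmetric])
    then show ?thesis by (simp add: power2_eq_square ennreal_mult' mult.assoc mult.left_commute)
  qed
  have "ennreal (moments x) = ennreal (\<integral>w. (A.Ar T w)\<^sup>2 \<partial>A.\<P> (Some x)) + ennreal (\<integral>w. (B.Ar T w)\<^sup>2 \<partial>A.\<P> (Some x))"
    unfolding moments_def by (rule ennreal_plus) auto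
  also have "\<dots> \<le> 2 * (ennreal (exp T) * sup_norm (potential p 1 \<mu>))\<^sup>2 + 2 * (ennreal (exp T) * sup_norm (potential p 1 \<nu>))\<^sup>2"
    by (intro add_mono A.second_moment_real B.second_moment_real T)
  finally show ?thesis unfolding e by (simp add: distrib_left)
qed

lemma sup_square_le_dyadic:
  "AE w in A.\<P> (Some x). (SUP t\<in>{0..T}. (abs_diff (A t w) (B t w))\<^sup>2) \<le> (SUP n. ennreal (dyadic n w))"
  using A.AE_finite_path B.AE_finite_path
proof eventually_elim
  case (elim w)
  note fA = A.finite_path_real[OF elim(1)] and fB = B.finite_path_real[OF elim(2)]
  have "(SUP t\<in>{0..T}. (abs_diff (A t w) (B t w))\<^sup>2) = (SUP t\<in>{0..T}. ennreal ((A.Ar t w - B.Ar t w)\<^sup>2))"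
  proof (rule SUP_cong[OF refl])
    fix t assume "t \<in> {0..T}"
    then have "abs_diff (A t w) (B t w) = ennreal \<bar>A.Ar t w - B.Ar t w\<bar>"
      using fA(2)[of t] fB(2)[of t] abs_diff_ennreal by (metis atLeastAtMost_iff enn2real_nonneg)
    then show "(abs_diff (A t w) (B t w))\<^sup>2 = ennreal ((A.Ar t w - B.Ar t w)\<^sup>2)"
      by (simp add: ennreal_power)
  qed
  also have "\<dots> \<le> (SUP n. ennreal (dyadic n w))"
    unfolding dyadic_def
  proof (rule SUP_le_dyadic_SUP[OF T])
    have "{0..T} \<subseteq> {0..}" by auto
    then show "continuous_on {0..T} (\<lambda>t. (A.Ar t w - B.Ar t w)\<^sup>2)"
      using fA(5) fB(5) by (intro continuous_intros) (auto intro: continuous_on_subset)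
  qed
  finally show ?case .
qed

lemma expectation_sup_square_le:
  "(\<integral>\<^sup>+w. (SUP t\<in>{0..T}. (abs_diff (A t w) (B t w))\<^sup>2) \<partial>law Z (Some x))
     \<le> 18 * (sup_norm (potential p \<alpha> \<mu>) + sup_norm (potential p \<alpha> \<nu>))
          * sup_norm (\<lambda>x. abs_diff (potential p \<alpha> \<mu> x) (potential p \<alpha> \<nu> x))
       + ennreal (4 * exp (2 * T) * (1 - exp (- \<alpha> * T)))
          * ((sup_norm (potential p 1 \<mu>))\<^sup>2 + (sup_norm (potential p 1 \<nu>))\<^sup>2)"
proof -
  let ?P = "A.\<P> (Some x)"
  define b where "b n = 8 * (2 * \<epsilon> n * c
      + ((\<integral>w. A.square_sum T n w \<partial>?P) + (\<integral>w. B.square_sum T n w \<partial>?P))) + 2 * (\<epsilon> n)\<^sup>2 + 2 * q * moments x" for n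
  \<comment> \<open>Both quadratic variations vanish and the error of the Riemann sums disappears,
    which leaves \<delta> in place of \<open>\<epsilon> n\<close>.\<close>
  have "b \<longlonglongrightarrow> 8 * (2 * \<delta> * c + (0 + 0)) + 2 * \<delta>\<^sup>2 + 2 * q * moments x"
    unfolding b_def
    by (intro tendsto_intros \<epsilon>_tendsto A.expectation_square_sum_tendsto[OF T] B.expectation_square_sum_tendsto[OF T])
  then have b: "(\<lambda>n. ennreal (b n)) \<longlonglongrightarrow> ennreal (16 * \<delta> * c + 2 * \<delta>\<^sup>2 + 2 * q * moments x)"
    by (intro tendsto_ennrealI) (simp add: mult.assoc)
  have inc: "incseq (\<lambda>n w. ennreal (dyadic n w))"
    unfolding dyadic_def by (intro monoI le_funI ennreal_leI dyadic_Max_mono)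
  have mono: "incseq (\<lambda>n. \<integral>\<^sup>+w. ennreal (dyadic n w) \<partial>?P)"
    using inc by (intro monoI nn_integral_mono) (auto simp: mono_def le_fun_def)
  have "(\<integral>\<^sup>+w. (SUP t\<in>{0..T}. (abs_diff (A t w) (B t w))\<^sup>2) \<partial>law Z (Some x))
      \<le> (\<integral>\<^sup>+w. (SUP n. ennreal (dyadic n w)) \<partial>?P)"
    unfolding A.nn_integral_\<P>[symmetric] by (rule nn_integral_mono_AE[OF sup_square_le_dyadic])
  also have "\<dots> = (SUP n. \<integral>\<^sup>+w. ennreal (dyadic n w) \<partial>?P)"
    by (rule nn_integral_monotone_convergence_SUP[OF inc]) (use dyadic_measurable in measurable)
  also have "\<dots> \<le> ennreal (16 * \<delta> * c + 2 * \<delta>\<^sup>2 + 2 * q * moments x)"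
    by (rule LIMSEQ_le[OF LIMSEQ_SUP[OF mono] b]) (use expectation_dyadic in \<open>auto simp: b_def\<close>)
  \<comment> \<open>The constant 18 is 16 + 2: since \<delta> is at most c, the square of \<delta>
    is absorbed into c \<delta>.\<close>
  also have "\<dots> \<le> ennreal (18 * c * \<delta> + 2 * q * moments x)"
    using mult_left_mono[OF \<delta>(3,2)] by (intro ennreal_leI) (simp add: power2_eq_square algebra_simps)
  also have "\<dots> = 18 * ennreal c * ennreal \<delta> + ennreal (2 * q) * ennreal (moments x)"
  proof -
    have "0 \<le> moments x" by (simp add: moments_def)
    then show ?thesis
      using c_nonneg \<delta>(2) q_nonneg by (simp add: ennreal_plus ennreal_mult)
  qed
  also have "\<dots> \<le> 18 * ennreal c * ennreal \<delta> + ennreal (2 * q) *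
      (ennreal (2 * exp (2 * T)) * ((sup_norm (potential p 1 \<mu>))\<^sup>2 + (sup_norm (potential p 1 \<nu>))\<^sup>2))"
    by (intro add_left_mono mult_left_mono moments_le) simp
  also have "ennreal c = sup_norm (potential p \<alpha> \<mu>) + sup_norm (potential p \<alpha> \<nu>)"
    using A.potential_finite[OF \<alpha>] B.potential_finite[OF \<alpha>] by (simp add: c_def ennreal_plus)
  also have "ennreal \<delta> = sup_norm (\<lambda>x. abs_diff (potential p \<alpha> \<mu> x) (potential p \<alpha> \<nu> x))"
    by (rule \<delta>(1)[symmetric])
  \<comment> \<open>The constant 4 is 2 from the coefficient 2 q of the remainder times 2 from the
    second moments.\<close>
  also have "ennreal (2 * q) * (ennreal (2 * exp (2 * T)) * ((sup_norm (potential p 1 \<mu>))\<^sup>2 + (sup_norm (potential p 1 \<nu>))\<^sup>2))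
      = ennreal (4 * exp (2 * T) * (1 - exp (- \<alpha> * T))) * ((sup_norm (potential p 1 \<mu>))\<^sup>2 + (sup_norm (potential p 1 \<nu>))\<^sup>2)"
  proof -
    have "4 * exp (2 * T) * (1 - exp (- \<alpha> * T)) = (2 * q) * (2 * exp (2 * T))" by (simp add: q_def)
    then show ?thesis using q_nonneg by (simp only: ennreal_mult' mult.assoc)
  qed
  finally show ?thesis .
qed

end

theorem theorem1p6:
  fixes Z :: "('w, 's::{metric_space, second_countable_topology}) process"
    and Zh :: "('v, 's) process"
    and m \<mu> \<nu> :: "'s measure"
    and p :: "real \<Rightarrow> 's \<Rightarrow> 's \<Rightarrow> ennreal"
    and A B :: "real \<Rightarrow> 'w \<Rightarrow> ennreal"
    and \<alpha> T :: real
  assumes "locally_compact_space (euclidean :: 's topology)"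
    and "standard_process Z" and "standard_process Zh"
    and "duality_density Z Zh m p"
    and "\<mu> \<in> S00 Z p" and "\<nu> \<in> S00 Z p"
    and "PCAF Z A" and "Revuz Z p A \<mu>"
    and "PCAF Z B" and "Revuz Z p B \<nu>"
    and "\<alpha> > 0" and "T > 0"
  shows "(SUP x. \<integral>\<^sup>+\<omega>. (SUP t\<in>{0..T}. (abs_diff (A t \<omega>) (B t \<omega>))\<^sup>2) \<partial>law Z (Some x))
     \<le> 18 * (sup_norm (potential p \<alpha> \<mu>) + sup_norm (potential p \<alpha> \<nu>))
          * sup_norm (\<lambda>x. abs_diff (potential p \<alpha> \<mu> x) (potential p \<alpha> \<nu> x))
       + ennreal (4 * exp (2 * T) * (1 - exp (- \<alpha> * T)))
          * ((sup_norm (potential p 1 \<mu>))\<^sup>2 + (sup_norm (potential p 1 \<nu>))\<^sup>2)"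
proof (rule SUP_least)
  fix x
  interpret revuz_pair Z p A \<mu> B \<nu> \<alpha> T
    using assms by unfold_locales (auto simp: S00_def)
  show "(\<integral>\<^sup>+\<omega>. (SUP t\<in>{0..T}. (abs_diff (A t \<omega>) (B t \<omega>))\<^sup>2) \<partial>law Z (Some x))
     \<le> 18 * (sup_norm (potential p \<alpha> \<mu>) + sup_norm (potential p \<alpha> \<nu>))
          * sup_norm (\<lambda>x. abs_diff (potential p \<alpha> \<mu> x) (potential p \<alpha> \<nu> x))
       + ennreal (4 * exp (2 * T) * (1 - exp (- \<alpha> * T)))
          * ((sup_norm (potential p 1 \<mu>))\<^sup>2 + (sup_norm (potential p 1 \<nu>))\<^sup>2)"
    by (rule expectation_sup_square_le)
qed

end
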